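(* Let $\mu$ be the probability measure $\mu(\mathrm{d}x)=Z_\mu^{-1}\mathrm{e}^{-U(x)}\,\mathrm{d}x$ on $\mathbb{R}^n$ described in the context, with $V$ $\rho$-convex, $\rho>0$. Then for all $f\in H^1(\mu)$, $$\mathrm{ent}_\mu(f^2)\leq \frac{2}{\rho}\int_{\mathbb{R}^n}|\nabla f|^2\,\mathrm{d}\mu .$$ This holds in particular with $\rho=n$ when $\mu$ is the beta Hermite ensemble, for all $\beta>0$.
   Context: Let $n\geq 1$ be an integer and $|\cdot|$ the Euclidean norm on $\mathbb{R}^n$. For $\rho\in\mathbb{R}$, a function $\phi:\mathbb{R}^n\to\mathbb{R}\cup\{+\infty\}$ is called $\rho$-convex when $x\mapsto \phi(x)-\rho|x|^2/2$ is convex. Setting: $V:\mathbb{R}^n\to\mathbb{R}$ is $\rho$-convex for some $\rho>0$; $W:\mathbb{R}\to\mathbb{R}\cup\{+\infty\}$ is convex with domain $(0,+\infty)$, i.e. $W$ is finite on $(0,+\infty)$ and $W\equiv+\infty$ on $(-\infty,0]$. Set $U(x)=V(x)+\sum_{i<j}W(x_i-x_j)\in\mathbb{R}\cup\{+\infty\}$, which is finite exactly on $D=\{x\in\mathbb{R}^n: x_1>\cdots>x_n\}$. Assume $Z_\mu=\int_{\mathbb{R}^n}\mathrm{e}^{-U(x)}\,\mathrm{d}x<\infty$ and let $\mu$ be the probability measure with density $\mathrm{e}^{-U}/Z_\mu$ with respect to Lebesgue measure. Beta Hermite ensemble ($\beta>0$): the case $V(x)=\frac n2|x|^2$, $W(u)=-\beta\log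 u$ for $u>0$ and $W(u)=+\infty$ for $u\le 0$, i.e. $\mathrm{d}\mu(x)=Z_\mu^{-1}\mathrm{e}^{-\frac n2|x|^2}\prod_{i<j}(x_i-x_j)^\beta\,\mathbf{1}_{\{x_1\geq\cdots\geq x_n\}}\,\mathrm{d}x$. $L^2(\mu)$ is the space of measurable functions $\mathbb{R}^n\to\mathbb{R}$ square integrable with respect to $\mu$; $H^1(\mu)$ is the Sobolev space of functions in $L^2(\mu)$ with weak derivative in $L^2(\mu)$ in the sense of Schwartz distributions. For $g\geq 0$, the entropy is $\mathrm{ent}_\mu(g)=\int g\log g\,\mathrm{d}\mu-\left(\int g\,\mathrm{d}\mu\right)\log\left(\int g\,\mathrm{d}\mu\right)$, with the convention $0\log 0=0$. *)

theory Defs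
  imports "HOL-Analysis.Analysis"
begin

text \<open>
  The space is \<open>real ^ 'n\<close> with \<open>'n\<close> finite and linearly ordered; the order stands for that
  of \<open>{1, ..., n}\<close>, where \<open>n = CARD('n)\<close>. Values \<open>+\<infinity>\<close> of potentials live in \<^typ>\<open>ereal\<close>.
\<close>

definition convex_ereal :: "('a::real_vector \<Rightarrow> ereal) \<Rightarrow> bool" where
  "convex_ereal \<phi> \<longleftrightarrow> (\<forall>x. \<phi> x \<noteq> -\<infinity>) \<and>
     (\<forall>x y. \<forall>u\<ge>0. \<forall>v\<ge>0. u + v = 1 \<longrightarrow>
        \<phi> (u *\<^sub>R x + v *\<^sub>R y) \<le> ereal u * \<phi> x + ereal v * \<phi> y)"

definition rho_convex :: "real \<Rightarrow> ('a::real_normed_vector \<Rightarrow> ereal) \<Rightarrow> bool" where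
  "rho_convex \<rho> \<phi> \<longleftrightarrow> convex_ereal (\<lambda>x. \<phi> x - ereal (\<rho> * (norm x)\<^sup>2 / 2))"

definition energy ::
  "(real ^ 'n::{finite,linorder} \<Rightarrow> real) \<Rightarrow> (real \<Rightarrow> ereal) \<Rightarrow> real ^ 'n::{finite,linorder} \<Rightarrow> ereal" where
  "energy V W x = ereal (V x) + (\<Sum>(i, j)\<in>{(i, j). i < j}. W (x $ i - x $ j))"

definition chamber :: "(real ^ 'n::{finite,linorder}) set" where
  "chamber = {x. \<forall>i j. i < j \<longrightarrow> x $ i > x $ j}"

text \<open>The value of \<^const>\<open>real_of_ereal\<close> at \<open>\<infinity>\<close> is \<open>0\<close>, hence the case distinction.\<close>

definition exp_neg :: "ereal \<Rightarrow> real" where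
  "exp_neg u = (if u = \<infinity> then 0 else exp (- real_of_ereal u))"

definition partition_const :: "('a::euclidean_space \<Rightarrow> ereal) \<Rightarrow> ennreal" where
  "partition_const U = (\<integral>\<^sup>+ x. ennreal (exp_neg (U x)) \<partial>lebesgue)"

definition gibbs_measure :: "('a::euclidean_space \<Rightarrow> ereal) \<Rightarrow> 'a measure" where
  "gibbs_measure U = density lebesgue (\<lambda>x. ennreal (exp_neg (U x)) / partition_const U)"

definition gibbs_setting ::
  "real \<Rightarrow> (real ^ 'n::{finite,linorder} \<Rightarrow> real) \<Rightarrow> (real \<Rightarrow> ereal) \<Rightarrow> bool" where
  "gibbs_setting \<rho> V W \<longleftrightarrow>
     \<rho> > 0 \<and> rho_convex \<rho> (\<lambda>x. ereal (V x)) \<and>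
     convex_ereal W \<and> (\<forall>u>0. W u \<noteq> \<infinity>) \<and> (\<forall>u\<le>0. W u = \<infinity>) \<and>
     partition_const (energy V W) < \<infinity>"

definition hermite_V :: "real ^ 'n::{finite,linorder} \<Rightarrow> real" where
  "hermite_V x = real CARD('n) / 2 * (norm x)\<^sup>2"

definition hermite_W :: "real \<Rightarrow> real \<Rightarrow> ereal" where
  "hermite_W \<beta> u = (if u > 0 then ereal (- \<beta> * ln u) else \<infinity>)"

primrec C_k :: "nat \<Rightarrow> ('a::real_normed_vector \<Rightarrow> 'b::real_normed_vector) \<Rightarrow> bool" where
  "C_k 0 \<phi> \<longleftrightarrow> continuous_on UNIV \<phi>"
| "C_k (Suc k) \<phi> \<longleftrightarrow> (\<forall>x. \<phi> differentiable (at x)) \<and>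
     (\<forall>v. C_k k (\<lambda>x. frechet_derivative \<phi> (at x) v))"

definition test_functions :: "'a::real_normed_vector set \<Rightarrow> ('a \<Rightarrow> real) set" where
  "test_functions D = {\<phi>. (\<forall>k. C_k k \<phi>) \<and> compact (closure {x. \<phi> x \<noteq> 0}) \<and>
     closure {x. \<phi> x \<noteq> 0} \<subseteq> D}"

text \<open>
  \<open>g\<close> is the gradient of \<open>f\<close> as a distribution on the open set \<open>D\<close>. The product with a test
  function vanishes off a compact subset of \<open>D\<close>, so integrating over the whole space amounts to
  integrating over \<open>D\<close>.
\<close>

definition weak_gradient_on ::
  "(real ^ 'n) set \<Rightarrow> (real ^ 'n \<Rightarrow> real) \<Rightarrow> (real ^ 'n \<Rightarrow> real ^ 'n) \<Rightarrow> bool" where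
  "weak_gradient_on D f g \<longleftrightarrow>
     (\<forall>K. compact K \<and> K \<subseteq> D \<longrightarrow> f absolutely_integrable_on K \<and> g absolutely_integrable_on K) \<and>
     (\<forall>\<phi>\<in>test_functions D. \<forall>i.
        (\<integral>x. f x * frechet_derivative \<phi> (at x) (axis i 1) \<partial>lebesgue) =
        - (\<integral>x. g x $ i * \<phi> x \<partial>lebesgue))"

definition L2 :: "'a measure \<Rightarrow> ('a \<Rightarrow> 'b::euclidean_space) set" where
  "L2 M = {f \<in> borel_measurable M. integrable M (\<lambda>x. (norm (f x))\<^sup>2)}"

text \<open>
  Below, \<open>M\<close> is a measure carried by the open set \<open>D\<close> with a density that is bounded away from
  zero on each compact subset of \<open>D\<close>. Members of \<open>L2 M\<close> are then locally integrable on \<open>D\<close>, but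
  need not be so near the boundary of \<open>D\<close>, and their values off \<open>D\<close> are irrelevant. Weak
  derivatives are therefore understood as distributions on \<open>D\<close>; a weak derivative on the whole
  space is in particular one on \<open>D\<close>.
\<close>

definition H1 :: "(real ^ 'n) measure \<Rightarrow> (real ^ 'n) set \<Rightarrow> (real ^ 'n \<Rightarrow> real) set" where
  "H1 M D = {f \<in> L2 M. \<exists>g\<in>L2 M. weak_gradient_on D f g}"

text \<open>
  Bochner integrals of non-integrable functions are \<open>0\<close>, while the integral of \<open>g log g\<close> may
  be \<open>+\<infinity>\<close>. It is never \<open>-\<infinity>\<close> for a finite measure, since \<open>t log t \<ge> - 1 / e\<close>.
\<close>

definition ereal_integral :: "'a measure \<Rightarrow> ('a \<Rightarrow> real) \<Rightarrow> ereal" where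
  "ereal_integral M h =
     enn2ereal (\<integral>\<^sup>+ x. ennreal (h x) \<partial>M) - enn2ereal (\<integral>\<^sup>+ x. ennreal (- h x) \<partial>M)"

text \<open>Meant for \<open>g \<ge> 0\<close> integrable; the convention \<open>0 log 0 = 0\<close> is automatic.\<close>

definition ent :: "'a measure \<Rightarrow> ('a \<Rightarrow> real) \<Rightarrow> ereal" where
  "ent M g = ereal_integral M (\<lambda>x. g x * ln (g x)) -
     ereal ((\<integral>x. g x \<partial>M) * ln (\<integral>x. g x \<partial>M))"

end

theory Submission
  imports Defs "HOL-Probability.Distributions"
begin

text \<open>
  Write the measure as \<open>e^{-E} dx\<close> on the open convex chamber. The interaction is convex, so
  \<open>E\<close> has the modulus of convexity of \<open>V\<close>, and the inequality holds for every \<open>\<rho>\<close>-strongly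
  convex \<open>E\<close> on every nonempty open convex set \<open>D\<close> when \<open>e^{-E} dx\<close> is a probability measure
  on \<open>D\<close>. The argument takes place on compact subsets of \<open>D\<close>, so no boundary condition on the
  function arises.

  The source of the inequality is the argument of Bobkov and Ledoux. On a compact convex set
  \<open>K\<close>, the Prekopa-Leindler inequality with weights \<open>1 - s\<close> and \<open>s\<close> is applied to
  \<open>u = e^{G/(1-s) - E}\<close> and \<open>v = e^{-E}\<close>. At \<open>z = (1-s) x + s y\<close> strong convexity gains
  \<open>\<rho> s (1-s) |x-y|\<^sup>2 / 2 = \<rho> (1-s) |x-z|\<^sup>2 / (2s)\<close>, so a third function
  \<open>w = e^{G + c |q|\<^sup>2 - E}\<close> with \<open>c = s / (2 \<rho>) + O(s\<^sup>2)\<close> is admissible as soon as \<open>q\<close> is a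
  gradient of \<open>G\<close> up to a quadratic error: the term \<open>q(z) (x-z)\<close> is absorbed by completing the
  square. Prekopa-Leindler is an equality at \<open>s = 0\<close>, and its derivative there reads
  \<open>\<integral> G e^G - m ln (m/Z) \<le> (1 / 2 \<rho>) \<integral> |q|\<^sup>2 e^G\<close> with \<open>m = \<integral> e^G\<close> and \<open>Z\<close> the total mass. For
  \<open>e^G = f\<^sup>2\<close> this is the logarithmic Sobolev inequality. These steps are \<open>prekopa_leindler\<close>
  (by induction on the coordinates from one-dimensional Brunn-Minkowski),
  \<open>bobkov_ledoux_pointwise\<close>, \<open>log_sobolev_exponential\<close> and \<open>log_sobolev_compact\<close>.

  A Sobolev function is reached by mollification on \<open>K\<close>. The weak gradient, tested against the
  mollifier itself, makes the mollified \<open>g\<close> a gradient of the mollified \<open>f\<close> with quadratic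
  error (\<open>mollify_taylor\<close>). By Jensen's inequality and the uniform continuity of \<open>E\<close> near \<open>K\<close>,
  the squared weighted \<open>L\<^sup>2\<close> norm over \<open>K\<close> of a mollified function is at most \<open>1 + k\<close> times
  that of the function over all of \<open>D\<close>, with \<open>k\<close> as small as desired
  (\<open>log_sobolev_mollified\<close>). Hence only lower semicontinuity of the entropy is needed as the
  mollification radius tends to \<open>0\<close> and \<open>K\<close> exhausts \<open>D\<close>. It comes from Fatou's lemma, because
  the entropy is the minimum over \<open>c > 0\<close> of the integral of the nonnegative function
  \<open>entropy_gap c (f\<^sup>2)\<close>, attained at the mean. A constant added to \<open>f\<^sup>2\<close> keeps the means away
  from \<open>0\<close> and the logarithms bounded, and is removed at the end (\<open>log_sobolev_shifted\<close>,
  \<open>log_sobolev_gap\<close>).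

  For the beta Hermite ensemble what remains is that the partition function is finite: the
  logarithmic interaction grows at most linearly, so it costs at most half of the Gaussian
  exponent.
\<close>

section \<open>The Prekopa-Leindler inequality\<close>

lemma emeasure_lborel_inner_compact:
  fixes A :: "'a::euclidean_space set"
  assumes A: "A \<in> sets borel" and a: "a < emeasure lborel A"
  obtains K where "compact K" "K \<subseteq> A" "a < emeasure lborel K"
proof -
  let ?B = "\<lambda>n::nat. A \<inter> cball 0 (real n)"
  have inc: "incseq ?B"
    by (auto simp: incseq_def)
  have un: "(\<Union>n. ?B n) = A"
  proof -
    have "\<exists>n. norm x \<le> real n" for x :: 'a by (rule real_arch_simple)
    then show ?thesis by auto
  qed
  have "(SUP n. emeasure lborel (?B n)) = emeasure lborel A"
    using SUP_emeasure_incseq[of ?B lborel] inc A un by (auto simp: image_subset_iff)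
  then have "a < (SUP n. emeasure lborel (?B n))"
    using a by simp
  then obtain n where n: "a < emeasure lborel (?B n)"
    unfolding less_SUP_iff by blast
  let ?b = "emeasure lborel (?B n)"
  have fin: "?b < \<infinity>"
    by (rule emeasure_bounded_finite) (auto intro: bounded_subset[OF bounded_cball])
  define e where "e = enn2real (?b - a)"
  have pos: "0 < ?b - a" using n by (simp add: diff_gr0_ennreal)
  have fd: "?b - a < \<infinity>" using fin diff_le_self_ennreal le_less_trans by blast
  have e: "e > 0" "ennreal e = ?b - a"
    using pos fd unfolding e_def by (auto simp: enn2real_positive_iff)
  have Bs: "?B n \<in> sets lebesgue" using A by auto
  obtain T where T: "closed T" "T \<subseteq> ?B n" "?B n - T \<in> lmeasurable" "emeasure lebesgue (?B n - T) < ennreal e"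
    using sets_lebesgue_inner_closed[OF Bs e(1)] by metis
  have Tb: "T \<in> sets borel" using T(1) by simp
  have "?b = emeasure lborel T + emeasure lborel (?B n - T)"
    using T(2) Tb A by (subst plus_emeasure) (auto simp: Un_absorb1)
  also have "emeasure lborel (?B n - T) = emeasure lebesgue (?B n - T)"
    using A Tb by simp
  finally have eq: "?b = emeasure lborel T + emeasure lebesgue (?B n - T)" .
  have "a < emeasure lborel T"
  proof (rule ccontr)
    assume "\<not> ?thesis"
    then have le: "emeasure lborel T \<le> a" by simp
    have at: "a < \<infinity>" using n fin by auto
    have "emeasure lborel T + emeasure lebesgue (?B n - T) \<le> a + emeasure lebesgue (?B n - T)"
      using le by (rule add_right_mono)
    also have "\<dots> < a + ennreal e"
      using T(4) at by (simp add: ennreal_add_left_cancel_less)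
    also have "\<dots> = ?b" using n e(2) by (simp add: less_imp_le)
    finally show False using eq by simp
  qed
  moreover have "compact T"
    using T(1,2) bounded_subset[OF bounded_cball] by (auto simp: compact_eq_bounded_closed)
  ultimately show thesis using that T(2) by auto
qed

text \<open>
  The translates of \<open>t A\<close> by \<open>s min B\<close> and of \<open>s B\<close> by \<open>t max A\<close> both lie in \<open>C\<close>, and they
  meet only in the point \<open>t max A + s min B\<close>.
\<close>

lemma brunn_minkowski_real_compact:
  fixes A B C :: "real set"
  assumes t: "t > 0" and s: "s > 0"
    and A: "compact A" "A \<noteq> {}" and B: "compact B" "B \<noteq> {}" and C: "C \<in> sets borel"
    and sub: "\<And>a b. a \<in> A \<Longrightarrow> b \<in> B \<Longrightarrow> t * a + s * b \<in> C"
  shows "ennreal t * emeasure lborel A + ennreal s * emeasure lborel B \<le> emeasure lborel C"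
proof -
  obtain a where a: "a \<in> A" "\<And>x. x \<in> A \<Longrightarrow> x \<le> a"
    using compact_attains_sup[OF A] by blast
  obtain b where b: "b \<in> B" "\<And>x. x \<in> B \<Longrightarrow> b \<le> x"
    using compact_attains_inf[OF B] by blast
  let ?A = "(\<lambda>x. s * b + t *\<^sub>R x) ` A" and ?B = "(\<lambda>x. t * a + s *\<^sub>R x) ` B"
  have img: "emeasure lborel ((\<lambda>x. c + d *\<^sub>R x) ` S) = ennreal d * emeasure lborel S"
    if "d > 0" "compact S" for c d and S :: "real set"
  proof -
    have "(\<lambda>x. c + d *\<^sub>R x) ` S \<in> sets borel"
      using that by (intro borel_compact compact_continuous_image continuous_intros)
    then have "emeasure lborel ((\<lambda>x. c + d *\<^sub>R x) ` S) = emeasure lebesgue ((\<lambda>x. c + d *\<^sub>R x) ` S)"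
      by simp
    also have "\<dots> = ennreal d * emeasure lborel S"
      using emeasure_lebesgue_affine[of d c S] that borel_compact[OF that(2)]
      by (simp add: image_image add.commute)
    finally show ?thesis .
  qed
  have bA: "?A \<in> sets borel" and bB: "?B \<in> sets borel"
    using A B by (auto intro!: borel_compact compact_continuous_image continuous_intros)
  have int: "?A \<inter> ?B \<subseteq> {s * b + t * a}"
  proof
    fix z assume "z \<in> ?A \<inter> ?B"
    then obtain x y where xy: "x \<in> A" "y \<in> B" "z = s * b + t * x" "z = t * a + s * y" by auto
    have "t * x \<le> t * a" "s * b \<le> s * y" using a(2)[OF xy(1)] b(2)[OF xy(2)] t s by auto
    then have "t * x = t * a" using xy(3,4) by linarith
    then show "z \<in> {s * b + t * a}" using xy(3) by simp
  qed
  have null: "emeasure lborel (?A \<inter> ?B) = 0"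
    using int by (metis countable_subset countable_insert countable_empty emeasure_lborel_countable)
  have "ennreal t * emeasure lborel A + ennreal s * emeasure lborel B = emeasure lborel ?A + emeasure lborel ?B"
    using img[OF t A(1)] img[OF s B(1)] by simp
  also have "\<dots> = emeasure lborel ?A + emeasure lborel (?B - ?A)"
    using emeasure_Diff_null_set[of "?A \<inter> ?B" lborel ?B] null bA bB
    by (simp add: null_sets_def Diff_Int)
  also have "\<dots> = emeasure lborel (?A \<union> (?B - ?A))"
    using bA bB by (subst plus_emeasure) auto
  also have "\<dots> \<le> emeasure lborel C"
    using C sub[OF a(1)] sub[OF _ b(1)] by (intro emeasure_mono) (auto simp: add.commute)
  finally show ?thesis .
qed

text \<open>
  Inner regularity reduces this to compact sets. The approximating compact sets have to be
  nonempty, since even a null set \<open>A\<close> puts a translate of \<open>s B\<close> into \<open>C\<close>.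
\<close>

lemma brunn_minkowski_real:
  fixes A B C :: "real set"
  assumes t: "t > 0" and s: "s > 0"
    and A: "A \<in> sets borel" "A \<noteq> {}" and B: "B \<in> sets borel" "B \<noteq> {}" and C: "C \<in> sets borel"
    and sub: "\<And>a b. a \<in> A \<Longrightarrow> b \<in> B \<Longrightarrow> t * a + s * b \<in> C"
  shows "ennreal t * emeasure lborel A + ennreal s * emeasure lborel B \<le> emeasure lborel C"
proof -
  have inner: "(SUP K\<in>{K. compact K \<and> K \<noteq> {} \<and> K \<subseteq> S}. emeasure lborel K) = emeasure lborel S"
    if S: "S \<in> sets borel" "S \<noteq> {}" for S :: "real set"
  proof (rule antisym)
    show "emeasure lborel S \<le> (SUP K\<in>{K. compact K \<and> K \<noteq> {} \<and> K \<subseteq> S}. emeasure lborel K)"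
    proof (rule dense_le)
      fix a assume "a < emeasure lborel S"
      then obtain K where K: "compact K" "K \<subseteq> S" "a < emeasure lborel K"
        using emeasure_lborel_inner_compact[OF S(1)] by metis
      have "K \<noteq> {}" using K(3) by auto
      then show "a \<le> (SUP K\<in>{K. compact K \<and> K \<noteq> {} \<and> K \<subseteq> S}. emeasure lborel K)"
        using K by (intro SUP_upper2[of K]) auto
    qed
  qed (use S in \<open>auto intro!: SUP_least emeasure_mono\<close>)
  have ne: "{K. compact K \<and> K \<noteq> {} \<and> K \<subseteq> S} \<noteq> {}" if S: "S \<noteq> {}" for S :: "real set"
  proof -
    obtain x where "x \<in> S" using S by auto
    then have "{x} \<in> {K. compact K \<and> K \<noteq> {} \<and> K \<subseteq> S}" by auto
    then show ?thesis by blast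
  qed
  have sup: "ennreal t * (SUP K\<in>F. emeasure lborel K) + ennreal s * (SUP K\<in>G. emeasure lborel K)
      = (SUP L\<in>G. SUP K\<in>F. ennreal t * emeasure lborel K + ennreal s * emeasure lborel L)"
    if "F \<noteq> {}" "G \<noteq> {}" for F G :: "real set set"
    unfolding SUP_mult_left_ennreal using that
    by (simp add: ennreal_SUP_add_left ennreal_SUP_add_right)
  let ?F = "\<lambda>S. {K. compact K \<and> K \<noteq> {} \<and> K \<subseteq> S}"
  have "ennreal t * emeasure lborel A + ennreal s * emeasure lborel B
      = (SUP L\<in>?F B. SUP K\<in>?F A. ennreal t * emeasure lborel K + ennreal s * emeasure lborel L)"
    unfolding inner[OF A, symmetric] inner[OF B, symmetric] by (rule sup) (rule ne[OF A(2)] ne[OF B(2)])+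
  also have "\<dots> \<le> emeasure lborel C"
    by (intro SUP_least brunn_minkowski_real_compact[OF t s _ _ _ _ C] sub) auto
  finally show ?thesis .
qed

lemma nn_integral_layer_cake_unit:
  fixes h :: "real \<Rightarrow> real"
  assumes [measurable]: "h \<in> borel_measurable borel" and h: "\<And>x. 0 \<le> h x" "\<And>x. h x \<le> 1"
  shows "(\<integral>\<^sup>+x. ennreal (h x) \<partial>lborel) = (\<integral>\<^sup>+r\<in>{0<..<1}. emeasure lborel {x. r < h x} \<partial>lborel)"
proof -
  have "(\<integral>\<^sup>+x. ennreal (h x) \<partial>lborel) = (\<integral>\<^sup>+x. (\<integral>\<^sup>+r. indicator {p. 0 < snd p \<and> snd p < h (fst p)} (x, r) \<partial>lborel) \<partial>lborel)"
  proof (rule nn_integral_cong)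
    fix x
    have "(\<integral>\<^sup>+r. indicator {p. 0 < snd p \<and> snd p < h (fst p)} (x, r) \<partial>lborel) = (\<integral>\<^sup>+r. indicator {0<..<h x} r \<partial>lborel)"
      by (intro nn_integral_cong) (auto simp: indicator_def)
    also have "\<dots> = ennreal (h x)" using h by simp
    finally show "ennreal (h x) = (\<integral>\<^sup>+r. indicator {p. 0 < snd p \<and> snd p < h (fst p)} (x, r) \<partial>lborel)" by simp
  qed
  also have "\<dots> = (\<integral>\<^sup>+r. (\<integral>\<^sup>+x. indicator {p. 0 < snd p \<and> snd p < h (fst p)} (x, r) \<partial>lborel) \<partial>lborel)"
    by (rule lborel_pair.Fubini'[symmetric]) measurable
  also have "\<dots> = (\<integral>\<^sup>+r\<in>{0<..<1}. emeasure lborel {x. r < h x} \<partial>lborel)"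
  proof (rule nn_integral_cong)
    fix r
    have "(\<integral>\<^sup>+x. indicator {p. 0 < snd p \<and> snd p < h (fst p)} (x, r) \<partial>lborel)
      = (\<integral>\<^sup>+x. indicator {x. r < h x} x * indicator {0<..<1} r \<partial>lborel)"
      using h(2) by (intro nn_integral_cong) (auto simp: indicator_def intro: less_le_trans)
    also have "\<dots> = emeasure lborel {x. r < h x} * indicator {0<..<1} r"
      by (subst nn_integral_multc) (auto simp: nn_integral_indicator)
    finally show "(\<integral>\<^sup>+x. indicator {p. 0 < snd p \<and> snd p < h (fst p)} (x, r) \<partial>lborel)
       = emeasure lborel {x. r < h x} * indicator {0<..<1} r" .
  qed
  finally show ?thesis .
qed


text \<open>
  Superlevel sets of two functions are compared at equal fractions of their suprema, so the
  suprema have to be finite. A truncation of \<open>u\<close> at a high level still has integral above \<open>a\<close>;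
  here \<open>M\<close> is its supremum and \<open>h\<close> its quotient by \<open>M\<close>.
\<close>

lemma truncate_to_unit_range:
  fixes u :: "real \<Rightarrow> ennreal"
  assumes [measurable]: "u \<in> borel_measurable borel"
    and a: "0 \<le> a" "ennreal a < (\<integral>\<^sup>+x. u x \<partial>lborel)"
  obtains M h where "M > 0" "h \<in> borel_measurable borel" "\<And>x. 0 \<le> h x" "\<And>x. h x \<le> 1"
    "\<And>r. r < 1 \<Longrightarrow> \<exists>x. r < h x" "\<And>x. ennreal (M * h x) \<le> u x"
    "ennreal (a / M) \<le> (\<integral>\<^sup>+x. ennreal (h x) \<partial>lborel)"
proof -
  have "(\<integral>\<^sup>+x. u x \<partial>lborel) = (\<integral>\<^sup>+x. (SUP n::nat. min (u x) (of_nat n)) \<partial>lborel)"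
  proof (rule nn_integral_cong)
    fix x
    have "(SUP n::nat. min (u x) (of_nat n)) = inf (u x) (SUP n::nat. of_nat n)"
      unfolding inf_min[symmetric] inf_SUP by simp
    then show "u x = (SUP n::nat. min (u x) (of_nat n))"
      by (simp add: ennreal_SUP_of_nat_eq_top)
  qed
  also have "\<dots> = (SUP n::nat. \<integral>\<^sup>+x. min (u x) (of_nat n) \<partial>lborel)"
    by (intro nn_integral_monotone_convergence_SUP)
       (auto simp: incseq_def le_fun_def min_le_iff_disj)
  finally obtain n :: nat where n: "ennreal a < (\<integral>\<^sup>+x. min (u x) (of_nat n) \<partial>lborel)"
    using a(2) by (auto simp: less_SUP_iff)
  define u' where "u' = (\<lambda>x. enn2real (min (u x) (of_nat n)))"
  have [measurable]: "u' \<in> borel_measurable borel" unfolding u'_def by measurable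
  have u': "ennreal (u' x) = min (u x) (of_nat n)" for x
    unfolding u'_def by (intro ennreal_enn2real) (auto simp: min_less_iff_disj of_nat_less_top)
  have u0: "0 \<le> u' x" for x by (simp add: u'_def)
  have "ennreal (u' x) \<le> ennreal (real n)" for x
    unfolding u' by (simp add: ennreal_of_nat_eq_real_of_nat)
  then have un: "u' x \<le> real n" for x by simp
  define M where "M = (SUP x. u' x)"
  have bdd: "bdd_above (range u')" using un by (auto intro!: bdd_aboveI)
  have uM: "u' x \<le> M" for x unfolding M_def by (intro cSUP_upper bdd) auto
  have M: "M > 0"
  proof (rule ccontr)
    assume "\<not> M > 0"
    then have "u' x = 0" for x using uM[of x] u0[of x] by simp
    then have "min (u x) (of_nat n) = 0" for x using u'[of x] by simp
    then show False using n by simp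
  qed
  define h where "h x = u' x / M" for x
  show thesis
  proof
    show "M > 0" by fact
    show "h \<in> borel_measurable borel" unfolding h_def by measurable
    show "0 \<le> h x" "h x \<le> 1" for x using u0[of x] uM[of x] M by (auto simp: h_def)
    show "\<exists>x. r < h x" if "r < 1" for r
    proof -
      have "r * M < M" using that M by simp
      then have "\<exists>x\<in>UNIV. r * M < u' x" using less_cSUP_iff[of UNIV u' "r * M"] bdd by (simp add: M_def)
      then show ?thesis using M by (auto simp: h_def field_simps)
    qed
    show "ennreal (M * h x) \<le> u x" for x using M u'[of x] by (simp add: h_def)
    have "(\<integral>\<^sup>+x. min (u x) (of_nat n) \<partial>lborel) = (\<integral>\<^sup>+x. ennreal M * ennreal (h x) \<partial>lborel)"
      using M by (intro nn_integral_cong) (simp add: u'[symmetric] h_def u0 ennreal_mult[symmetric])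
    also have "\<dots> = ennreal M * (\<integral>\<^sup>+x. ennreal (h x) \<partial>lborel)"
      using \<open>h \<in> borel_measurable borel\<close> by (intro nn_integral_cmult) auto
    finally have "ennreal a \<le> ennreal M * (\<integral>\<^sup>+x. ennreal (h x) \<partial>lborel)" using n by simp
    then have "ennreal (1/M) * ennreal a \<le> ennreal (1/M) * (ennreal M * (\<integral>\<^sup>+x. ennreal (h x) \<partial>lborel))"
      by (rule mult_left_mono) simp
    also have "\<dots> = ennreal (1 / M * M) * (\<integral>\<^sup>+x. ennreal (h x) \<partial>lborel)"
      using M by (subst ennreal_mult) (auto simp: mult.assoc)
    finally show "ennreal (a / M) \<le> (\<integral>\<^sup>+x. ennreal (h x) \<partial>lborel)"
      using M a(1) by (simp add: ennreal_mult[symmetric])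
  qed
qed

text \<open>
  Superlevel sets of the normalised functions satisfy the hypothesis of Brunn-Minkowski at
  each level. Integrating over the level bounds the integral of \<open>w\<close> by an arithmetic mean,
  which dominates the geometric one.

  Real lower bounds \<open>a\<close> and \<open>b\<close> replace the values of \<open>u\<close> and \<open>v\<close>: this avoids powers of
  infinite values, and the conclusion has the shape of the hypothesis, as the induction on the
  dimension requires.
\<close>

lemma prekopa_leindler_real:
  fixes u v w :: "real \<Rightarrow> ennreal"
  assumes t: "t > 0" and s: "s > 0" and ts: "t + s = 1"
    and [measurable]: "u \<in> borel_measurable borel" "v \<in> borel_measurable borel" "w \<in> borel_measurable borel"
    and H: "\<And>x y a b. 0 \<le> a \<Longrightarrow> 0 \<le> b \<Longrightarrow> ennreal a < u x \<Longrightarrow> ennreal b < v y \<Longrightarrow>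
              ennreal (a powr t * b powr s) \<le> w (t * x + s * y)"
    and ab: "0 \<le> a" "0 \<le> b" "ennreal a < (\<integral>\<^sup>+x. u x \<partial>lborel)" "ennreal b < (\<integral>\<^sup>+x. v x \<partial>lborel)"
  shows "ennreal (a powr t * b powr s) \<le> (\<integral>\<^sup>+x. w x \<partial>lborel)"
proof (cases "a = 0 \<or> b = 0")
  case False
  with ab have ab0: "a > 0" "b > 0" by auto
  obtain M h where M: "M > 0" and [measurable]: "h \<in> borel_measurable borel"
    and h: "\<And>x. 0 \<le> h x" "\<And>x. h x \<le> 1" "\<And>r. r < 1 \<Longrightarrow> \<exists>x. r < h x"
      "\<And>x. ennreal (M * h x) \<le> u x" "ennreal (a / M) \<le> (\<integral>\<^sup>+x. ennreal (h x) \<partial>lborel)"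
    using truncate_to_unit_range[OF _ ab(1) ab(3)] by (metis assms(4))
  obtain N k where N: "N > 0" and [measurable]: "k \<in> borel_measurable borel"
    and k: "\<And>x. 0 \<le> k x" "\<And>x. k x \<le> 1" "\<And>r. r < 1 \<Longrightarrow> \<exists>x. r < k x"
      "\<And>x. ennreal (N * k x) \<le> v x" "ennreal (b / N) \<le> (\<integral>\<^sup>+x. ennreal (k x) \<partial>lborel)"
    using truncate_to_unit_range[OF _ ab(2) ab(4)] by (metis assms(5))
  define K where "K = M powr t * N powr s"
  have K: "K > 0" using M N by (simp add: K_def)
  have level: "ennreal t * emeasure lborel {x. r < h x} + ennreal s * emeasure lborel {x. r < k x}
      \<le> emeasure lborel {x. ennreal (K * r) \<le> w x}" if r: "0 < r" "r < 1" for r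
  proof (rule brunn_minkowski_real[OF t s])
    fix x y assume xy: "x \<in> {x. r < h x}" "y \<in> {x. r < k x}"
    have "ennreal (M * r) < u x"
      using xy(1) M r by (intro less_le_trans[OF _ h(4)]) (simp add: ennreal_less_iff)
    moreover have "ennreal (N * r) < v y"
      using xy(2) N r by (intro less_le_trans[OF _ k(4)]) (simp add: ennreal_less_iff)
    ultimately have "ennreal ((M * r) powr t * (N * r) powr s) \<le> w (t * x + s * y)"
      using M N r by (intro H) auto
    also have "(M * r) powr t * (N * r) powr s = K * (r powr t * r powr s)"
      using M N r by (simp add: K_def powr_mult)
    also have "r powr t * r powr s = r" using r ts by (simp add: powr_add[symmetric])
    finally show "t * x + s * y \<in> {x. ennreal (K * r) \<le> w x}" by simp
  qed (use h(3) k(3) r in \<open>auto\<close>)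
  have "ennreal (t * (a / M) + s * (b / N)) \<le> ennreal t * (\<integral>\<^sup>+x. ennreal (h x) \<partial>lborel) + ennreal s * (\<integral>\<^sup>+x. ennreal (k x) \<partial>lborel)"
  proof -
    have "ennreal (t * (a / M) + s * (b / N)) = ennreal t * ennreal (a / M) + ennreal s * ennreal (b / N)"
      using M N ab(1,2) t s by (simp only: ennreal_plus ennreal_mult divide_nonneg_pos mult_nonneg_nonneg less_imp_le)
    also have "\<dots> \<le> ennreal t * (\<integral>\<^sup>+x. ennreal (h x) \<partial>lborel) + ennreal s * (\<integral>\<^sup>+x. ennreal (k x) \<partial>lborel)"
      by (intro add_mono mult_left_mono h(5) k(5)) simp_all
    finally show ?thesis .
  qed
  also have "\<dots> = ennreal t * (\<integral>\<^sup>+r\<in>{0<..<1}. emeasure lborel {x. r < h x} \<partial>lborel)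
      + ennreal s * (\<integral>\<^sup>+r\<in>{0<..<1}. emeasure lborel {x. r < k x} \<partial>lborel)"
    using h k by (simp add: nn_integral_layer_cake_unit)
  also have "\<dots> = (\<integral>\<^sup>+r\<in>{0<..<1}. (ennreal t * emeasure lborel {x. r < h x} + ennreal s * emeasure lborel {x. r < k x}) \<partial>lborel)"
    by (subst nn_integral_cmult[symmetric] nn_integral_add[symmetric], measurable)+
       (auto intro!: nn_integral_cong simp: algebra_simps)
  also have "\<dots> \<le> (\<integral>\<^sup>+r\<in>{0<..<1}. emeasure lborel {x. ennreal (K * r) \<le> w x} \<partial>lborel)"
    using level by (intro nn_integral_mono) (auto simp: indicator_def)
  also have "\<dots> = (\<integral>\<^sup>+r. (\<integral>\<^sup>+x. indicator {p. 0 < snd p \<and> snd p < 1 \<and> ennreal (K * snd p) \<le> w (fst p)} (x, r) \<partial>lborel) \<partial>lborel)"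
  proof (rule nn_integral_cong)
    fix r
    have "(\<integral>\<^sup>+x. indicator {p. 0 < snd p \<and> snd p < 1 \<and> ennreal (K * snd p) \<le> w (fst p)} (x, r) \<partial>lborel)
      = (\<integral>\<^sup>+x. indicator {x. ennreal (K * r) \<le> w x} x * indicator {0<..<1} r \<partial>lborel)"
      by (intro nn_integral_cong) (auto simp: indicator_def)
    also have "\<dots> = emeasure lborel {x. ennreal (K * r) \<le> w x} * indicator {0<..<1} r"
      by (subst nn_integral_multc) auto
    finally show "emeasure lborel {x. ennreal (K * r) \<le> w x} * indicator {0<..<1} r =
      (\<integral>\<^sup>+x. indicator {p. 0 < snd p \<and> snd p < 1 \<and> ennreal (K * snd p) \<le> w (fst p)} (x, r) \<partial>lborel)" by simp
  qed
  also have "\<dots> = (\<integral>\<^sup>+x. (\<integral>\<^sup>+r. indicator {p. 0 < snd p \<and> snd p < 1 \<and> ennreal (K * snd p) \<le> w (fst p)} (x, r) \<partial>lborel) \<partial>lborel)"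
    by (rule lborel_pair.Fubini') measurable
  also have "\<dots> \<le> (\<integral>\<^sup>+x. ennreal (1 / K) * w x \<partial>lborel)"
  proof (rule nn_integral_mono)
    fix x
    show "(\<integral>\<^sup>+r. indicator {p. 0 < snd p \<and> snd p < 1 \<and> ennreal (K * snd p) \<le> w (fst p)} (x, r) \<partial>lborel) \<le> ennreal (1 / K) * w x"
    proof (cases "w x")
      case (real q)
      have "(\<integral>\<^sup>+r. indicator {p. 0 < snd p \<and> snd p < 1 \<and> ennreal (K * snd p) \<le> w (fst p)} (x, r) \<partial>lborel)
        \<le> (\<integral>\<^sup>+r. indicator {0..q / K} r \<partial>lborel)"
        using K real by (intro nn_integral_mono) (auto simp: indicator_def field_simps)
      also have "\<dots> = ennreal (q / K)" using real K by simp
      finally show ?thesis using real K by (simp add: ennreal_mult[symmetric])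
    next
      case top
      then show ?thesis using K by (simp add: ennreal_mult_top)
    qed
  qed
  also have "\<dots> = ennreal (1 / K) * (\<integral>\<^sup>+x. w x \<partial>lborel)" by (simp add: nn_integral_cmult)
  finally have main: "ennreal (t * (a / M) + s * (b / N)) \<le> ennreal (1 / K) * (\<integral>\<^sup>+x. w x \<partial>lborel)" .
  have "a powr t * b powr s = K * ((a / M) powr t * (b / N) powr s)"
    using M N ab0 by (simp add: K_def powr_divide)
  also have "\<dots> \<le> K * (t * (a / M) + s * (b / N))"
    using Youngs_inequality_0[of t s "a / M" "b / N"] t s ts M N ab0 K by (intro mult_left_mono) auto
  finally have "ennreal (a powr t * b powr s) \<le> ennreal K * ennreal (t * (a / M) + s * (b / N))"
    using K by (subst ennreal_mult'[symmetric]) (auto intro!: ennreal_leI)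
  also have "\<dots> \<le> ennreal K * (ennreal (1 / K) * (\<integral>\<^sup>+x. w x \<partial>lborel))"
    using main by (rule mult_left_mono) simp
  also have "\<dots> = (\<integral>\<^sup>+x. w x \<partial>lborel)"
    using K by (simp add: mult.assoc[symmetric] ennreal_mult[symmetric])
  finally show ?thesis .
qed (use t s in auto)

text \<open>
  When one coordinate of \<open>x\<close> and of \<open>y\<close> is frozen, the induction hypothesis says that the
  integrals over the remaining coordinates satisfy the hypothesis of the one-dimensional
  inequality.
\<close>

lemma prekopa_leindler_PiM:
  fixes u v w :: "('i \<Rightarrow> real) \<Rightarrow> ennreal"
  assumes t: "t > 0" and s: "s > 0" and ts: "t + s = 1" and I: "finite I"
    and "u \<in> borel_measurable (PiM I (\<lambda>_. lborel))" "v \<in> borel_measurable (PiM I (\<lambda>_. lborel))"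
      "w \<in> borel_measurable (PiM I (\<lambda>_. lborel))"
    and "\<And>x y a b. x \<in> extensional I \<Longrightarrow> y \<in> extensional I \<Longrightarrow> 0 \<le> a \<Longrightarrow> 0 \<le> b \<Longrightarrow>
              ennreal a < u x \<Longrightarrow> ennreal b < v y \<Longrightarrow>
              ennreal (a powr t * b powr s) \<le> w (\<lambda>i\<in>I. t * x i + s * y i)"
    and "0 \<le> a" "0 \<le> b" "ennreal a < (\<integral>\<^sup>+x. u x \<partial>PiM I (\<lambda>_. lborel))" "ennreal b < (\<integral>\<^sup>+x. v x \<partial>PiM I (\<lambda>_. lborel))"
  shows "ennreal (a powr t * b powr s) \<le> (\<integral>\<^sup>+x. w x \<partial>PiM I (\<lambda>_. lborel))"
  using I assms(5-)
proof (induction I arbitrary: u v w a b rule: finite_induct)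
  case empty
  have m: "(\<integral>\<^sup>+x. f x \<partial>PiM {} (\<lambda>_. lborel)) = f (\<lambda>_. undefined)" for f :: "('i \<Rightarrow> real) \<Rightarrow> ennreal"
    by (simp add: PiM_empty nn_integral_count_space_finite)
  have "restrict (\<lambda>i. t * (undefined::real) + s * undefined) {} = ((\<lambda>_. undefined) :: 'i \<Rightarrow> real)" by auto
  then show ?case using empty.prems(4)[of "\<lambda>_. undefined" "\<lambda>_. undefined" a b] empty.prems(5-) unfolding m by simp
next
  case (insert i I)
  interpret product_sigma_finite "\<lambda>_::'i. lborel :: real measure" by standard
  let ?P = "PiM I (\<lambda>_. lborel :: real measure)"
  note [measurable] = insert.prems(1-3)
  have slice[measurable]: "(\<lambda>(y, x). f (x(i := y))) \<in> borel_measurable (lborel \<Otimes>\<^sub>M ?P)"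
    if [measurable]: "f \<in> borel_measurable (PiM (insert i I) (\<lambda>_. lborel))" for f :: "('i \<Rightarrow> real) \<Rightarrow> ennreal"
    by measurable
  interpret P: sigma_finite_measure ?P by (rule sigma_finite) fact
  have int: "(\<lambda>y. \<integral>\<^sup>+x. f (x(i := y)) \<partial>?P) \<in> borel_measurable borel"
    if f: "f \<in> borel_measurable (PiM (insert i I) (\<lambda>_. lborel))" for f :: "('i \<Rightarrow> real) \<Rightarrow> ennreal"
  proof -
    have "(\<lambda>y. \<integral>\<^sup>+x. f (x(i := y)) \<partial>?P) \<in> borel_measurable lborel"
      using P.borel_measurable_nn_integral[OF slice[OF f]] by simp
    then show ?thesis by simp
  qed
  have sl: "(\<lambda>x. f (x(i := y))) \<in> borel_measurable ?P"
    if f: "f \<in> borel_measurable (PiM (insert i I) (\<lambda>_. lborel))" for f :: "('i \<Rightarrow> real) \<Rightarrow> ennreal" and y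
    using measurable_compose[OF measurable_Pair1' slice[OF f], of y] by simp
  show ?case
    unfolding product_nn_integral_insert_rev[OF insert.hyps insert.prems(3)]
  proof (rule prekopa_leindler_real[OF t s ts int[OF insert.prems(1)] int[OF insert.prems(2)] int[OF insert.prems(3)] _ insert.prems(5,6)])
    show "ennreal a < (\<integral>\<^sup>+y. \<integral>\<^sup>+x. u (x(i := y)) \<partial>?P \<partial>lborel)"
      using insert.prems(7) unfolding product_nn_integral_insert_rev[OF insert.hyps insert.prems(1)] .
    show "ennreal b < (\<integral>\<^sup>+y. \<integral>\<^sup>+x. v (x(i := y)) \<partial>?P \<partial>lborel)"
      using insert.prems(8) unfolding product_nn_integral_insert_rev[OF insert.hyps insert.prems(2)] .
  next
    fix p q and a b :: real
    assume ab: "0 \<le> a" "0 \<le> b" "ennreal a < (\<integral>\<^sup>+x. u (x(i := p)) \<partial>?P)" "ennreal b < (\<integral>\<^sup>+x. v (x(i := q)) \<partial>?P)"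
    show "ennreal (a powr t * b powr s) \<le> (\<integral>\<^sup>+x. w (x(i := t * p + s * q)) \<partial>?P)"
    proof (rule insert.IH[OF sl[OF insert.prems(1)] sl[OF insert.prems(2)] sl[OF insert.prems(3)] _ ab])
      fix x y :: "'i \<Rightarrow> real" and a b :: real
      assume xy: "x \<in> extensional I" "y \<in> extensional I" "0 \<le> a" "0 \<le> b"
        "ennreal a < u (x(i := p))" "ennreal b < v (y(i := q))"
      have "ennreal (a powr t * b powr s) \<le> w (\<lambda>j\<in>insert i I. t * (x(i := p)) j + s * (y(i := q)) j)"
        by (rule insert.prems(4)[OF _ _ xy(3-6)]) (use xy(1,2) in \<open>auto simp: extensional_def\<close>)
      also have "(\<lambda>j\<in>insert i I. t * (x(i := p)) j + s * (y(i := q)) j) = (\<lambda>j\<in>I. t * x j + s * y j)(i := t * p + s * q)"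
        using insert.hyps by (auto simp: fun_eq_iff)
      finally show "ennreal (a powr t * b powr s) \<le> w ((\<lambda>j\<in>I. t * x j + s * y j)(i := t * p + s * q))" .
    qed
  qed
qed

theorem prekopa_leindler:
  fixes u v w :: "'a::euclidean_space \<Rightarrow> ennreal"
  assumes t: "t > 0" and s: "s > 0" and ts: "t + s = 1"
    and [measurable]: "u \<in> borel_measurable borel" "v \<in> borel_measurable borel" "w \<in> borel_measurable borel"
    and H: "\<And>x y a b. 0 \<le> a \<Longrightarrow> 0 \<le> b \<Longrightarrow> ennreal a < u x \<Longrightarrow> ennreal b < v y \<Longrightarrow>
              ennreal (a powr t * b powr s) \<le> w (t *\<^sub>R x + s *\<^sub>R y)"
    and ab: "0 \<le> a" "0 \<le> b" "ennreal a < (\<integral>\<^sup>+x. u x \<partial>lborel)" "ennreal b < (\<integral>\<^sup>+x. v x \<partial>lborel)"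
  shows "ennreal (a powr t * b powr s) \<le> (\<integral>\<^sup>+x. w x \<partial>lborel)"
proof -
  let ?P = "PiM (Basis :: 'a set) (\<lambda>_. lborel :: real measure)"
  let ?c = "\<lambda>f. \<Sum>b\<in>(Basis :: 'a set). f b *\<^sub>R b"
  have [measurable]: "?c \<in> ?P \<rightarrow>\<^sub>M borel" by measurable
  have int: "(\<integral>\<^sup>+x. f x \<partial>lborel) = (\<integral>\<^sup>+x. f (?c x) \<partial>?P)"
    if "f \<in> borel_measurable borel" for f :: "'a \<Rightarrow> ennreal"
    using that by (subst lborel_eq) (simp add: nn_integral_distr)
  have "ennreal (a powr t * b powr s) \<le> (\<integral>\<^sup>+x. w (?c x) \<partial>?P)"
  proof (rule prekopa_leindler_PiM[OF t s ts finite_Basis])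
    fix x y :: "'a \<Rightarrow> real" and a b :: real
    assume xy: "0 \<le> a" "0 \<le> b" "ennreal a < u (?c x)" "ennreal b < v (?c y)"
    have "ennreal (a powr t * b powr s) \<le> w (t *\<^sub>R ?c x + s *\<^sub>R ?c y)"
      using xy by (rule H)
    also have "t *\<^sub>R ?c x + s *\<^sub>R ?c y = ?c (\<lambda>j\<in>Basis. t * x j + s * y j)"
      by (simp add: scaleR_sum_right sum.distrib[symmetric] algebra_simps)
    finally show "ennreal (a powr t * b powr s) \<le> w (?c (\<lambda>j\<in>Basis. t * x j + s * y j))" .
  qed (use ab int in auto)
  then show ?thesis using int[of w] by simp
qed


corollary prekopa_leindler_integral:
  fixes u v w :: "'a::euclidean_space \<Rightarrow> real"
  assumes t: "t > 0" and s: "s > 0" and ts: "t + s = 1"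
    and u: "integrable lborel u" "\<And>x. 0 \<le> u x" and v: "integrable lborel v" "\<And>x. 0 \<le> v x"
    and w: "integrable lborel w" "\<And>x. 0 \<le> w x"
    and H: "\<And>x y. u x powr t * v y powr s \<le> w (t *\<^sub>R x + s *\<^sub>R y)"
  shows "(\<integral>x. u x \<partial>lborel) powr t * (\<integral>x. v x \<partial>lborel) powr s \<le> (\<integral>x. w x \<partial>lborel)"
proof (cases "(\<integral>x. u x \<partial>lborel) = 0 \<or> (\<integral>x. v x \<partial>lborel) = 0")
  case True
  then show ?thesis using w t s by (auto intro!: integral_nonneg_AE)
next
  case False
  let ?U = "\<integral>x. u x \<partial>lborel" and ?V = "\<integral>x. v x \<partial>lborel" and ?W = "\<integral>x. w x \<partial>lborel"
  have pos: "?U > 0" "?V > 0"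
    using False integral_nonneg_AE[of u lborel] integral_nonneg_AE[of v lborel] u v by (auto simp: less_le)
  have W0: "?W \<ge> 0" using w by (auto intro!: integral_nonneg_AE)
  show ?thesis
  proof (rule field_le_mult_one_interval)
    fix z :: real assume z: "0 < z" "z < 1"
    have "ennreal ((z * ?U) powr t * (z * ?V) powr s) \<le> (\<integral>\<^sup>+x. ennreal (w x) \<partial>lborel)"
    proof (rule prekopa_leindler[OF t s ts])
      fix x y :: 'a and a b :: real
      assume *: "0 \<le> a" "0 \<le> b" "ennreal a < ennreal (u x)" "ennreal b < ennreal (v y)"
      have "a powr t * b powr s \<le> u x powr t * v y powr s"
        using * t s u(2)[of x] v(2)[of y] by (intro mult_mono powr_mono2) (auto simp: ennreal_less_iff)
      also have "\<dots> \<le> w (t *\<^sub>R x + s *\<^sub>R y)" by (rule H)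
      finally show "ennreal (a powr t * b powr s) \<le> ennreal (w (t *\<^sub>R x + s *\<^sub>R y))" by (rule ennreal_leI)
    qed (use u v w z pos in \<open>auto simp: nn_integral_eq_integral ennreal_less_iff borel_measurable_integrable dest!: borel_measurable_integrable\<close>)
    then have "(z * ?U) powr t * (z * ?V) powr s \<le> ?W"
      using w W0 by (simp add: nn_integral_eq_integral)
    moreover have "(z * ?U) powr t * (z * ?V) powr s = (z powr t * z powr s) * (?U powr t * ?V powr s)"
      using z pos by (simp add: powr_mult)
    moreover have "z powr t * z powr s = z" using z ts by (simp add: powr_add[symmetric])
    ultimately show "z * (?U powr t * ?V powr s) \<le> ?W" by simp
  qed
qed

section \<open>Strongly log-concave densities on compact convex sets\<close>

text \<open>
  Convexity of \<open>E - \<rho> |x|\<^sup>2 / 2\<close>, rewritten by means of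
  \<open>t |x|\<^sup>2 + s |y|\<^sup>2 - |t x + s y|\<^sup>2 = t s |x - y|\<^sup>2\<close>.
\<close>

definition strongly_convex_on :: "'a::euclidean_space set \<Rightarrow> real \<Rightarrow> ('a \<Rightarrow> real) \<Rightarrow> bool" where
  "strongly_convex_on D \<rho> E \<longleftrightarrow> (\<forall>x\<in>D. \<forall>y\<in>D. \<forall>t>0. \<forall>s>0. t + s = 1 \<longrightarrow>
     E (t *\<^sub>R x + s *\<^sub>R y) \<le> t * E x + s * E y - \<rho> * t * s / 2 * (norm (x - y))\<^sup>2)"

text \<open>
  Not normalised: on a subset of \<open>D\<close> the same potential is used, and only the total mass
  changes.
\<close>

definition boltzmann :: "'a::euclidean_space set \<Rightarrow> ('a \<Rightarrow> real) \<Rightarrow> 'a measure" where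
  "boltzmann D E = density lborel (\<lambda>x. ennreal (indicator D x * exp (- E x)))"

lemma sets_boltzmann[simp, measurable_cong]: "sets (boltzmann D E) = sets borel"
  by (simp add: boltzmann_def)

lemma space_boltzmann[simp]: "space (boltzmann D E) = UNIV"
  by (simp add: boltzmann_def)

lemma
  fixes h :: "'a::euclidean_space \<Rightarrow> real"
  assumes [measurable]: "D \<in> sets borel" "E \<in> borel_measurable borel" "h \<in> borel_measurable borel"
  shows integral_boltzmann: "(\<integral>x. h x \<partial>boltzmann D E) = (\<integral>x. indicator D x * exp (- E x) * h x \<partial>lborel)"
    and integrable_boltzmann: "integrable (boltzmann D E) h \<longleftrightarrow> integrable lborel (\<lambda>x. indicator D x * exp (- E x) * h x)"
  unfolding boltzmann_def by (subst integral_density integrable_density; simp)+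

lemma nn_integral_boltzmann:
  assumes [measurable]: "D \<in> sets borel" "E \<in> borel_measurable borel" "h \<in> borel_measurable borel"
  shows "(\<integral>\<^sup>+x. h x \<partial>boltzmann D E) = (\<integral>\<^sup>+x. ennreal (indicator D x * exp (- E x)) * h x \<partial>lborel)"
  unfolding boltzmann_def by (subst nn_integral_density) auto

lemma AE_boltzmann:
  assumes [measurable]: "D \<in> sets borel" "E \<in> borel_measurable borel"
  shows "(AE x in boltzmann D E. P x) \<longleftrightarrow> (AE x in lborel. x \<in> D \<longrightarrow> P x)"
  unfolding boltzmann_def by (subst AE_density) (auto simp: indicator_def intro!: AE_cong)

lemma AE_boltzmannI:
  assumes "D \<in> sets borel" "E \<in> borel_measurable borel" "\<And>x. x \<in> D \<Longrightarrow> P x"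
  shows "AE x in boltzmann D E. P x"
  using assms by (simp add: AE_boltzmann)

lemma finite_measure_boltzmann:
  fixes E :: "'a::euclidean_space \<Rightarrow> real"
  assumes K: "compact K" and [measurable]: "E \<in> borel_measurable borel"
    and b: "\<And>x. x \<in> K \<Longrightarrow> \<bar>E x\<bar> \<le> b"
  shows "finite_measure (boltzmann K E)"
proof
  have [measurable]: "K \<in> sets borel" using K by (rule borel_compact)
  have "emeasure (boltzmann K E) (space (boltzmann K E)) = (\<integral>\<^sup>+x. ennreal (indicator K x * exp (- E x)) \<partial>lborel)"
    unfolding boltzmann_def by (subst emeasure_density) auto
  also have "\<dots> \<le> (\<integral>\<^sup>+x. ennreal (exp b) * indicator K x \<partial>lborel)"
  proof (rule nn_integral_mono)
    fix x
    show "ennreal (indicator K x * exp (- E x)) \<le> ennreal (exp b) * indicator K x"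
      using b[of x] by (auto simp: indicator_def intro!: ennreal_leI)
  qed
  also have "\<dots> = ennreal (exp b) * emeasure lborel K" by (subst nn_integral_cmult) auto
  also have "\<dots> < \<infinity>" using emeasure_compact_finite[OF K] by (simp add: ennreal_mult_less_top)
  finally show "emeasure (boltzmann K E) (space (boltzmann K E)) \<noteq> \<infinity>" by simp
qed

lemma integrable_boltzmann_bounded:
  fixes E h :: "'a::euclidean_space \<Rightarrow> real"
  assumes K: "compact K" and [measurable]: "E \<in> borel_measurable borel" "h \<in> borel_measurable borel"
    and b: "\<And>x. x \<in> K \<Longrightarrow> \<bar>E x\<bar> \<le> b" and c: "\<And>x. x \<in> K \<Longrightarrow> \<bar>h x\<bar> \<le> c"
  shows "integrable (boltzmann K E) h"
proof -
  interpret finite_measure "boltzmann K E" using finite_measure_boltzmann[OF K _ b] by simp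
  have [measurable]: "K \<in> sets borel" using K by (rule borel_compact)
  show ?thesis
    by (rule integrable_const_bound[where B = c]) (auto intro!: AE_boltzmannI c)
qed

lemma derivative_nonneg_at_zero:
  fixes \<phi> :: "real \<Rightarrow> real"
  assumes d: "(\<phi> has_real_derivative l) (at 0)" and z: "\<phi> 0 = 0" and e: "e > 0"
    and pos: "\<And>s. 0 < s \<Longrightarrow> s < e \<Longrightarrow> \<phi> s \<ge> 0"
  shows "l \<ge> 0"
proof (rule ccontr)
  assume "\<not> l \<ge> 0"
  then obtain d where "d > 0" "\<And>h. 0 < h \<Longrightarrow> h < d \<Longrightarrow> \<phi> (0 + h) < \<phi> 0"
    using DERIV_neg_dec_right[OF d] by auto
  moreover have "0 < min d e / 2" "min d e / 2 < d" "min d e / 2 < e" using \<open>d > 0\<close> e by (auto simp: min_def)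
  ultimately show False using pos[of "min d e / 2"] z by fastforce
qed

text \<open>
  The two sides of the assumed inequality agree at \<open>s = 0\<close>, so the difference of their
  logarithms has a nonnegative derivative there. The coefficient of \<open>B\<close> has derivative
  \<open>1 / (2 \<rho>)\<close> at \<open>0\<close>, and \<open>C\<close> and \<open>D\<close> enter only at second order.
\<close>

lemma entropy_bound_of_small_time_inequality:
  fixes m A B C D Z \<rho> e :: real
  assumes m: "m > 0" and Z: "Z > 0" and \<rho>: "\<rho> > 0" and e: "e > 0"
    and ineq: "\<And>s. 0 < s \<Longrightarrow> s < e \<Longrightarrow>
      (m + s / (1 - s) * A) powr (1 - s) * Z powr s
        \<le> m + s / (2 * \<rho> * (1 - s) - 4 * C * s) * B + (s / (2 * \<rho> * (1 - s) - 4 * C * s))\<^sup>2 * D"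
  shows "A - m * ln m + m * ln Z \<le> 1 / (2 * \<rho>) * B"
proof -
  let ?k = "\<lambda>s. s / (2 * \<rho> * (1 - s) - 4 * C * s)"
  let ?R = "\<lambda>s. m + ?k s * B + (?k s)\<^sup>2 * D" and ?L = "\<lambda>s. m + s / (1 - s) * A"
  let ?\<phi> = "\<lambda>s. ln (?R s) - ((1 - s) * ln (?L s) + s * ln Z)"
  have R: "(?R \<longlongrightarrow> m + 0 / (2 * \<rho> * (1 - 0) - 4 * C * 0) * B + (0 / (2 * \<rho> * (1 - 0) - 4 * C * 0))\<^sup>2 * D) (at_right 0)"
    using \<rho> by (intro tendsto_intros) auto
  have L: "(?L \<longlongrightarrow> m + 0 / (1 - 0) * A) (at_right 0)"
    by (intro tendsto_intros) auto
  have "eventually (\<lambda>s. ?R s > 0) (at_right 0)" "eventually (\<lambda>s. ?L s > 0) (at_right 0)"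
    using order_tendstoD(1)[OF R, of 0] order_tendstoD(1)[OF L, of 0] m by simp_all
  then have "eventually (\<lambda>s. ?R s > 0 \<and> ?L s > 0) (at_right 0)" by eventually_elim simp
  then obtain d where d: "d > 0" "\<And>s. 0 < s \<Longrightarrow> s < d \<Longrightarrow> ?R s > 0 \<and> ?L s > 0"
    unfolding eventually_at_right_field by blast
  have "0 \<le> B / (2 * \<rho>) / m - (A / m - ln m + ln Z)"
  proof (rule derivative_nonneg_at_zero[of ?\<phi>])
    show "(?\<phi> has_real_derivative (B / (2 * \<rho>) / m - (A / m - ln m + ln Z))) (at 0)"
      using m \<rho> by (auto intro!: derivative_eq_intros simp: field_simps power2_eq_square)
    show "min d (min e 1) > 0" using d e by simp
    show "?\<phi> s \<ge> 0" if s: "0 < s" "s < min d (min e 1)" for s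
    proof -
      have pos: "?R s > 0" "?L s > 0" using d(2)[of s] s by auto
      have "ln (?L s powr (1 - s) * Z powr s) \<le> ln (?R s)"
        using ineq[of s] s pos Z by (subst ln_le_cancel_iff) (auto intro!: mult_pos_pos)
      moreover have "ln (?L s powr (1 - s) * Z powr s) = (1 - s) * ln (?L s) + s * ln Z"
        using pos Z by (subst ln_mult) (auto simp: ln_powr)
      ultimately show ?thesis by linarith
    qed
  qed simp
  then have "0 \<le> m * (B / (2 * \<rho>) / m - (A / m - ln m + ln Z))"
    using m by (intro mult_nonneg_nonneg) auto
  also have "\<dots> = 1 / (2 * \<rho>) * B - (A - m * ln m + m * ln Z)"
    using m \<rho> by (simp add: field_simps)
  finally show ?thesis by simp
qed

lemma quadratic_le_square:
  fixes q h :: "'a::real_inner"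
  assumes "k > 0"
  shows "q \<bullet> h - k * (norm h)\<^sup>2 \<le> (norm q)\<^sup>2 / (4 * k)"
proof -
  have "0 \<le> (norm (q - (2 * k) *\<^sub>R h))\<^sup>2" by simp
  also have "\<dots> = (norm q)\<^sup>2 - 4 * k * (q \<bullet> h) + 4 * k\<^sup>2 * (norm h)\<^sup>2"
    unfolding power2_norm_eq_inner
    by (simp add: inner_diff_left inner_diff_right inner_commute power2_eq_square algebra_simps)
  finally show ?thesis using assms by (simp add: field_simps power2_eq_square)
qed

text \<open>
  Since \<open>x - z = s (x - y)\<close>, the gain from strong convexity is \<open>\<rho> (1 - s) / (2 s)\<close> times
  \<open>|x - z|\<^sup>2\<close>. For small \<open>s\<close> it exceeds the quadratic error in \<open>G\<close>, and the rest of it absorbs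
  the linear term by completing the square.
\<close>

lemma bobkov_ledoux_pointwise:
  fixes E G :: "'a::euclidean_space \<Rightarrow> real" and q :: "'a \<Rightarrow> 'a"
  assumes sc: "strongly_convex_on K \<rho> E" and s: "0 < s" "s < 1"
    and k: "\<rho> * (1 - s) / (2 * s) - C > 0"
    and G: "\<And>x z. x \<in> K \<Longrightarrow> z \<in> K \<Longrightarrow> G x \<le> G z + q z \<bullet> (x - z) + C * (norm (x - z))\<^sup>2"
    and xy: "x \<in> K" "y \<in> K" "(1 - s) *\<^sub>R x + s *\<^sub>R y \<in> K"
  defines "z \<equiv> (1 - s) *\<^sub>R x + s *\<^sub>R y"
  shows "(1 - s) * (G x / (1 - s) - E x) + s * (- E y)
     \<le> G z + (norm (q z))\<^sup>2 / (4 * (\<rho> * (1 - s) / (2 * s) - C)) - E z"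
proof -
  have h: "x - z = s *\<^sub>R (x - y)" by (simp add: z_def algebra_simps)
  have n: "(norm (x - z))\<^sup>2 = s\<^sup>2 * (norm (x - y))\<^sup>2"
    using s by (simp add: h power_mult_distrib)
  have "E z \<le> (1 - s) * E x + s * E y - \<rho> * (1 - s) * s / 2 * (norm (x - y))\<^sup>2"
    using sc xy s unfolding strongly_convex_on_def z_def by simp
  also have "\<rho> * (1 - s) * s / 2 * (norm (x - y))\<^sup>2 = \<rho> * (1 - s) / (2 * s) * (norm (x - z))\<^sup>2"
    unfolding n using s by (simp add: field_simps power2_eq_square)
  finally have Ez: "E z \<le> (1 - s) * E x + s * E y - \<rho> * (1 - s) / (2 * s) * (norm (x - z))\<^sup>2" .
  have "q z \<bullet> (x - z) - (\<rho> * (1 - s) / (2 * s) - C) * (norm (x - z))\<^sup>2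
    \<le> (norm (q z))\<^sup>2 / (4 * (\<rho> * (1 - s) / (2 * s) - C))"
    using k by (rule quadratic_le_square)
  moreover have "G x \<le> G z + q z \<bullet> (x - z) + C * (norm (x - z))\<^sup>2"
    using G xy unfolding z_def by simp
  moreover have "(1 - s) * (G x / (1 - s) - E x) + s * (- E y) = G x - ((1 - s) * E x + s * E y)"
    using s by (simp add: field_simps)
  ultimately show ?thesis using Ez by (simp add: left_diff_distrib)
qed

text \<open>
  Prekopa-Leindler is applied to the three functions from \<open>bobkov_ledoux_pointwise\<close>. Its left
  side is bounded below through \<open>exp y \<ge> 1 + y\<close>, its right side above through
  \<open>exp y \<le> 1 + y + y\<^sup>2\<close>, so both become explicit functions of \<open>s\<close>, and \<open>s\<close> tends to \<open>0\<close>.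
\<close>

lemma log_sobolev_exponential:
  fixes E G :: "'a::euclidean_space \<Rightarrow> real" and q :: "'a \<Rightarrow> 'a"
  assumes K: "compact K" "convex K" and \<rho>: "\<rho> > 0" and sc: "strongly_convex_on K \<rho> E"
    and [measurable]: "E \<in> borel_measurable borel" "G \<in> borel_measurable borel" "q \<in> borel_measurable borel"
    and b: "\<And>x. x \<in> K \<Longrightarrow> \<bar>E x\<bar> \<le> b" "\<And>x. x \<in> K \<Longrightarrow> \<bar>G x\<bar> \<le> b" "\<And>x. x \<in> K \<Longrightarrow> norm (q x) \<le> b"
    and C: "C \<ge> 0"
    and G: "\<And>x z. x \<in> K \<Longrightarrow> z \<in> K \<Longrightarrow> G x \<le> G z + q z \<bullet> (x - z) + C * (norm (x - z))\<^sup>2"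
  defines "\<nu> \<equiv> boltzmann K E"
  defines "m \<equiv> \<integral>x. exp (G x) \<partial>\<nu>"
  assumes Z: "measure \<nu> UNIV > 0"
  shows "(\<integral>x. G x * exp (G x) \<partial>\<nu>) - m * ln m + m * ln (measure \<nu> UNIV)
    \<le> 1 / (2 * \<rho>) * (\<integral>x. (norm (q x))\<^sup>2 * exp (G x) \<partial>\<nu>)"
proof -
  have Km[measurable]: "K \<in> sets borel" using K by (simp add: borel_compact)
  interpret finite_measure \<nu> unfolding \<nu>_def using finite_measure_boltzmann[OF K(1) _ b(1)] by simp
  have int: "integrable \<nu> h" if "h \<in> borel_measurable borel" "\<And>x. x \<in> K \<Longrightarrow> \<bar>h x\<bar> \<le> c" for h :: "'a \<Rightarrow> real" and c
    unfolding \<nu>_def by (rule integrable_boltzmann_bounded[OF K(1) _ that(1) b(1) that(2)]) auto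
  have ne: "K \<noteq> {}"
  proof
    assume "K = {}"
    then have "emeasure \<nu> UNIV = 0" by (simp add: \<nu>_def boltzmann_def emeasure_density)
    then show False using Z by (simp add: measure_def)
  qed
  have b0: "b \<ge> 0" using ne b(1) abs_ge_zero order_trans by blast
  have eb: "G x \<le> b" if "x \<in> K" for x using b(2)[OF that] by simp
  have i1: "integrable \<nu> (\<lambda>x. exp (G x))" by (rule int[of _ "exp b"]) (auto simp: eb)
  have i2: "integrable \<nu> (\<lambda>x. G x * exp (G x))"
    by (rule int[of _ "b * exp b"]) (auto simp: abs_mult simp: eb intro!: mult_mono b b0)
  have i3: "integrable \<nu> (\<lambda>x. (norm (q x))\<^sup>2 * exp (G x))"
    by (rule int[of _ "b\<^sup>2 * exp b"]) (auto simp: abs_mult simp: eb intro!: mult_mono power_mono b b0)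
  have i4: "integrable \<nu> (\<lambda>x. ((norm (q x))\<^sup>2)\<^sup>2 * exp (G x))"
    by (rule int[of _ "(b\<^sup>2)\<^sup>2 * exp b"]) (auto simp: abs_mult simp: eb intro!: mult_mono power_mono b b0)
  have m: "m > 0"
  proof -
    have "exp (- b) * measure \<nu> UNIV = (\<integral>x. exp (- b) \<partial>\<nu>)" by (simp add: \<nu>_def)
    also have "\<dots> \<le> m" unfolding m_def
    proof (intro integral_mono_AE i1)
      show "AE x in \<nu>. exp (- b) \<le> exp (G x)"
        unfolding \<nu>_def by (intro AE_boltzmannI) (use b(2) in \<open>fastforce simp: abs_le_iff\<close>)+
    qed auto
    finally show ?thesis using Z by (smt (verit) exp_gt_zero mult_pos_pos)
  qed
  define A where "A = (\<integral>x. G x * exp (G x) \<partial>\<nu>)"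
  define B where "B = (\<integral>x. (norm (q x))\<^sup>2 * exp (G x) \<partial>\<nu>)"
  define D where "D = (\<integral>x. ((norm (q x))\<^sup>2)\<^sup>2 * exp (G x) \<partial>\<nu>)"
  have comb: "integrable \<nu> (\<lambda>x. exp (G x) + k * ((norm (q x))\<^sup>2 * exp (G x)) + l * (((norm (q x))\<^sup>2)\<^sup>2 * exp (G x)))"
      "(\<integral>x. exp (G x) + k * ((norm (q x))\<^sup>2 * exp (G x)) + l * (((norm (q x))\<^sup>2)\<^sup>2 * exp (G x)) \<partial>\<nu>) = m + k * B + l * D"
    for k l using i1 i3 i4 by (simp_all add: m_def B_def D_def)
  let ?k = "\<lambda>s. s / (2 * \<rho> * (1 - s) - 4 * C * s)"
  have "((\<lambda>s. 2 * \<rho> * (1 - s) - 4 * C * s) \<longlongrightarrow> 2 * \<rho> * (1 - 0) - 4 * C * 0) (at_right 0)"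
    by (intro tendsto_intros)
  from order_tendstoD(1)[OF this, of 0]
  have ev1: "eventually (\<lambda>s. 2 * \<rho> * (1 - s) - 4 * C * s > 0) (at_right 0)" using \<rho> by simp
  have "((\<lambda>s. ?k s * b\<^sup>2) \<longlongrightarrow> 0 / (2 * \<rho> * (1 - 0) - 4 * C * 0) * b\<^sup>2) (at_right 0)"
    using \<rho> by (intro tendsto_intros) auto
  from order_tendstoD(2)[OF this, of 1]
  have ev2: "eventually (\<lambda>s. ?k s * b\<^sup>2 < 1) (at_right 0)" by simp
  have "((\<lambda>s. m + s / (1 - s) * A) \<longlongrightarrow> m + 0 / (1 - 0) * A) (at_right 0)"
    by (intro tendsto_intros) auto
  from order_tendstoD(1)[OF this, of 0]
  have ev3: "eventually (\<lambda>s. m + s / (1 - s) * A > 0) (at_right 0)" using m by simp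
  have "eventually (\<lambda>s. 2 * \<rho> * (1 - s) - 4 * C * s > 0 \<and> ?k s * b\<^sup>2 < 1 \<and> m + s / (1 - s) * A > 0) (at_right 0)"
    using ev1 ev2 ev3 by eventually_elim simp
  then obtain e where e: "e > 0" "\<And>s. 0 < s \<Longrightarrow> s < e \<Longrightarrow> 2 * \<rho> * (1 - s) - 4 * C * s > 0"
      "\<And>s. 0 < s \<Longrightarrow> s < e \<Longrightarrow> ?k s * b\<^sup>2 < 1" "\<And>s. 0 < s \<Longrightarrow> s < e \<Longrightarrow> m + s / (1 - s) * A > 0"
    unfolding eventually_at_right_field by blast
  have "A - m * ln m + m * ln (measure \<nu> UNIV) \<le> 1 / (2 * \<rho>) * B"
  proof (rule entropy_bound_of_small_time_inequality[OF m Z \<rho>])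
    show "min e 1 > 0" using e by simp
    fix s assume s: "0 < s" "s < min e 1"
    let ?c = "\<rho> * (1 - s) / (2 * s) - C"
    have den: "2 * \<rho> * (1 - s) - 4 * C * s > 0" using e(2)[of s] s by simp
    have ck: "?k s = 1 / (4 * ?c)" and cpos: "?c > 0"
      using den s by (auto simp: field_simps)
    have k0: "?k s \<ge> 0" using den s by simp
    \<comment> \<open>the functions of the Prekopa-Leindler inequality; \<open>?k s\<close> is \<open>1 / (4 * ?c)\<close>\<close>
    define u where "u x = indicator K x * exp (- E x) * exp (G x / (1 - s))" for x
    define v where "v x = indicator K x * exp (- E x) * (1::real)" for x
    define w where "w x = indicator K x * exp (- E x) * exp (G x + ?k s * (norm (q x))\<^sup>2)" for x
    have iu: "integrable \<nu> (\<lambda>x. exp (G x / (1 - s)))"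
      by (rule int[of _ "exp (b / (1 - s))"]) (use b(2) s in \<open>auto simp: abs_le_iff intro!: divide_right_mono\<close>)
    have iw: "integrable \<nu> (\<lambda>x. exp (G x + ?k s * (norm (q x))\<^sup>2))"
    proof (rule int[of _ "exp (b + ?k s * b\<^sup>2)"])
      fix x assume "x \<in> K"
      then show "\<bar>exp (G x + ?k s * (norm (q x))\<^sup>2)\<bar> \<le> exp (b + ?k s * b\<^sup>2)"
        using b(2)[of x] b(3)[of x] k0 by (auto intro!: add_mono mult_left_mono power_mono simp del: times_divide_eq_left)
    qed auto
    have Iu: "integrable lborel u" "(\<integral>x. u x \<partial>lborel) = (\<integral>x. exp (G x / (1 - s)) \<partial>\<nu>)"
      using iu unfolding \<nu>_def u_def by (auto simp: integrable_boltzmann integral_boltzmann)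
    have Iw: "integrable lborel w" "(\<integral>x. w x \<partial>lborel) = (\<integral>x. exp (G x + ?k s * (norm (q x))\<^sup>2) \<partial>\<nu>)"
      using iw unfolding \<nu>_def w_def by (auto simp: integrable_boltzmann integral_boltzmann)
    have "integrable \<nu> (\<lambda>x. 1::real)" by simp
    then have Iv: "integrable lborel v"
      unfolding \<nu>_def v_def by (simp add: integrable_boltzmann)
    have "(\<integral>x. v x \<partial>lborel) = (\<integral>x. 1 \<partial>\<nu>)"
      unfolding \<nu>_def v_def by (rule integral_boltzmann[symmetric]) auto
    then have Zv: "(\<integral>x. v x \<partial>lborel) = measure \<nu> UNIV" by (simp add: \<nu>_def)
    have nn: "0 \<le> u x" "0 \<le> v x" "0 \<le> w x" for x by (auto simp: u_def v_def w_def)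
    have PL: "(\<integral>x. u x \<partial>lborel) powr (1 - s) * (\<integral>x. v x \<partial>lborel) powr s \<le> (\<integral>x. w x \<partial>lborel)"
    proof (rule prekopa_leindler_integral)
      fix x y :: 'a
      let ?z = "(1 - s) *\<^sub>R x + s *\<^sub>R y"
      show "u x powr (1 - s) * v y powr s \<le> w ?z"
      proof (cases "x \<in> K \<and> y \<in> K")
        case True
        then have z: "?z \<in> K" using K(2) s by (auto simp: convex_def)
        have "u x powr (1 - s) * v y powr s = exp ((1 - s) * (G x / (1 - s) - E x) + s * (- E y))"
        proof -
          have "u x = exp (G x / (1 - s) - E x)" "v y = exp (- E y)"
            using True by (auto simp: u_def v_def exp_add[symmetric])
          then show ?thesis by (simp only: exp_powr_real exp_add mult.commute)
        qed
        also have "\<dots> \<le> exp (G ?z + (norm (q ?z))\<^sup>2 / (4 * ?c) - E ?z)"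
          using bobkov_ledoux_pointwise[OF sc _ _ cpos G _ _ z] True s by simp
        also have "(norm (q ?z))\<^sup>2 / (4 * ?c) = ?k s * (norm (q ?z))\<^sup>2" unfolding ck by simp
        also have "exp (G ?z + ?k s * (norm (q ?z))\<^sup>2 - E ?z) = w ?z"
          unfolding w_def using z by (simp only: indicator_simps mult_1_left exp_add exp_diff exp_minus divide_inverse mult.commute)
        finally show ?thesis .
      next
        case False
        then show ?thesis by (auto simp: u_def v_def w_def)
      qed
    qed (use s Iu Iv Iw nn in auto)
    have lower: "m + s / (1 - s) * A \<le> (\<integral>x. u x \<partial>lborel)"
    proof -
      have "m + s / (1 - s) * A = (\<integral>x. exp (G x) + s / (1 - s) * (G x * exp (G x)) \<partial>\<nu>)"
        unfolding m_def A_def using i1 i2 by simp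
      also have "\<dots> \<le> (\<integral>x. exp (G x / (1 - s)) \<partial>\<nu>)"
      proof (intro integral_mono iu)
        fix x
        have "exp (G x) + s / (1 - s) * (G x * exp (G x)) = exp (G x) * (1 + s / (1 - s) * G x)"
          by (simp add: algebra_simps)
        also have "\<dots> \<le> exp (G x) * exp (s / (1 - s) * G x)"
          by (intro mult_left_mono exp_ge_add_one_self) auto
        also have "\<dots> = exp (G x / (1 - s))"
          using s by (simp add: exp_add[symmetric] field_simps)
        finally show "exp (G x) + s / (1 - s) * (G x * exp (G x)) \<le> exp (G x / (1 - s))" .
      qed (use i1 i2 in auto)
      finally show ?thesis using Iu by simp
    qed
    have upper: "(\<integral>x. w x \<partial>lborel) \<le> m + ?k s * B + (?k s)\<^sup>2 * D"
    proof -
      have "(\<integral>x. w x \<partial>lborel) = (\<integral>x. exp (G x + ?k s * (norm (q x))\<^sup>2) \<partial>\<nu>)" by (rule Iw)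
      also have "\<dots> \<le> (\<integral>x. exp (G x) + ?k s * ((norm (q x))\<^sup>2 * exp (G x)) + (?k s)\<^sup>2 * (((norm (q x))\<^sup>2)\<^sup>2 * exp (G x)) \<partial>\<nu>)"
      proof (intro integral_mono_AE iw)
        show "integrable \<nu> (\<lambda>x. exp (G x) + ?k s * ((norm (q x))\<^sup>2 * exp (G x)) + (?k s)\<^sup>2 * (((norm (q x))\<^sup>2)\<^sup>2 * exp (G x)))"
          by (rule comb(1))
        show "AE x in \<nu>. exp (G x + ?k s * (norm (q x))\<^sup>2) \<le> exp (G x) + ?k s * ((norm (q x))\<^sup>2 * exp (G x)) + (?k s)\<^sup>2 * (((norm (q x))\<^sup>2)\<^sup>2 * exp (G x))"
          unfolding \<nu>_def
        proof (intro AE_boltzmannI)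
          fix x assume x: "x \<in> K"
          let ?y = "?k s * (norm (q x))\<^sup>2"
          have "?y \<le> ?k s * b\<^sup>2" using b(3)[OF x] k0 by (intro mult_left_mono power_mono) auto
          also have "\<dots> \<le> 1" using e(3)[of s] s by simp
          finally have "exp ?y \<le> 1 + ?y + ?y\<^sup>2" using k0 by (intro exp_bound mult_nonneg_nonneg) auto
          then have "exp (G x) * exp ?y \<le> exp (G x) * (1 + ?y + ?y\<^sup>2)" by (intro mult_left_mono) auto
          also have "\<dots> = exp (G x) + ?k s * ((norm (q x))\<^sup>2 * exp (G x)) + (?k s)\<^sup>2 * (((norm (q x))\<^sup>2)\<^sup>2 * exp (G x))"
            unfolding power_mult_distrib by (simp only: ring_distribs mult_1_right mult_ac)
          finally show "exp (G x + ?y) \<le> exp (G x) + ?k s * ((norm (q x))\<^sup>2 * exp (G x)) + (?k s)\<^sup>2 * (((norm (q x))\<^sup>2)\<^sup>2 * exp (G x))"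
            by (simp only: exp_add)
        qed auto
      qed
      also have "\<dots> = m + ?k s * B + (?k s)\<^sup>2 * D"
        by (rule comb(2))
      finally show ?thesis .
    qed
    have "(m + s / (1 - s) * A) powr (1 - s) * measure \<nu> UNIV powr s
       \<le> (\<integral>x. u x \<partial>lborel) powr (1 - s) * (\<integral>x. v x \<partial>lborel) powr s"
      unfolding Zv using lower e(4)[of s] s by (intro mult_right_mono powr_mono2) auto
    then show "(m + s / (1 - s) * A) powr (1 - s) * measure \<nu> UNIV powr s \<le> m + ?k s * B + (?k s)\<^sup>2 * D"
      using PL upper by linarith
  qed
  then show ?thesis unfolding A_def B_def .
qed


text \<open>
  The Bregman divergence of \<open>y ln y\<close> between \<open>y\<close> and \<open>c\<close>. It is nonnegative, and its integral
  is smallest when \<open>c\<close> is the mean, where it equals the entropy; this form of the entropy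
  passes to limits by Fatou.
\<close>

definition entropy_gap :: "real \<Rightarrow> real \<Rightarrow> real" where
  "entropy_gap c y = y * ln y - y * ln c - y + c"

lemma entropy_gap_nonneg:
  assumes "c > 0" "y \<ge> 0"
  shows "entropy_gap c y \<ge> 0"
proof (cases "y = 0")
  case False
  then have y: "y > 0" using assms by simp
  have "ln (c / y) \<le> c / y - 1" using assms y by (intro ln_le_minus_one) auto
  then have "y * ln (c / y) \<le> y * (c / y - 1)" using y by (intro mult_left_mono) auto
  then show ?thesis using y assms by (simp add: entropy_gap_def ln_div algebra_simps)
qed (use assms in \<open>simp add: entropy_gap_def\<close>)

lemma tendsto_xlnx:
  fixes y :: real
  assumes "(f \<longlongrightarrow> y) F" "y \<ge> 0" "\<And>n. f n \<ge> 0"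
  shows "((\<lambda>n. f n * ln (f n)) \<longlongrightarrow> y * ln y) F"
proof (cases "y = 0")
  case False
  then show ?thesis using assms by (intro tendsto_intros) auto
next
  case True
  have lim: "((\<lambda>z::real. z * ln z) \<longlongrightarrow> 0) (at_right 0)"
  proof -
    have "((\<lambda>t::real. - (ln t / t)) \<longlongrightarrow> 0) at_top"
      using tendsto_minus[OF ln_x_over_x_tendsto_0] by simp
    then have "((\<lambda>z::real. - (ln (inverse z) / inverse z)) \<longlongrightarrow> 0) (at_right 0)"
      by (rule filterlim_compose[OF _ filterlim_inverse_at_top_right])
    then show ?thesis by (rule Lim_transform_eventually)
        (auto simp: eventually_at_right_field ln_inverse ln_div field_simps intro!: exI[of _ 1])
  qed
  have "((\<lambda>z::real. z * ln z) \<longlongrightarrow> 0) (at 0 within {0..})"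
  proof -
    have "at (0::real) within {0..} = at_right 0"
      by (metis at_within_Icc_at_right at_within_Ici_at_right)
    then show ?thesis using lim by simp
  qed
  then have "continuous (at 0 within {0..}) (\<lambda>z::real. z * ln z)"
    by (simp add: continuous_within)
  from continuous_within_tendsto_compose'[OF this, of f F] show ?thesis
    using assms True by simp
qed

lemma tendsto_entropy_gap:
  assumes "(c \<longlongrightarrow> c0) F" "c0 > 0" "(f \<longlongrightarrow> y) F" "y \<ge> 0" "\<And>n. f n \<ge> 0"
  shows "((\<lambda>n. entropy_gap (c n) (f n)) \<longlongrightarrow> entropy_gap c0 y) F"
  unfolding entropy_gap_def using assms by (intro tendsto_intros tendsto_xlnx) auto

lemma borel_measurable_entropy_gap[measurable]:
  assumes [measurable]: "f \<in> borel_measurable M"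
  shows "(\<lambda>x. entropy_gap c (f x)) \<in> borel_measurable M"
  unfolding entropy_gap_def by measurable

text \<open>
  The two integrals of the gap differ by the gap between \<open>c\<close> and the mean, times the total
  mass.
\<close>

lemma (in finite_measure) integral_entropy_gap_mean_le:
  assumes F: "integrable M F" "\<And>x. F x \<ge> 0" and FF: "integrable M (\<lambda>x. F x * ln (F x))"
    and c: "c > 0" and m: "m > 0" "(\<integral>x. F x \<partial>M) = m * measure M (space M)"
  shows "(\<integral>x. entropy_gap m (F x) \<partial>M) = (\<integral>x. F x * ln (F x) \<partial>M) - m * ln m * measure M (space M)"
    and "(\<integral>x. entropy_gap m (F x) \<partial>M) \<le> (\<integral>x. entropy_gap c (F x) \<partial>M)"
proof -
  have eq: "(\<integral>x. entropy_gap d (F x) \<partial>M) = (\<integral>x. F x * ln (F x) \<partial>M) + (c - m - m * ln d) * measure M (space M)  + (d - c) * measure M (space M)" for d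
    unfolding entropy_gap_def using F FF by (simp add: m algebra_simps)
  show "(\<integral>x. entropy_gap m (F x) \<partial>M) = (\<integral>x. F x * ln (F x) \<partial>M) - m * ln m * measure M (space M)"
    unfolding eq by (simp add: algebra_simps)
  have "0 \<le> entropy_gap c m * measure M (space M)" using entropy_gap_nonneg[of c m] c m by simp
  then show "(\<integral>x. entropy_gap m (F x) \<partial>M) \<le> (\<integral>x. entropy_gap c (F x) \<partial>M)"
    unfolding eq by (simp add: entropy_gap_def algebra_simps)
qed

text \<open>
  By concavity, the logarithm of the quotient \<open>(Fx\<^sup>2 + d) / (Fz\<^sup>2 + d)\<close> is at most
  \<open>(Fx\<^sup>2 - Fz\<^sup>2) / (Fz\<^sup>2 + d)\<close>; the numerator is expanded around \<open>Fz\<close>, and \<open>d\<close> bounds the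
  denominator from below.
\<close>

lemma log_square_taylor_bound:
  fixes p h :: "'a::real_inner" and Fx Fz C d b r :: real
  assumes F: "\<bar>Fx - Fz - p \<bullet> h\<bar> \<le> C * (norm h)\<^sup>2" and C: "C \<ge> 0" and d: "d > 0"
    and b: "\<bar>Fz\<bar> \<le> b" "norm p \<le> b" and h: "norm h \<le> r"
  shows "ln (Fx\<^sup>2 + d) \<le> ln (Fz\<^sup>2 + d) + ((2 * Fz / (Fz\<^sup>2 + d)) *\<^sub>R p) \<bullet> h
           + (2 * b * C + (b + C * r)\<^sup>2) / d * (norm h)\<^sup>2"
proof -
  have r: "r \<ge> 0" using h norm_ge_zero order_trans by blast
  have b0: "b \<ge> 0" using b(1) by linarith
  let ?D = "Fx - Fz"
  define e where "e = ?D - p \<bullet> h"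
  have e: "\<bar>e\<bar> \<le> C * (norm h)\<^sup>2" using F by (simp add: e_def)
  have D: "\<bar>?D\<bar> \<le> (b + C * r) * norm h"
  proof -
    have "\<bar>p \<bullet> h\<bar> \<le> norm p * norm h" by (rule Cauchy_Schwarz_ineq2)
    also have "\<dots> \<le> b * norm h" using b(2) by (intro mult_right_mono) auto
    finally have "\<bar>?D\<bar> \<le> b * norm h + C * (norm h)\<^sup>2" using e by (simp add: e_def)
    also have "C * (norm h)\<^sup>2 \<le> C * r * norm h"
      using h C by (simp add: power2_eq_square mult.assoc[symmetric] mult_right_mono mult_left_mono)
    finally show ?thesis by (simp add: algebra_simps)
  qed
  have "\<bar>?D\<bar>\<^sup>2 \<le> ((b + C * r) * norm h)\<^sup>2" using D by (intro power_mono) auto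
  then have D2: "?D\<^sup>2 \<le> (b + C * r)\<^sup>2 * (norm h)\<^sup>2" by (simp add: power_mult_distrib)
  have "Fz * e \<le> \<bar>Fz\<bar> * \<bar>e\<bar>" by (simp add: abs_mult[symmetric])
  also have "\<dots> \<le> b * (C * (norm h)\<^sup>2)" using b(1) e by (intro mult_mono) auto
  finally have Fe: "Fz * e \<le> b * (C * (norm h)\<^sup>2)" .
  have "Fx\<^sup>2 - Fz\<^sup>2 = 2 * Fz * (p \<bullet> h) + 2 * (Fz * e) + ?D\<^sup>2"
    by (simp add: e_def power2_eq_square algebra_simps)
  also have "\<dots> \<le> 2 * Fz * (p \<bullet> h) + 2 * (b * (C * (norm h)\<^sup>2)) + (b + C * r)\<^sup>2 * (norm h)\<^sup>2"
    using Fe D2 by linarith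
  also have "\<dots> = 2 * Fz * (p \<bullet> h) + (2 * b * C + (b + C * r)\<^sup>2) * (norm h)\<^sup>2"
    by (simp add: algebra_simps)
  finally have sq: "Fx\<^sup>2 - Fz\<^sup>2 \<le> 2 * Fz * (p \<bullet> h) + (2 * b * C + (b + C * r)\<^sup>2) * (norm h)\<^sup>2" .
  have pos: "Fz\<^sup>2 + d > 0" "Fx\<^sup>2 + d > 0" using d by (auto intro: add_nonneg_pos)
  have "ln (Fx\<^sup>2 + d) - ln (Fz\<^sup>2 + d) = ln ((Fx\<^sup>2 + d) / (Fz\<^sup>2 + d))"
    using pos by (simp add: ln_div)
  also have "\<dots> \<le> (Fx\<^sup>2 + d) / (Fz\<^sup>2 + d) - 1" using pos by (intro ln_le_minus_one) auto
  also have "\<dots> = (Fx\<^sup>2 - Fz\<^sup>2) / (Fz\<^sup>2 + d)" using pos by (simp add: field_simps)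
  also have "\<dots> \<le> (2 * Fz * (p \<bullet> h) + (2 * b * C + (b + C * r)\<^sup>2) * (norm h)\<^sup>2) / (Fz\<^sup>2 + d)"
    using sq pos by (intro divide_right_mono) auto
  also have "\<dots> = ((2 * Fz / (Fz\<^sup>2 + d)) *\<^sub>R p) \<bullet> h + (2 * b * C + (b + C * r)\<^sup>2) * (norm h)\<^sup>2 / (Fz\<^sup>2 + d)"
    by (simp add: add_divide_distrib)
  also have "(2 * b * C + (b + C * r)\<^sup>2) * (norm h)\<^sup>2 / (Fz\<^sup>2 + d) \<le> (2 * b * C + (b + C * r)\<^sup>2) * (norm h)\<^sup>2 / d"
    using d b0 C r pos by (intro divide_left_mono mult_nonneg_nonneg add_nonneg_nonneg) auto
  finally show ?thesis by simp
qed

text \<open>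
  The exponential form with \<open>G = ln (F\<^sup>2 + d)\<close>, whose gradient \<open>q = 2 F p / (F\<^sup>2 + d)\<close>
  satisfies \<open>|q|\<^sup>2 e\<^sup>G \<le> 4 |p|\<^sup>2\<close>.
\<close>

lemma log_sobolev_compact:
  fixes E F :: "'a::euclidean_space \<Rightarrow> real" and p :: "'a \<Rightarrow> 'a"
  assumes K: "compact K" "convex K" and \<rho>: "\<rho> > 0" and sc: "strongly_convex_on K \<rho> E"
    and [measurable]: "E \<in> borel_measurable borel" "F \<in> borel_measurable borel" "p \<in> borel_measurable borel"
    and b: "\<And>x. x \<in> K \<Longrightarrow> \<bar>E x\<bar> \<le> b" "\<And>x. x \<in> K \<Longrightarrow> \<bar>F x\<bar> \<le> b" "\<And>x. x \<in> K \<Longrightarrow> norm (p x) \<le> b"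
    and C: "C \<ge> 0"
    and F: "\<And>x z. x \<in> K \<Longrightarrow> z \<in> K \<Longrightarrow> \<bar>F x - F z - p z \<bullet> (x - z)\<bar> \<le> C * (norm (x - z))\<^sup>2"
    and d: "d > 0"
  defines "\<nu> \<equiv> boltzmann K E"
  defines "c \<equiv> (\<integral>x. (F x)\<^sup>2 + d \<partial>\<nu>) / measure \<nu> UNIV"
  assumes Z: "measure \<nu> UNIV > 0"
  shows "integrable \<nu> (\<lambda>x. (norm (p x))\<^sup>2)" "integrable \<nu> (\<lambda>x. (F x)\<^sup>2)"
    "(\<integral>\<^sup>+x. ennreal (entropy_gap c ((F x)\<^sup>2 + d)) \<partial>\<nu>) \<le> ennreal (2 / \<rho> * (\<integral>x. (norm (p x))\<^sup>2 \<partial>\<nu>))"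
proof -
  have Km[measurable]: "K \<in> sets borel" using K by (simp add: borel_compact)
  interpret finite_measure \<nu> unfolding \<nu>_def using finite_measure_boltzmann[OF K(1) _ b(1)] by simp
  have int: "integrable \<nu> h" if "h \<in> borel_measurable borel" "\<And>x. x \<in> K \<Longrightarrow> \<bar>h x\<bar> \<le> c" for h :: "'a \<Rightarrow> real" and c
    unfolding \<nu>_def by (rule integrable_boltzmann_bounded[OF K(1) _ that(1) b(1) that(2)]) auto
  have ne: "K \<noteq> {}"
  proof
    assume "K = {}"
    then have "emeasure \<nu> UNIV = 0" by (simp add: \<nu>_def boltzmann_def emeasure_density)
    then show False using Z by (simp add: measure_def)
  qed
  have b0: "b \<ge> 0" using ne b(1) abs_ge_zero order_trans by blast
  obtain r where r: "\<And>x z. x \<in> K \<Longrightarrow> z \<in> K \<Longrightarrow> norm (x - z) \<le> r"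
    using compact_imp_bounded[OF K(1)] bounded_two_points[of K] by (auto simp: dist_norm)
  have r0: "r \<ge> 0" using ne r norm_ge_zero order_trans by blast
  show ip: "integrable \<nu> (\<lambda>x. (norm (p x))\<^sup>2)"
    by (rule int[of _ "b\<^sup>2"]) (auto intro!: power_mono b)
  have Fb: "(F x)\<^sup>2 \<le> b\<^sup>2" if "x \<in> K" for x using power_mono[OF b(2)[OF that], of 2] by simp
  show iF: "integrable \<nu> (\<lambda>x. (F x)\<^sup>2)"
    by (rule int[of _ "b\<^sup>2"]) (auto intro!: Fb)
  define G where "G x = ln ((F x)\<^sup>2 + d)" for x
  define q where "q x = (2 * F x / ((F x)\<^sup>2 + d)) *\<^sub>R p x" for x
  have [measurable]: "G \<in> borel_measurable borel" "q \<in> borel_measurable borel"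
    unfolding G_def q_def by measurable
  have pos: "(F x)\<^sup>2 + d > 0" for x using d by (auto intro: add_nonneg_pos)
  have eG: "exp (G x) = (F x)\<^sup>2 + d" for x using pos by (simp add: G_def)
  have qb: "norm (q x) \<le> 2 * b / d * b" if "x \<in> K" for x
  proof -
    have "norm (q x) = 2 * \<bar>F x\<bar> / ((F x)\<^sup>2 + d) * norm (p x)"
      using pos[of x] by (simp add: q_def abs_mult)
    also have "\<dots> \<le> 2 * b / d * b" using b[OF that] d b0 by (intro mult_mono frac_le) auto
    finally show ?thesis .
  qed
  have Gb: "\<bar>G x\<bar> \<le> max \<bar>ln d\<bar> \<bar>ln (b\<^sup>2 + d)\<bar>" if "x \<in> K" for x
  proof -
    have "ln d \<le> G x" unfolding G_def using d pos[of x] by (subst ln_le_cancel_iff) auto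
    moreover have "G x \<le> ln (b\<^sup>2 + d)" unfolding G_def
      using Fb[OF that] pos[of x] by (subst ln_le_cancel_iff) auto
    ultimately show ?thesis by linarith
  qed
  \<comment> \<open>a common bound for \<open>E\<close>, \<open>G\<close> and \<open>q\<close>\<close>
  define B where "B = max b (max (2 * b / d * b) (max \<bar>ln d\<bar> \<bar>ln (b\<^sup>2 + d)\<bar>))"
  have B: "b \<le> B" "2 * b / d * b \<le> B" "max \<bar>ln d\<bar> \<bar>ln (b\<^sup>2 + d)\<bar> \<le> B"
    unfolding B_def by (rule max.cobounded1 max.coboundedI2[OF max.cobounded1] max.coboundedI2[OF max.cobounded2])+
  let ?m = "\<integral>x. exp (G x) \<partial>\<nu>"
  have LS: "(\<integral>x. G x * exp (G x) \<partial>\<nu>) - ?m * ln ?m + ?m * ln (measure \<nu> UNIV)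
    \<le> 1 / (2 * \<rho>) * (\<integral>x. (norm (q x))\<^sup>2 * exp (G x) \<partial>\<nu>)"
    unfolding \<nu>_def
  proof (rule log_sobolev_exponential[OF K \<rho> sc])
    show "measure (boltzmann K E) UNIV > 0" using Z by (simp add: \<nu>_def)
    show "0 \<le> (2 * b * C + (b + C * r)\<^sup>2) / d" using b0 C d by auto
    fix x assume x: "x \<in> K"
    show "\<bar>E x\<bar> \<le> B" "\<bar>G x\<bar> \<le> B" "norm (q x) \<le> B"
      by (rule order_trans[OF b(1)[OF x] B(1)] order_trans[OF Gb[OF x] B(3)] order_trans[OF qb[OF x] B(2)])+
    fix z assume z: "z \<in> K"
    show "G x \<le> G z + q z \<bullet> (x - z) + (2 * b * C + (b + C * r)\<^sup>2) / d * (norm (x - z))\<^sup>2"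
      unfolding G_def q_def by (rule log_square_taylor_bound) (use F[OF x z] C d b(2,3)[OF z] r[OF x z] in auto)
  qed auto
  have i1: "integrable \<nu> (\<lambda>x. (F x)\<^sup>2 + d)" using iF by simp
  have i2: "integrable \<nu> (\<lambda>x. ((F x)\<^sup>2 + d) * ln ((F x)\<^sup>2 + d))"
  proof (rule int[of _ "(b\<^sup>2 + d) * B"])
    fix x assume x: "x \<in> K"
    have "\<bar>(F x)\<^sup>2 + d\<bar> \<le> b\<^sup>2 + d" using Fb[OF x] d by simp
    moreover have "\<bar>ln ((F x)\<^sup>2 + d)\<bar> \<le> B" using order_trans[OF Gb[OF x] B(3)] by (simp add: G_def)
    ultimately show "\<bar>((F x)\<^sup>2 + d) * ln ((F x)\<^sup>2 + d)\<bar> \<le> (b\<^sup>2 + d) * B"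
      unfolding abs_mult using d by (intro mult_mono) auto
  qed auto
  have mZ: "?m = c * measure \<nu> UNIV" using Z by (simp add: eG c_def)
  have "d * measure \<nu> UNIV = (\<integral>x. d \<partial>\<nu>)" by (simp add: \<nu>_def)
  also have "\<dots> \<le> ?m" unfolding eG by (intro integral_mono i1) auto
  finally have "?m > 0" using d Z by (smt (verit) mult_pos_pos)
  then have c: "c > 0" using Z by (simp add: mZ zero_less_mult_iff)
  have gap: "(\<integral>x. entropy_gap c ((F x)\<^sup>2 + d) \<partial>\<nu>) = (\<integral>x. G x * exp (G x) \<partial>\<nu>) - ?m * ln ?m + ?m * ln (measure \<nu> UNIV)"
  proof -
    have sp: "space \<nu> = UNIV" by (simp add: \<nu>_def)
    have "(\<integral>x. entropy_gap c ((F x)\<^sup>2 + d) \<partial>\<nu>) = (\<integral>x. G x * exp (G x) \<partial>\<nu>) - ?m * ln c"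
      using integral_entropy_gap_mean_le(1)[OF i1 less_imp_le[OF pos] i2 c c] mZ
      by (simp add: sp G_def eG[unfolded G_def] mult.commute mult.left_commute)
    also have "ln c = ln ?m - ln (measure \<nu> UNIV)" using c Z by (simp add: mZ ln_mult)
    finally show ?thesis by (simp add: algebra_simps)
  qed
  have "(\<integral>x. (norm (q x))\<^sup>2 * exp (G x) \<partial>\<nu>) \<le> (\<integral>x. 4 * (norm (p x))\<^sup>2 \<partial>\<nu>)"
  proof (rule integral_mono')
    fix x
    have "(norm (q x))\<^sup>2 * exp (G x) = 4 * (norm (p x))\<^sup>2 * ((F x)\<^sup>2 / ((F x)\<^sup>2 + d))"
      using pos[of x] by (simp add: q_def eG power_mult_distrib power_divide) (simp add: power2_eq_square)
    also have "\<dots> \<le> 4 * (norm (p x))\<^sup>2 * 1" using d pos[of x] by (intro mult_left_mono) auto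
    finally show "(norm (q x))\<^sup>2 * exp (G x) \<le> 4 * (norm (p x))\<^sup>2" by simp
  qed (use ip in auto)
  then have "1 / (2 * \<rho>) * (\<integral>x. (norm (q x))\<^sup>2 * exp (G x) \<partial>\<nu>) \<le> 1 / (2 * \<rho>) * (4 * (\<integral>x. (norm (p x))\<^sup>2 \<partial>\<nu>))"
    using \<rho> ip by (intro mult_left_mono) auto
  then have main: "(\<integral>x. entropy_gap c ((F x)\<^sup>2 + d) \<partial>\<nu>) \<le> 2 / \<rho> * (\<integral>x. (norm (p x))\<^sup>2 \<partial>\<nu>)"
    using LS gap by simp
  have "integrable \<nu> (\<lambda>x. entropy_gap c ((F x)\<^sup>2 + d))"
    unfolding entropy_gap_def using i1 i2 iF by simp
  then have "(\<integral>\<^sup>+x. ennreal (entropy_gap c ((F x)\<^sup>2 + d)) \<partial>\<nu>) = ennreal (\<integral>x. entropy_gap c ((F x)\<^sup>2 + d) \<partial>\<nu>)"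
    using c pos by (intro nn_integral_eq_integral) (auto intro!: AE_I2 entropy_gap_nonneg order.strict_implies_order[OF pos])
  then show "(\<integral>\<^sup>+x. ennreal (entropy_gap c ((F x)\<^sup>2 + d)) \<partial>\<nu>) \<le> ennreal (2 / \<rho> * (\<integral>x. (norm (p x))\<^sup>2 \<partial>\<nu>))"
    using main by (simp add: ennreal_leI)
qed

section \<open>Smooth mollifiers\<close>

text \<open>
  The function \<open>s \<mapsto> s\<^sup>-\<^sup>k e\<^sup>-\<^sup>1\<^sup>/\<^sup>s\<close> extended by zero. The powers of \<open>s\<close> are there because the
  derivative of each member of the family is a combination of the next two.
\<close>

definition flat :: "nat \<Rightarrow> real \<Rightarrow> real" where
  "flat k s = (if s > 0 then exp (- (1 / s)) / s ^ k else 0)"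

lemma flat_nonneg: "flat k s \<ge> 0"
  by (simp add: flat_def)

text \<open>
  The term of order \<open>k + 2\<close> in the series of \<open>exp (1 / s)\<close> gives a quadratic bound, which
  makes the derivative at \<open>0\<close> vanish.
\<close>

lemma flat_le_square: "flat k s \<le> fact (k + 2) * s\<^sup>2"
proof (cases "s > 0")
  case True
  define n where "n = k + 2"
  have "(1 / s) ^ n / fact n \<le> exp (1 / s)"
  proof -
    have s: "summable (\<lambda>n. (1 / s) ^ n /\<^sub>R fact n)" by (rule summable_exp_generic)
    have "(\<Sum>n\<in>{n}. (1 / s) ^ n /\<^sub>R fact n) \<le> (\<Sum>n. (1 / s) ^ n /\<^sub>R fact n)"
      using s True by (intro sum_le_suminf) auto
    then show ?thesis by (simp add: exp_def divide_inverse mult.commute)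
  qed
  then have "inverse (fact n * s ^ n) \<le> exp (1 / s)"
    by (simp add: power_one_over divide_inverse power_inverse mult.commute)
  then have "inverse (exp (1 / s)) \<le> inverse (inverse (fact n * s ^ n))"
    using True by (intro le_imp_inverse_le) auto
  then have "exp (- (1 / s)) \<le> fact n * s ^ n"
    by (simp add: exp_minus)
  then have "exp (- (1 / s)) / s ^ k \<le> fact n * s ^ n / s ^ k"
    using True by (intro divide_right_mono) auto
  also have "\<dots> = fact n * s\<^sup>2" using True by (simp add: n_def power_add power2_eq_square)
  finally show ?thesis using True by (simp add: flat_def n_def)
qed (simp add: flat_def)

lemma has_real_derivative_flat:
  "(flat k has_real_derivative flat (k + 2) s - real k * flat (k + 1) s) (at s)"
proof -
  consider "s > 0" | "s < 0" | "s = 0" by linarith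
  then show ?thesis
  proof cases
    case 1
    have "((\<lambda>s. exp (- (1 / s)) / s ^ k) has_real_derivative flat (k + 2) s - real k * flat (k + 1) s) (at s)"
    proof (cases k)
      case 0
      then show ?thesis using 1
        by (auto intro!: derivative_eq_intros simp: flat_def field_simps power2_eq_square)
    next
      case (Suc j)
      show ?thesis using 1 unfolding Suc
        by (auto intro!: derivative_eq_intros simp: flat_def)
           (cases j; simp add: divide_simps power2_eq_square; simp add: algebra_simps)
    qed
    then show ?thesis
      by (rule has_field_derivative_transform_within_open[where S = "{0<..}"])
         (use 1 in \<open>auto simp: flat_def\<close>)
  next
    case 2
    have "((\<lambda>_. 0) has_real_derivative flat (k + 2) s - real k * flat (k + 1) s) (at s)"
      using 2 by (simp add: flat_def)
    then show ?thesis
      by (rule has_field_derivative_transform_within_open[where S = "{..<0}"])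
         (use 2 in \<open>auto simp: flat_def\<close>)
  next
    case 3
    let ?c = "fact (k + 2) :: real"
    have "((\<lambda>h. (flat k (0 + h) - flat k 0) / h) \<longlongrightarrow> 0) (at 0)"
    proof (rule Lim_null_comparison)
      show "eventually (\<lambda>h. norm ((flat k (0 + h) - flat k 0) / h) \<le> ?c * \<bar>h\<bar>) (at 0)"
      proof (intro always_eventually allI)
        fix h :: real
        have "norm ((flat k (0 + h) - flat k 0) / h) = flat k h / \<bar>h\<bar>"
          by (simp add: flat_def abs_divide)
        also have "\<dots> \<le> ?c * h\<^sup>2 / \<bar>h\<bar>" by (intro divide_right_mono flat_le_square) auto
        also have "\<dots> = ?c * \<bar>h\<bar>" by (simp add: power2_eq_square abs_if)
        finally show "norm ((flat k (0 + h) - flat k 0) / h) \<le> ?c * \<bar>h\<bar>" .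
      qed
      show "((\<lambda>h::real. ?c * \<bar>h\<bar>) \<longlongrightarrow> 0) (at 0)"
        by (auto intro!: tendsto_eq_intros)
    qed
    then show ?thesis using 3 by (simp add: DERIV_def flat_def)
  qed
qed

text \<open>
  An algebra that contains bump functions and is closed under directional derivatives. Its
  members are therefore differentiable to every order, without any formula for higher
  derivatives.
\<close>

inductive_set smooth_functions :: "('a::real_inner \<Rightarrow> real) set" where
  const: "(\<lambda>_. c) \<in> smooth_functions"
| inner: "(\<lambda>x. x \<bullet> v) \<in> smooth_functions"
| flat: "(\<lambda>x. flat k (r - (norm (x - a))\<^sup>2)) \<in> smooth_functions"
| add: "f \<in> smooth_functions \<Longrightarrow> g \<in> smooth_functions \<Longrightarrow> (\<lambda>x. f x + g x) \<in> smooth_functions"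
| mult: "f \<in> smooth_functions \<Longrightarrow> g \<in> smooth_functions \<Longrightarrow> (\<lambda>x. f x * g x) \<in> smooth_functions"

lemma smooth_functions_derivative:
  assumes "f \<in> smooth_functions"
  shows "\<exists>D. (\<forall>x. (f has_derivative D x) (at x)) \<and> (\<forall>v. (\<lambda>x. D x v) \<in> smooth_functions)"
  using assms
proof induction
  case (const c)
  have "\<forall>x. ((\<lambda>_::'a. c) has_derivative (\<lambda>v. 0)) (at x)" by auto
  then show ?case using smooth_functions.const[of 0] by (intro exI[of _ "\<lambda>x v. 0"]) simp
next
  case (inner v)
  have "\<forall>x. ((\<lambda>x. x \<bullet> v) has_derivative (\<lambda>h. h \<bullet> v)) (at x)"
    by (auto intro!: derivative_eq_intros)
  then show ?case by (intro exI[of _ "\<lambda>x h. h \<bullet> v"] conjI allI smooth_functions.const) auto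
next
  case (flat k r a)
  let ?q = "\<lambda>x. r - (norm (x - a))\<^sup>2"
  let ?D = "\<lambda>x v. (flat (k + 2) (?q x) + (- real k) * flat (k + 1) (?q x)) * ((- 2) * (x \<bullet> v + - (a \<bullet> v)))"
  have der: "((\<lambda>x. flat k (?q x)) has_derivative ?D x) (at x)" for x
  proof -
    have "(?q has_derivative (\<lambda>v. - 2 * (x \<bullet> v - a \<bullet> v))) (at x)"
      unfolding power2_norm_eq_inner
      by (auto intro!: derivative_eq_intros simp: inner_diff_left inner_diff_right inner_commute algebra_simps)
    from has_derivative_compose[OF this has_field_derivative_imp_has_derivative[OF has_real_derivative_flat]]
    show ?thesis by simp
  qed
  have sm: "(\<lambda>x. ?D x v) \<in> smooth_functions" for v
    by (intro smooth_functions.intros)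
  show ?case by (intro exI[of _ ?D] conjI allI der sm)
next
  case (add f g)
  then obtain D E where D: "\<And>x. (f has_derivative D x) (at x)" "\<And>v. (\<lambda>x. D x v) \<in> smooth_functions"
    and E: "\<And>x. (g has_derivative E x) (at x)" "\<And>v. (\<lambda>x. E x v) \<in> smooth_functions" by blast
  have "\<forall>x. ((\<lambda>x. f x + g x) has_derivative (\<lambda>v. D x v + E x v)) (at x)"
    using D(1) E(1) by (auto intro!: has_derivative_add)
  moreover have "\<forall>v. (\<lambda>x. D x v + E x v) \<in> smooth_functions"
    using D(2) E(2) by (auto intro: smooth_functions.intros)
  ultimately show ?case by (intro exI[of _ "\<lambda>x v. D x v + E x v"]) simp
next
  case (mult f g)
  then obtain D E where D: "\<And>x. (f has_derivative D x) (at x)" "\<And>v. (\<lambda>x. D x v) \<in> smooth_functions"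
    and E: "\<And>x. (g has_derivative E x) (at x)" "\<And>v. (\<lambda>x. E x v) \<in> smooth_functions" by blast
  have "\<forall>x. ((\<lambda>x. f x * g x) has_derivative (\<lambda>v. f x * E x v + D x v * g x)) (at x)"
    using D(1) E(1) by (auto intro!: has_derivative_mult)
  moreover have "\<forall>v. (\<lambda>x. f x * E x v + D x v * g x) \<in> smooth_functions"
    by (intro allI smooth_functions.add smooth_functions.mult D(2) E(2) mult.hyps)
  ultimately show ?case by (intro exI[of _ "\<lambda>x v. f x * E x v + D x v * g x"]) simp
qed

lemma smooth_functions_continuous:
  assumes "f \<in> smooth_functions"
  shows "continuous_on S f"
proof -
  obtain D where "\<And>x. (f has_derivative D x) (at x)"
    using smooth_functions_derivative[OF assms] by blast
  then show ?thesis
    by (intro continuous_at_imp_continuous_on ballI has_derivative_continuous) auto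
qed

lemma smooth_functions_C_k:
  assumes "f \<in> smooth_functions"
  shows "C_k k f"
  using assms
proof (induction k arbitrary: f)
  case 0
  then show ?case by (simp add: smooth_functions_continuous)
next
  case (Suc k)
  obtain D where D: "\<And>x. (f has_derivative D x) (at x)" "\<And>v. (\<lambda>x. D x v) \<in> smooth_functions"
    using smooth_functions_derivative[OF Suc.prems] by blast
  have "frechet_derivative f (at x) = D x" for x
    using frechet_derivative_at[OF D(1)] by simp
  then show ?case using D Suc.IH by (auto simp: differentiable_def)
qed

lemma smooth_functions_bounded:
  fixes f :: "'a::euclidean_space \<Rightarrow> real"
  assumes f: "f \<in> smooth_functions" and R: "\<And>x. norm x > R \<Longrightarrow> f x = 0"
  obtains M where "M \<ge> 0" "\<And>x. \<bar>f x\<bar> \<le> M"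
proof -
  have "compact (f ` cball 0 R)"
    by (intro compact_continuous_image smooth_functions_continuous f) auto
  then obtain M where M: "\<And>x. x \<in> cball 0 R \<Longrightarrow> \<bar>f x\<bar> \<le> M"
    using compact_imp_bounded[of "f ` cball 0 R"] by (force simp: bounded_iff)
  show thesis
  proof
    show "\<bar>f x\<bar> \<le> max M 0" for x
      using M[of x] R[of x] by (cases "norm x \<le> R") auto
  qed simp
qed

lemma derivative_zero_outside_ball:
  fixes f :: "'a::euclidean_space \<Rightarrow> real"
  assumes D: "(f has_derivative D) (at x)" and R: "\<And>x. norm x > R \<Longrightarrow> f x = 0" and x: "norm x > R"
  shows "D = (\<lambda>_. 0)"
proof -
  have op: "open {x :: 'a. norm x > R}"
    by (intro open_Collect_less continuous_intros)
  have "((\<lambda>_. 0) has_derivative (\<lambda>_. 0)) (at x)" by simp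
  then have "(f has_derivative (\<lambda>_. 0)) (at x)"
    by (rule has_derivative_transform_within_open[OF _ op]) (use x R in auto)
  then show ?thesis using D has_derivative_unique by blast
qed

lemma linear_bound_by_basis:
  fixes L :: "'a::euclidean_space \<Rightarrow> real"
  assumes L: "linear L" and M: "\<And>b. b \<in> Basis \<Longrightarrow> \<bar>L b\<bar> \<le> M b"
  shows "\<bar>L v\<bar> \<le> (\<Sum>b\<in>Basis. M b) * norm v"
proof -
  have "L v = (\<Sum>b\<in>Basis. (v \<bullet> b) * L b)"
    using linear_sum[OF L, of "\<lambda>b. (v \<bullet> b) *\<^sub>R b" Basis]
    by (simp add: euclidean_representation linear_scale[OF L])
  also have "\<bar>\<dots>\<bar> \<le> (\<Sum>b\<in>Basis. \<bar>(v \<bullet> b) * L b\<bar>)" by (rule sum_abs)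
  also have "\<dots> \<le> (\<Sum>b\<in>Basis. norm v * M b)"
    by (intro sum_mono) (auto simp: abs_mult intro!: mult_mono M Basis_le_norm)
  finally show ?thesis by (simp add: sum_distrib_left mult.commute)
qed

lemma smooth_functions_lipschitz:
  fixes f :: "'a::euclidean_space \<Rightarrow> real"
  assumes f: "f \<in> smooth_functions" and R: "\<And>x. norm x > R \<Longrightarrow> f x = 0"
  obtains L where "L \<ge> 0" "\<And>x y. \<bar>f x - f y\<bar> \<le> L * norm (x - y)"
proof -
  obtain D where D: "\<And>x. (f has_derivative D x) (at x)" "\<And>v. (\<lambda>x. D x v) \<in> smooth_functions"
    using smooth_functions_derivative[OF f] by blast
  have "\<exists>M. M \<ge> 0 \<and> (\<forall>x. \<bar>D x b\<bar> \<le> M)" for b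
    using smooth_functions_bounded[OF D(2), of R] derivative_zero_outside_ball[OF D(1) R]
    by metis
  then obtain M where M: "\<And>b. M b \<ge> 0" "\<And>b x. \<bar>D x b\<bar> \<le> M b" by metis
  show thesis
  proof
    show "(\<Sum>b\<in>(Basis :: 'a set). M b) \<ge> 0" by (intro sum_nonneg M)
    show "\<bar>f x - f y\<bar> \<le> (\<Sum>b\<in>(Basis :: 'a set). M b) * norm (x - y)" for x y
    proof -
      have "onorm (D z) \<le> (\<Sum>b\<in>(Basis :: 'a set). M b)" for z
        using linear_bound_by_basis[OF has_derivative_linear[OF D(1)] M(2)]
        by (intro onorm_le) auto
      then have "norm (f x - f y) \<le> (\<Sum>b\<in>(Basis :: 'a set). M b) * norm (x - y)"
        by (intro differentiable_bound[of UNIV f D]) (auto intro: D(1))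
      then show ?thesis by simp
    qed
  qed
qed

text \<open>
  The components of the gradient are again smooth and vanish far out, hence are Lipschitz.
\<close>

lemma smooth_functions_taylor:
  fixes f :: "'a::euclidean_space \<Rightarrow> real"
  assumes f: "f \<in> smooth_functions" and R: "\<And>x. norm x > R \<Longrightarrow> f x = 0"
  shows "\<exists>g C. C \<ge> 0 \<and> continuous_on UNIV g \<and> (\<forall>x. (f has_derivative (\<lambda>h. g x \<bullet> h)) (at x)) \<and>
    (\<forall>x. norm x > R \<longrightarrow> g x = 0) \<and> (\<forall>x y. \<bar>f y - f x - g x \<bullet> (y - x)\<bar> \<le> C * (norm (y - x))\<^sup>2)"
proof -
  obtain D where D: "\<And>x. (f has_derivative D x) (at x)" "\<And>v. (\<lambda>x. D x v) \<in> smooth_functions"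
    using smooth_functions_derivative[OF f] by blast
  have D0: "D x = (\<lambda>_. 0)" if "norm x > R" for x
    using derivative_zero_outside_ball[OF D(1) R that] .
  have "\<exists>L. L \<ge> 0 \<and> (\<forall>x y. \<bar>D x b - D y b\<bar> \<le> L * norm (x - y))" for b
    using smooth_functions_lipschitz[OF D(2), of R] D0 by metis
  then obtain L where L: "\<And>b. L b \<ge> 0" "\<And>b x y. \<bar>D x b - D y b\<bar> \<le> L b * norm (x - y)" by metis
  define g where "g x = (\<Sum>b\<in>Basis. D x b *\<^sub>R b)" for x
  have g: "g x \<bullet> h = D x h" for x h
  proof -
    have lin: "linear (D x)" by (rule has_derivative_linear[OF D(1)])
    have "D x h = (\<Sum>b\<in>Basis. (h \<bullet> b) * D x b)"
      using linear_sum[OF lin, of "\<lambda>b. (h \<bullet> b) *\<^sub>R b" Basis]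
      by (simp add: euclidean_representation linear_scale[OF lin])
    also have "\<dots> = g x \<bullet> h"
      by (simp add: g_def inner_sum_left inner_commute[of h] mult.commute)
    finally show ?thesis by simp
  qed
  let ?C = "\<Sum>b\<in>(Basis :: 'a set). L b"
  have C0: "?C \<ge> 0" by (intro sum_nonneg L)
  show ?thesis
  proof (intro exI[of _ g] exI[of _ ?C] conjI allI impI)
    show "?C \<ge> 0" by (rule C0)
    show "continuous_on UNIV g"
      unfolding g_def by (intro continuous_intros smooth_functions_continuous D(2))
    show "(f has_derivative (\<lambda>h. g x \<bullet> h)) (at x)" for x
      using D(1)[of x] by (simp add: g)
    show "g x = 0" if "norm x > R" for x
      using D0[OF that] by (simp add: g_def)
    show "\<bar>f y - f x - g x \<bullet> (y - x)\<bar> \<le> ?C * (norm (y - x))\<^sup>2" for x y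
    proof -
      have "norm (f y - f x - D x (y - x)) \<le> norm (y - x) * (?C * norm (y - x))"
      proof (rule differentiable_bound_linearization[where S = "closed_segment x y"])
        show "x + t *\<^sub>R (y - x) \<in> closed_segment x y" if "t \<in> {0..1}" for t
          unfolding in_segment using that by (intro exI[of _ t]) (auto simp: algebra_simps)
        show "(f has_derivative D z) (at z within closed_segment x y)" for z
          by (rule has_derivative_at_withinI[OF D(1)])
        show "onorm (D z - D x) \<le> ?C * norm (y - x)" if z: "z \<in> closed_segment x y" for z
        proof (rule onorm_le)
          fix v
          have lin: "linear (D z - D x)"
            using linear_compose_sub[OF has_derivative_linear[OF D(1)] has_derivative_linear[OF D(1)]]
            by (simp add: fun_diff_def)
          have "\<bar>(D z - D x) v\<bar> \<le> (\<Sum>b\<in>(Basis :: 'a set). L b * norm (z - x)) * norm v"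
            using L(2) by (intro linear_bound_by_basis[OF lin]) auto
          also have "\<dots> = ?C * norm (z - x) * norm v" by (simp add: sum_distrib_right)
          also have "\<dots> \<le> ?C * norm (y - x) * norm v"
            using C0 z segment_bound(1)[OF z] by (intro mult_right_mono mult_left_mono) auto
          finally show "norm ((D z - D x) v) \<le> ?C * norm (y - x) * norm v" by simp
        qed
      qed auto
      then show ?thesis by (simp add: g power2_eq_square mult.commute mult.left_commute)
    qed
  qed
qed

definition mollifier :: "real \<Rightarrow> ('a::euclidean_space \<Rightarrow> real) \<Rightarrow> bool" where
  "mollifier e \<eta> \<longleftrightarrow> \<eta> \<in> borel_measurable borel \<and> (\<forall>x. \<eta> x \<ge> 0) \<and> (\<forall>x. norm x \<ge> e \<longrightarrow> \<eta> x = 0)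
     \<and> (\<exists>M. \<forall>x. \<eta> x \<le> M) \<and> integrable lborel \<eta> \<and> (\<integral>x. \<eta> x \<partial>lborel) = 1"

text \<open>
  The bump \<open>flat 0 (e\<^sup>2 - |x|\<^sup>2)\<close>, normalised. It is even, so \<open>y \<mapsto> \<eta> (x - y)\<close> is a bump of the
  same kind centred at \<open>x\<close>.
\<close>

lemma smooth_mollifier_exists:
  fixes e :: real
  assumes e: "e > 0"
  shows "\<exists>(\<eta> :: 'a::euclidean_space \<Rightarrow> real) M C g. mollifier e \<eta> \<and> (\<forall>x. \<eta> x \<le> M) \<and>
    C \<ge> 0 \<and> g \<in> borel_measurable borel \<and> (\<forall>x. norm (g x) \<le> M) \<and> (\<forall>x. norm x > e \<longrightarrow> g x = 0) \<and>
    (\<forall>x y. \<bar>\<eta> y - \<eta> x - g x \<bullet> (y - x)\<bar> \<le> C * (norm (y - x))\<^sup>2) \<and>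
    (\<forall>x y v. frechet_derivative (\<lambda>y. \<eta> (x - y)) (at y) v = - (g (x - y) \<bullet> v)) \<and>
    (\<forall>x D. cball x e \<subseteq> D \<longrightarrow> (\<lambda>y. \<eta> (x - y)) \<in> test_functions D)"
proof -
  define \<eta>0 :: "'a \<Rightarrow> real" where "\<eta>0 x = flat 0 (e\<^sup>2 - (norm (x - 0))\<^sup>2)" for x
  have sm0: "\<eta>0 \<in> smooth_functions" unfolding \<eta>0_def by (rule smooth_functions.flat)
  have out: "\<eta>0 x = 0" if "norm x \<ge> e" for x
    using that e by (simp add: \<eta>0_def flat_def not_less power_mono)
  have out': "\<eta>0 x = 0" if "norm x > e" for x using out that by simp
  have ins: "\<eta>0 x > 0" if "norm x < e" for x
    using that e by (simp add: \<eta>0_def flat_def power_strict_mono)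
  have cont: "continuous_on UNIV \<eta>0" by (rule smooth_functions_continuous[OF sm0])
  have [measurable]: "\<eta>0 \<in> borel_measurable borel" by (rule borel_measurable_continuous_onI[OF cont])
  obtain M0 where M0: "M0 \<ge> 0" "\<And>x. \<bar>\<eta>0 x\<bar> \<le> M0" using smooth_functions_bounded[OF sm0 out'] by blast
  have int: "integrable lborel \<eta>0"
  proof (rule Bochner_Integration.integrable_bound)
    show "integrable lborel (\<lambda>x::'a. M0 * indicator (cball 0 e) x)"
      by (intro integrable_mult_right integrable_real_indicator) (use emeasure_compact_finite[OF compact_cball, of 0 e] in auto)
    show "AE x in lborel. norm (\<eta>0 x) \<le> norm (M0 * indicator (cball 0 e) x)"
      using M0 out by (intro AE_I2) (auto simp: indicator_def)
  qed simp
  define I where "I = (\<integral>x. \<eta>0 x \<partial>lborel)"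
  have I: "I > 0"
  proof -
    have nn: "AE x in lborel. 0 \<le> \<eta>0 x" by (simp add: \<eta>0_def flat_nonneg)
    have "I \<noteq> 0"
    proof
      assume "I = 0"
      then have "AE x in lborel. \<eta>0 x = 0"
        using integral_nonneg_eq_0_iff_AE[OF int nn] by (simp add: I_def)
      then have "AE x in lborel. x \<notin> ball (0::'a) e" by eventually_elim (use ins in \<open>force\<close>)
      then have "emeasure lborel (ball (0::'a) e) = 0"
        by (subst (asm) AE_iff_null_sets[symmetric]) (auto simp: null_sets_def)
      then show False using content_ball_pos[OF e, of "0::'a"] by (simp add: measure_def)
    qed
    moreover have "I \<ge> 0" unfolding I_def by (rule integral_nonneg_AE[OF nn])
    ultimately show ?thesis by simp
  qed
  define \<eta> where "\<eta> x = (1 / I) * \<eta>0 x" for x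
  have sm: "\<eta> \<in> smooth_functions" unfolding \<eta>_def by (intro smooth_functions.mult smooth_functions.const sm0)
  have o: "\<eta> x = 0" if "norm x > e" for x using out'[OF that] by (simp add: \<eta>_def)
  obtain g C where T: "C \<ge> 0 \<and> continuous_on UNIV g \<and> (\<forall>x. (\<eta> has_derivative (\<lambda>h. g x \<bullet> h)) (at x)) \<and>
    (\<forall>x. norm x > e \<longrightarrow> g x = 0) \<and> (\<forall>x y. \<bar>\<eta> y - \<eta> x - g x \<bullet> (y - x)\<bar> \<le> C * (norm (y - x))\<^sup>2)"
    using smooth_functions_taylor[of \<eta> e] sm o by blast
  have C: "C \<ge> 0" and g: "continuous_on UNIV g" "\<And>x. (\<eta> has_derivative (\<lambda>h. g x \<bullet> h)) (at x)"
    "\<And>x. norm x > e \<Longrightarrow> g x = 0" "\<And>x y. \<bar>\<eta> y - \<eta> x - g x \<bullet> (y - x)\<bar> \<le> C * (norm (y - x))\<^sup>2"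
    using T by simp_all
  have "compact (g ` cball 0 e)" by (intro compact_continuous_image continuous_on_subset[OF g(1)]) auto
  then obtain M1 where M1: "\<And>x. x \<in> cball 0 e \<Longrightarrow> norm (g x) \<le> M1"
    using compact_imp_bounded[of "g ` cball 0 e"] by (force simp: bounded_iff)
  have M1': "norm (g x) \<le> max M1 0" for x
    using M1[of x] g(3)[of x] by (cases "norm x \<le> e") auto
  have ub: "\<eta> x \<le> M0 / I" for x
  proof -
    have "\<eta>0 x \<le> M0" using M0(2)[of x] by linarith
    then have "\<eta>0 x / I \<le> M0 / I" using I by (intro divide_right_mono) auto
    then show ?thesis by (simp add: \<eta>_def)
  qed
  show ?thesis
  proof (rule exI[of _ \<eta>], rule exI[of _ "max (M0 / I) (max M1 0)"], rule exI[of _ C], rule exI[of _ g], intro conjI allI impI)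
    show "mollifier e \<eta>"
      unfolding mollifier_def
    proof (intro conjI allI impI)
      show "\<eta> \<in> borel_measurable borel" unfolding \<eta>_def by measurable
      show "0 \<le> \<eta> x" for x using I by (simp add: \<eta>_def \<eta>0_def flat_nonneg)
      show "\<eta> x = 0" if "norm x \<ge> e" for x using out[OF that] by (simp add: \<eta>_def)
      show "\<exists>M. \<forall>x. \<eta> x \<le> M"
        using ub by blast
      show "integrable lborel \<eta>" using int unfolding \<eta>_def by simp
      show "(\<integral>x. \<eta> x \<partial>lborel) = 1" using I unfolding \<eta>_def by (simp add: I_def)
    qed
    show "\<eta> x \<le> max (M0 / I) (max M1 0)" for x using ub[of x] by simp
    show "norm (g x) \<le> max (M0 / I) (max M1 0)" for x using M1'[of x] by simp
    show "C \<ge> 0" by fact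
    show "g x = 0" if "norm x > e" for x using g(3)[OF that] .
    show "g \<in> borel_measurable borel" by (rule borel_measurable_continuous_onI[OF g(1)])
    show "\<bar>\<eta> y - \<eta> x - g x \<bullet> (y - x)\<bar> \<le> C * (norm (y - x))\<^sup>2" for x y by (rule g(4))
    show "frechet_derivative (\<lambda>y. \<eta> (x - y)) (at y) v = - (g (x - y) \<bullet> v)" for x y v
    proof -
      have "((\<lambda>y. x - y) has_derivative (\<lambda>h. - h)) (at y)" by (auto intro!: derivative_eq_intros)
      from has_derivative_compose[OF this g(2)]
      have "((\<lambda>y. \<eta> (x - y)) has_derivative (\<lambda>h. g (x - y) \<bullet> - h)) (at y)" .
      from frechet_derivative_at[OF this] show ?thesis by (metis inner_minus_right)
    qed
    show "(\<lambda>y. \<eta> (x - y)) \<in> test_functions D" if sub: "cball x e \<subseteq> D" for x D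
    proof -
      have "(\<lambda>y. \<eta> (x - y)) = (\<lambda>y. (1 / I) * flat 0 (e\<^sup>2 - (norm (y - x))\<^sup>2))"
        by (simp add: \<eta>_def \<eta>0_def norm_minus_commute)
      also have "\<dots> \<in> smooth_functions" by (intro smooth_functions.intros)
      finally have "\<forall>k. C_k k (\<lambda>y. \<eta> (x - y))" using smooth_functions_C_k by blast
      moreover have cl: "closure {y. \<eta> (x - y) \<noteq> 0} \<subseteq> cball x e"
      proof (rule closure_minimal)
        show "{y. \<eta> (x - y) \<noteq> 0} \<subseteq> cball x e"
          using o by (auto simp: dist_norm) (meson not_le)
      qed simp
      moreover have "compact (closure {y. \<eta> (x - y) \<noteq> 0})"
        using bounded_subset[OF bounded_cball cl] by (simp add: compact_eq_bounded_closed)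
      ultimately show ?thesis using sub unfolding test_functions_def by auto
    qed
  qed
qed

section \<open>Mollification of integrable functions\<close>

lemma
  fixes h :: "'a::euclidean_space \<Rightarrow> ennreal" and k :: "'a \<Rightarrow> real"
  shows nn_integral_lborel_reflect: "h \<in> borel_measurable borel \<Longrightarrow> (\<integral>\<^sup>+y. h (x - y) \<partial>lborel) = (\<integral>\<^sup>+y. h y \<partial>lborel)"
    and integral_lborel_reflect: "k \<in> borel_measurable borel \<Longrightarrow> (\<integral>y. k (x - y) \<partial>lborel) = (\<integral>y. k y \<partial>lborel)"
    and integrable_lborel_reflect: "k \<in> borel_measurable borel \<Longrightarrow> integrable lborel (\<lambda>y. k (x - y)) \<longleftrightarrow> integrable lborel k"
proof -
  have "lborel = density (distr lborel borel (\<lambda>y. x + (-1) *\<^sub>R y)) (\<lambda>_. ennreal (\<bar>-1\<bar> ^ DIM('a)))"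
    by (rule lborel_affine) simp
  then have eq: "lborel = distr lborel borel (\<lambda>y. x - y)"
    by (simp add: density_1)
  show "(\<integral>\<^sup>+y. h (x - y) \<partial>lborel) = (\<integral>\<^sup>+y. h y \<partial>lborel)" if "h \<in> borel_measurable borel"
    using that by (subst (2) eq) (simp add: nn_integral_distr)
  show "(\<integral>y. k (x - y) \<partial>lborel) = (\<integral>y. k y \<partial>lborel)" if "k \<in> borel_measurable borel"
    using that by (subst (2) eq) (simp add: integral_distr)
  show "integrable lborel (\<lambda>y. k (x - y)) \<longleftrightarrow> integrable lborel k" if "k \<in> borel_measurable borel"
    using that by (subst (2) eq) (simp add: integrable_distr_eq)
qed

lemma nn_integral_lborel_translate:
  fixes h :: "'a::euclidean_space \<Rightarrow> ennreal"
  assumes [measurable]: "h \<in> borel_measurable borel"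
  shows "(\<integral>\<^sup>+y. h (y - x) \<partial>lborel) = (\<integral>\<^sup>+y. h y \<partial>lborel)"
proof -
  have "(\<integral>\<^sup>+y. h (y - x) \<partial>lborel) = (\<integral>\<^sup>+y. h (- (x - y)) \<partial>lborel)" by simp
  also have "\<dots> = (\<integral>\<^sup>+y. h (- y) \<partial>lborel)"
    by (intro nn_integral_lborel_reflect[of "\<lambda>y. h (- y)"]) measurable
  also have "\<dots> = (\<integral>\<^sup>+y. h (0 - y) \<partial>lborel)" by simp
  also have "\<dots> = (\<integral>\<^sup>+y. h y \<partial>lborel)" using assms by (rule nn_integral_lborel_reflect)
  finally show ?thesis .
qed

lemma integrable_approx_truncation:
  fixes f :: "'a::euclidean_space \<Rightarrow> real"
  assumes f: "integrable lborel f" and d: "d > 0"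
  obtains n :: nat where
    "(\<integral>x. \<bar>f x - indicator (cball 0 (real n)) x * max (- real n) (min (real n) (f x))\<bar> \<partial>lborel) < d"
proof -
  have [measurable]: "f \<in> borel_measurable borel" using f by simp
  have [measurable]: "cball (0::'a) r \<in> sets borel" for r by simp
  let ?h = "\<lambda>n x. indicator (cball 0 (real n)) x * max (- real n) (min (real n) (f x))"
  have "(\<lambda>n. \<integral>x. \<bar>f x - ?h n x\<bar> \<partial>lborel) \<longlonglongrightarrow> (\<integral>x. 0 \<partial>(lborel :: 'a measure))"
  proof (rule integral_dominated_convergence[where w = "\<lambda>x. \<bar>f x\<bar>"])
    show "AE x in lborel. (\<lambda>n. \<bar>f x - ?h n x\<bar>) \<longlonglongrightarrow> 0"
    proof (rule AE_I2)
      fix x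
      obtain N where N: "\<bar>f x\<bar> + norm x \<le> real N" using real_arch_simple by blast
      have "eventually (\<lambda>n. \<bar>f x - ?h n x\<bar> = 0) sequentially"
        using eventually_ge_at_top[of N]
      proof eventually_elim
        case (elim n)
        then have "\<bar>f x\<bar> + norm x \<le> real n" using N by linarith
        then have "norm x \<le> real n" "- real n \<le> f x" "f x \<le> real n" using norm_ge_zero[of x] by linarith+
        then show ?case by simp
      qed
      then show "(\<lambda>n. \<bar>f x - ?h n x\<bar>) \<longlonglongrightarrow> 0" by (rule tendsto_eventually)
    qed
    show "AE x in lborel. norm \<bar>f x - ?h n x\<bar> \<le> \<bar>f x\<bar>" for n
      by (intro AE_I2) (auto simp: indicator_def max_def min_def)
  qed (use f in auto)
  then have "eventually (\<lambda>n. (\<integral>x. \<bar>f x - ?h n x\<bar> \<partial>lborel) < d) sequentially"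
    using d by (intro order_tendstoD) auto
  then show thesis using that eventually_happens'[OF sequentially_bot] by blast
qed

text \<open>
  A bounded measurable function is almost everywhere a limit of continuous functions. These
  are clipped to the same bound and cut off outside the support, so that dominated convergence
  applies.
\<close>

lemma integrable_approx_continuous_of_bounded:
  fixes h :: "'a::euclidean_space \<Rightarrow> real"
  assumes [measurable]: "h \<in> borel_measurable borel" and b: "\<And>x. \<bar>h x\<bar> \<le> b"
    and R: "\<And>x. norm x > R \<Longrightarrow> h x = 0" and d: "d > 0"
  obtains c where "continuous_on UNIV c" "\<And>x. norm x > R + 1 \<Longrightarrow> c x = 0"
    "(\<integral>x. \<bar>h x - c x\<bar> \<partial>lborel) < d" "integrable lborel c"
proof -
  have b0: "b \<ge> 0" using b[of 0] by linarith
  have "h measurable_on UNIV"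
    by (rule lebesgue_measurable_imp_measurable_on_real) (auto intro: measurable_completion)
  then obtain N g where N: "negligible N" and g: "\<And>n. continuous_on UNIV (g n)"
    "\<And>x. x \<notin> N \<Longrightarrow> (\<lambda>n. g n x) \<longlonglongrightarrow> h x"
    unfolding measurable_on_def by auto
  have AEN: "AE x in lborel. x \<notin> N"
  proof -
    have "AE x in lebesgue. x \<notin> N"
      using N by (intro AE_not_in) (simp add: negligible_iff_null_sets)
    then show ?thesis by (simp add: AE_completion_iff)
  qed
  \<comment> \<open>equals \<open>1\<close> on the ball of radius \<open>R\<close> and \<open>0\<close> outside the ball of radius \<open>R + 1\<close>\<close>
  define cut where "cut x = max 0 (min 1 (R + 1 - norm x))" for x :: 'a
  define c where "c n x = cut x * max (- b) (min b (g n x))" for n x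
  have cont: "continuous_on UNIV (c n)" for n
    unfolding c_def cut_def by (intro continuous_intros g)
  have [measurable]: "c n \<in> borel_measurable borel" for n
    by (rule borel_measurable_continuous_onI[OF cont])
  have cut: "0 \<le> cut x" "cut x \<le> 1" "norm x > R + 1 \<Longrightarrow> cut x = 0" "norm x \<le> R \<Longrightarrow> cut x = 1" for x
    by (auto simp: cut_def)
  have cb: "\<bar>c n x\<bar> \<le> b * indicator (cball 0 (R + 1)) x" for n x
  proof -
    have "\<bar>max (- b) (min b (g n x))\<bar> \<le> b" using b0 by (auto simp: abs_le_iff)
    then have "\<bar>c n x\<bar> \<le> cut x * b" using cut(1)[of x] by (simp add: c_def abs_mult mult_left_mono)
    also have "\<dots> \<le> b * indicator (cball 0 (R + 1)) x"
      using cut(2,3)[of x] b0 by (auto simp: indicator_def mult_left_le mult.commute)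
    finally show ?thesis .
  qed
  have iw: "integrable lborel (\<lambda>x::'a. c * indicator (cball 0 (R + 1)) x)" for c :: real
    using emeasure_compact_finite[OF compact_cball, of 0 "R + 1"] by (intro integrable_mult_right integrable_real_indicator) auto
  have hb: "\<bar>h x\<bar> \<le> b * indicator (cball 0 (R + 1)) x" for x
    using b[of x] R[of x] b0 by (auto simp: indicator_def)
  have ic: "integrable lborel (c n)" for n
    by (rule Bochner_Integration.integrable_bound[OF iw[of b]]) (use cb[of n] b0 in \<open>auto intro!: AE_I2 simp: abs_mult\<close>)
  have "(\<lambda>n. \<integral>x. \<bar>h x - c n x\<bar> \<partial>lborel) \<longlonglongrightarrow> (\<integral>x. 0 \<partial>(lborel :: 'a measure))"
  proof (rule integral_dominated_convergence[where w = "\<lambda>x. 2 * b * indicator (cball 0 (R + 1)) x"])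
    show "AE x in lborel. (\<lambda>n. \<bar>h x - c n x\<bar>) \<longlonglongrightarrow> 0"
      using AEN
    proof eventually_elim
      case (elim x)
      have "(\<lambda>n. c n x) \<longlonglongrightarrow> cut x * max (- b) (min b (h x))"
        unfolding c_def by (intro tendsto_intros g elim)
      also have "cut x * max (- b) (min b (h x)) = h x"
        using b[of x] R[of x] cut(4)[of x] b0 by (cases "norm x \<le> R") (auto simp: abs_le_iff)
      finally have "(\<lambda>n. \<bar>h x - c n x\<bar>) \<longlonglongrightarrow> \<bar>h x - h x\<bar>"
        by (rule tendsto_rabs[OF tendsto_diff[OF tendsto_const]])
      then show ?case by simp
    qed
    show "AE x in lborel. norm \<bar>h x - c n x\<bar> \<le> 2 * b * indicator (cball 0 (R + 1)) x" for n
    proof (rule AE_I2)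
      fix x
      show "norm \<bar>h x - c n x\<bar> \<le> 2 * b * indicator (cball 0 (R + 1)) x"
        using hb[of x] cb[of n x] by simp
    qed
  qed (use iw in auto)
  then have "eventually (\<lambda>n. (\<integral>x. \<bar>h x - c n x\<bar> \<partial>lborel) < d) sequentially"
    using d by (intro order_tendstoD) auto
  then obtain n where "(\<integral>x. \<bar>h x - c n x\<bar> \<partial>lborel) < d"
    using eventually_happens'[OF sequentially_bot] by blast
  then show thesis using that[of "c n"] cont ic cut(3) by (simp add: c_def)
qed

lemma integrable_approx_continuous:
  fixes f :: "'a::euclidean_space \<Rightarrow> real"
  assumes f: "integrable lborel f" and d: "d > 0"
  obtains c R where "continuous_on UNIV c" "\<And>x. norm x > R \<Longrightarrow> c x = 0"
    "(\<integral>\<^sup>+x. ennreal \<bar>f x - c x\<bar> \<partial>lborel) \<le> ennreal d"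
proof -
  have [measurable]: "f \<in> borel_measurable borel" using f by simp
  have [measurable]: "cball (0::'a) r \<in> sets borel" for r by simp
  obtain n :: nat where n: "(\<integral>x. \<bar>f x - indicator (cball 0 (real n)) x * max (- real n) (min (real n) (f x))\<bar> \<partial>lborel) < d / 2"
    using integrable_approx_truncation[OF f, of "d / 2"] d by auto
  define h where "h x = indicator (cball 0 (real n)) x * max (- real n) (min (real n) (f x))" for x
  have [measurable]: "h \<in> borel_measurable borel" unfolding h_def by measurable
  have ih: "integrable lborel h"
    by (rule Bochner_Integration.integrable_bound[OF f]) (auto intro!: AE_I2 simp: h_def indicator_def max_def min_def)
  obtain c where c: "continuous_on UNIV c" "\<And>x. norm x > real n + 1 \<Longrightarrow> c x = 0"
    "(\<integral>x. \<bar>h x - c x\<bar> \<partial>lborel) < d / 2" "integrable lborel c"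
  proof (rule integrable_approx_continuous_of_bounded[of h "real n" "real n" "d / 2"])
    show "\<bar>h x\<bar> \<le> real n" for x by (auto simp: h_def indicator_def)
    show "h x = 0" if "norm x > real n" for x using that by (simp add: h_def)
  qed (use d in auto)
  have "(\<integral>x. \<bar>f x - c x\<bar> \<partial>lborel) \<le> (\<integral>x. \<bar>f x - h x\<bar> + \<bar>h x - c x\<bar> \<partial>lborel)"
    using f ih c(4) by (intro integral_mono) auto
  also have "\<dots> = (\<integral>x. \<bar>f x - h x\<bar> \<partial>lborel) + (\<integral>x. \<bar>h x - c x\<bar> \<partial>lborel)"
    using f ih c(4) by (intro Bochner_Integration.integral_add) auto
  also have "\<dots> \<le> d" using n c(3) unfolding h_def by linarith
  finally have "(\<integral>x. \<bar>f x - c x\<bar> \<partial>lborel) \<le> d" .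
  moreover have "(\<integral>\<^sup>+x. ennreal \<bar>f x - c x\<bar> \<partial>lborel) = ennreal (\<integral>x. \<bar>f x - c x\<bar> \<partial>lborel)"
    using f c(4) by (intro nn_integral_eq_integral) auto
  ultimately show thesis using that[OF c(1,2)] by (simp add: ennreal_leI)
qed

text \<open>
  A continuous function of bounded support close to \<open>f\<close> is uniformly continuous, and
  translation preserves the distance to it.
\<close>

lemma L1_translation_continuous:
  fixes f :: "'a::euclidean_space \<Rightarrow> real"
  assumes f: "integrable lborel f" and d: "d > 0"
  obtains e where "e > 0" "\<And>h. norm h < e \<Longrightarrow> (\<integral>\<^sup>+x. ennreal \<bar>f (x - h) - f x\<bar> \<partial>lborel) \<le> ennreal d"
proof -
  have [measurable]: "f \<in> borel_measurable borel" using f by simp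
  obtain c R where c: "continuous_on UNIV c" "\<And>x. norm x > R \<Longrightarrow> c x = 0"
    "(\<integral>\<^sup>+x. ennreal \<bar>f x - c x\<bar> \<partial>lborel) \<le> ennreal (d / 3)"
    using integrable_approx_continuous[OF f, of "d / 3"] d by auto
  have [measurable]: "c \<in> borel_measurable borel" by (rule borel_measurable_continuous_onI[OF c(1)])
  define B where "B = cball (0::'a) (R + 1)"
  have [measurable]: "B \<in> sets borel" by (simp add: B_def)
  define m where "m = measure lborel B"
  have mB: "emeasure lborel B = ennreal m"
    using emeasure_compact_finite[of B] unfolding m_def B_def by (intro emeasure_eq_ennreal_measure) auto
  have m0: "m \<ge> 0" by (simp add: m_def)
  have "uniformly_continuous_on (cball 0 (R + 2)) c"
    by (rule compact_uniformly_continuous) (auto intro: continuous_on_subset[OF c(1)])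
  moreover have w: "d / 3 / (m + 1) > 0" using d m0 by simp
  ultimately obtain e where e: "e > 0" "\<And>x y. x \<in> cball 0 (R + 2) \<Longrightarrow> y \<in> cball 0 (R + 2) \<Longrightarrow> dist y x < e \<Longrightarrow> dist (c y) (c x) < d / 3 / (m + 1)"
    unfolding uniformly_continuous_on_def by metis
  show thesis
  proof
    show "min e 1 > 0" using e by simp
    fix h :: 'a assume h: "norm h < min e 1"
    have pt: "\<bar>c (x - h) - c x\<bar> \<le> d / 3 / (m + 1) * indicator B x" for x
    proof (cases "x \<in> B")
      case True
      then have "norm (x - h) \<le> R + 2" using h norm_triangle_ineq4[of x h] by (simp add: B_def)
      then have "dist (c (x - h)) (c x) < d / 3 / (m + 1)"
        using True h by (intro e(2)) (auto simp: B_def dist_norm norm_minus_commute)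
      then show ?thesis using True by (simp add: dist_real_def)
    next
      case False
      then have x: "norm x > R + 1" by (simp add: B_def)
      moreover have "norm (x - h) > R" using x h norm_triangle_ineq2[of x h] by simp
      ultimately show ?thesis using c(2) False by simp
    qed
    have "(\<integral>\<^sup>+x. ennreal \<bar>f (x - h) - f x\<bar> \<partial>lborel)
      \<le> (\<integral>\<^sup>+x. (ennreal \<bar>f (x - h) - c (x - h)\<bar> + ennreal \<bar>f x - c x\<bar>) + ennreal (d / 3 / (m + 1)) * indicator B x \<partial>lborel)"
    proof (rule nn_integral_mono)
      fix x
      have "\<bar>f (x - h) - f x\<bar> \<le> \<bar>f (x - h) - c (x - h)\<bar> + \<bar>f x - c x\<bar> + d / 3 / (m + 1) * indicator B x"
        using pt[of x] by linarith
      then have "ennreal \<bar>f (x - h) - f x\<bar> \<le> ennreal (\<bar>f (x - h) - c (x - h)\<bar> + \<bar>f x - c x\<bar> + d / 3 / (m + 1) * indicator B x)"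
        by (rule ennreal_leI)
      also have "\<dots> = ennreal \<bar>f (x - h) - c (x - h)\<bar> + ennreal \<bar>f x - c x\<bar> + ennreal (d / 3 / (m + 1)) * indicator B x"
        using w by (auto simp: indicator_def ennreal_plus[symmetric] simp del: ennreal_plus)
      finally show "ennreal \<bar>f (x - h) - f x\<bar> \<le> ennreal \<bar>f (x - h) - c (x - h)\<bar> + ennreal \<bar>f x - c x\<bar> + ennreal (d / 3 / (m + 1)) * indicator B x" .
    qed
    also have "\<dots> = (\<integral>\<^sup>+x. ennreal \<bar>f (x - h) - c (x - h)\<bar> \<partial>lborel) + (\<integral>\<^sup>+x. ennreal \<bar>f x - c x\<bar> \<partial>lborel)
        + ennreal (d / 3 / (m + 1)) * emeasure lborel B"
      by (simp add: nn_integral_add nn_integral_cmult_indicator)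
    also have "(\<integral>\<^sup>+x. ennreal \<bar>f (x - h) - c (x - h)\<bar> \<partial>lborel) = (\<integral>\<^sup>+x. ennreal \<bar>f x - c x\<bar> \<partial>lborel)"
      by (rule nn_integral_lborel_translate[of "\<lambda>x. ennreal \<bar>f x - c x\<bar>"]) measurable
    also have "(\<integral>\<^sup>+x. ennreal \<bar>f x - c x\<bar> \<partial>lborel) + (\<integral>\<^sup>+x. ennreal \<bar>f x - c x\<bar> \<partial>lborel) + ennreal (d / 3 / (m + 1)) * emeasure lborel B
       \<le> ennreal (d / 3) + ennreal (d / 3) + ennreal (d / 3)"
    proof (intro add_mono c(3))
      have "d / 3 / (m + 1) * m \<le> d / 3" using d m0 by (simp add: field_simps)
      then show "ennreal (d / 3 / (m + 1)) * emeasure lborel B \<le> ennreal (d / 3)"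
        using w m0 by (simp only: mB ennreal_mult[symmetric] less_imp_le ennreal_leI)
    qed
    also have "\<dots> = ennreal d" using d by (simp add: ennreal_plus[symmetric] del: ennreal_plus)
    finally show "(\<integral>\<^sup>+x. ennreal \<bar>f (x - h) - f x\<bar> \<partial>lborel) \<le> ennreal d" .
  qed
qed

definition mollify :: "('a::euclidean_space \<Rightarrow> real) \<Rightarrow> ('a \<Rightarrow> 'b::euclidean_space) \<Rightarrow> 'a \<Rightarrow> 'b" where
  "mollify \<eta> f x = (\<integral>y. \<eta> (x - y) *\<^sub>R f y \<partial>lborel)"

lemma borel_measurable_mollify:
  assumes [measurable]: "\<eta> \<in> borel_measurable borel" "f \<in> borel_measurable borel"
  shows "mollify \<eta> f \<in> borel_measurable borel"
  unfolding mollify_def by measurable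

lemma integrable_bounded_reflect_mult:
  fixes f :: "'a::euclidean_space \<Rightarrow> 'b::euclidean_space"
  assumes [measurable]: "\<eta> \<in> borel_measurable borel" and M: "\<And>x. \<bar>\<eta> x\<bar> \<le> M" and f: "integrable lborel f"
  shows "integrable lborel (\<lambda>y. \<eta> (x - y) *\<^sub>R f y)"
proof (rule Bochner_Integration.integrable_bound)
  show "integrable lborel (\<lambda>y. M * norm (f y))" using f by auto
  have [measurable]: "f \<in> borel_measurable borel" using f by simp
  show "(\<lambda>y. \<eta> (x - y) *\<^sub>R f y) \<in> borel_measurable lborel" by measurable
  have M0: "M \<ge> 0" using M[of 0] by linarith
  show "AE y in lborel. norm (\<eta> (x - y) *\<^sub>R f y) \<le> norm (M * norm (f y))"
    using M M0 by (intro AE_I2) (simp add: abs_mult mult_right_mono)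
qed

lemma mollifier_reflect:
  assumes "mollifier e (\<eta> :: 'a::euclidean_space \<Rightarrow> real)"
  shows "integrable lborel (\<lambda>y. \<eta> (x - y))" "(\<integral>y. \<eta> (x - y) \<partial>lborel) = 1"
    "(\<integral>\<^sup>+y. ennreal (\<eta> (x - y)) \<partial>lborel) = 1"  "(\<integral>\<^sup>+y. ennreal (\<eta> (y - x)) \<partial>lborel) = 1"
    "(\<integral>\<^sup>+y. ennreal (\<eta> y) \<partial>lborel) = 1"
proof -
  have m[measurable]: "\<eta> \<in> borel_measurable borel" and i: "integrable lborel \<eta>" "(\<integral>x. \<eta> x \<partial>lborel) = 1" "\<And>x. \<eta> x \<ge> 0"
    using assms by (auto simp: mollifier_def)
  show "integrable lborel (\<lambda>y. \<eta> (x - y))" "(\<integral>y. \<eta> (x - y) \<partial>lborel) = 1"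
    using i by (simp_all add: integrable_lborel_reflect integral_lborel_reflect)
  show 1: "(\<integral>\<^sup>+y. ennreal (\<eta> y) \<partial>lborel) = 1"
    using i by (subst nn_integral_eq_integral) auto
  then show "(\<integral>\<^sup>+y. ennreal (\<eta> (x - y)) \<partial>lborel) = 1"
    by (subst nn_integral_lborel_reflect) auto
  show "(\<integral>\<^sup>+y. ennreal (\<eta> (y - x)) \<partial>lborel) = 1"
    using 1 by (subst nn_integral_lborel_translate[of "\<lambda>y. ennreal (\<eta> y)"]) auto
qed

text \<open>
  The mollification is the average of the translates of \<open>f\<close> by vectors shorter than \<open>e\<close>, all
  of which are close to \<open>f\<close>.
\<close>

lemma mollify_L1_convergence:
  fixes f :: "'a::euclidean_space \<Rightarrow> real"
  assumes f: "integrable lborel f" and d: "d > 0"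
  obtains e0 where "e0 > 0"
    "\<And>e \<eta>. e \<le> e0 \<Longrightarrow> mollifier e \<eta> \<Longrightarrow> (\<integral>\<^sup>+x. ennreal \<bar>mollify \<eta> f x - f x\<bar> \<partial>lborel) \<le> ennreal d"
proof -
  have [measurable]: "f \<in> borel_measurable borel" using f by simp
  obtain e0 where e0: "e0 > 0" "\<And>h. norm h < e0 \<Longrightarrow> (\<integral>\<^sup>+x. ennreal \<bar>f (x - h) - f x\<bar> \<partial>lborel) \<le> ennreal d"
    using L1_translation_continuous[OF f d] by blast
  show thesis
  proof (rule that[OF e0(1)])
    fix e and \<eta> :: "'a \<Rightarrow> real" assume e: "e \<le> e0" and moll: "mollifier e \<eta>"
    then have [measurable]: "\<eta> \<in> borel_measurable borel" and pos: "\<And>x. \<eta> x \<ge> 0" and zero: "\<And>x. norm x \<ge> e \<Longrightarrow> \<eta> x = 0"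
      by (auto simp: mollifier_def)
    obtain M where M: "\<And>x. \<eta> x \<le> M" using moll by (auto simp: mollifier_def)
    have i: "integrable lborel (\<lambda>y. \<eta> (x - y) *\<^sub>R f y)" for x
      by (rule integrable_bounded_reflect_mult[of \<eta> M]) (use pos M f in auto)
    have "(\<integral>\<^sup>+x. ennreal \<bar>mollify \<eta> f x - f x\<bar> \<partial>lborel) \<le> (\<integral>\<^sup>+x. \<integral>\<^sup>+h. ennreal (\<eta> h) * ennreal \<bar>f (x - h) - f x\<bar> \<partial>lborel \<partial>lborel)"
    proof (rule nn_integral_mono)
      fix x
      have i2: "integrable lborel (\<lambda>y. \<eta> (x - y) * f x)" using mollifier_reflect(1)[OF moll] by simp
      have "mollify \<eta> f x - f x = (\<integral>y. \<eta> (x - y) * f y - \<eta> (x - y) * f x \<partial>lborel)"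
        using i i2 mollifier_reflect(1,2)[OF moll, of x] by (simp add: mollify_def)
      then have "ennreal \<bar>mollify \<eta> f x - f x\<bar> \<le> (\<integral>\<^sup>+y. ennreal (norm (\<eta> (x - y) * f y - \<eta> (x - y) * f x)) \<partial>lborel)"
        using i i2 integral_norm_bound_ennreal[of lborel "\<lambda>y. \<eta> (x - y) * f y - \<eta> (x - y) * f x"] by simp
      also have "\<dots> = (\<integral>\<^sup>+y. ennreal (\<eta> (x - y)) * ennreal \<bar>f (x - (x - y)) - f x\<bar> \<partial>lborel)"
      proof (rule nn_integral_cong)
        fix y
        have "norm (\<eta> (x - y) * f y - \<eta> (x - y) * f x) = \<eta> (x - y) * \<bar>f y - f x\<bar>"
          using pos[of "x - y"] by (simp add: right_diff_distrib[symmetric] abs_mult)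
        then show "ennreal (norm (\<eta> (x - y) * f y - \<eta> (x - y) * f x)) = ennreal (\<eta> (x - y)) * ennreal \<bar>f (x - (x - y)) - f x\<bar>"
          using pos by (simp add: ennreal_mult)
      qed
      also have "\<dots> = (\<integral>\<^sup>+h. ennreal (\<eta> h) * ennreal \<bar>f (x - h) - f x\<bar> \<partial>lborel)"
        by (rule nn_integral_lborel_reflect[of "\<lambda>h. ennreal (\<eta> h) * ennreal \<bar>f (x - h) - f x\<bar>"]) measurable
      finally show "ennreal \<bar>mollify \<eta> f x - f x\<bar> \<le> (\<integral>\<^sup>+h. ennreal (\<eta> h) * ennreal \<bar>f (x - h) - f x\<bar> \<partial>lborel)" .
    qed
    also have "\<dots> = (\<integral>\<^sup>+h. \<integral>\<^sup>+x. ennreal (\<eta> h) * ennreal \<bar>f (x - h) - f x\<bar> \<partial>lborel \<partial>lborel)"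
      by (rule lborel_pair.Fubini') measurable
    also have "\<dots> = (\<integral>\<^sup>+h. ennreal (\<eta> h) * (\<integral>\<^sup>+x. ennreal \<bar>f (x - h) - f x\<bar> \<partial>lborel) \<partial>lborel)"
      by (intro nn_integral_cong nn_integral_cmult) measurable
    also have "\<dots> \<le> (\<integral>\<^sup>+h. ennreal (\<eta> h) * ennreal d \<partial>lborel)"
    proof (rule nn_integral_mono)
      fix h
      show "ennreal (\<eta> h) * (\<integral>\<^sup>+x. ennreal \<bar>f (x - h) - f x\<bar> \<partial>lborel) \<le> ennreal (\<eta> h) * ennreal d"
        using e0(2)[of h] zero[of h] e by (cases "norm h < e") (auto intro!: mult_left_mono)
    qed
    also have "\<dots> = ennreal d" using mollifier_reflect(5)[OF moll] by (subst nn_integral_multc) auto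
    finally show "(\<integral>\<^sup>+x. ennreal \<bar>mollify \<eta> f x - f x\<bar> \<partial>lborel) \<le> ennreal d" .
  qed
qed

text \<open>
  Jensen for the probability density \<open>y \<mapsto> \<eta> (x - y)\<close>: integrate \<open>2 (a \<bullet> v) - |a|\<^sup>2 \<le> |v|\<^sup>2\<close>
  for \<open>v = f y\<close> and take \<open>a\<close> to be the mollification.
\<close>

lemma norm_mollify_square_le:
  fixes f :: "'a::euclidean_space \<Rightarrow> 'b::euclidean_space"
  assumes moll: "mollifier e \<eta>" and f: "integrable lborel f" and f2: "integrable lborel (\<lambda>y. (norm (f y))\<^sup>2)"
  shows "ennreal ((norm (mollify \<eta> f x))\<^sup>2) \<le> (\<integral>\<^sup>+y. ennreal (\<eta> (x - y) * (norm (f y))\<^sup>2) \<partial>lborel)"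
proof -
  have [measurable]: "\<eta> \<in> borel_measurable borel" and pos: "\<And>x. \<eta> x \<ge> 0"
    using moll by (auto simp: mollifier_def)
  obtain M where M: "\<And>x. \<eta> x \<le> M" using moll by (auto simp: mollifier_def)
  have i1: "integrable lborel (\<lambda>y. \<eta> (x - y) *\<^sub>R f y)"
    by (rule integrable_bounded_reflect_mult[of \<eta> M]) (use pos M f in auto)
  have "integrable lborel (\<lambda>y. \<eta> (x - y) *\<^sub>R (norm (f y))\<^sup>2)"
    by (rule integrable_bounded_reflect_mult[of \<eta> M]) (use pos M f2 in auto)
  then have i2: "integrable lborel (\<lambda>y. \<eta> (x - y) * (norm (f y))\<^sup>2)" by simp
  let ?a = "mollify \<eta> f x"
  have i3: "integrable lborel (\<lambda>y. \<eta> (x - y) * (norm ?a)\<^sup>2)" using mollifier_reflect(1)[OF moll] by simp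
  have i4: "integrable lborel (\<lambda>y. 2 * (?a \<bullet> (\<eta> (x - y) *\<^sub>R f y)))"
    by (intro integrable_mult_right integrable_inner_right i1)
  have "(norm ?a)\<^sup>2 = (\<integral>y. 2 * (?a \<bullet> (\<eta> (x - y) *\<^sub>R f y)) - \<eta> (x - y) * (norm ?a)\<^sup>2 \<partial>lborel)"
  proof -
    have "(\<integral>y. 2 * (?a \<bullet> (\<eta> (x - y) *\<^sub>R f y)) - \<eta> (x - y) * (norm ?a)\<^sup>2 \<partial>lborel)
      = 2 * (?a \<bullet> (\<integral>y. \<eta> (x - y) *\<^sub>R f y \<partial>lborel)) - (\<integral>y. \<eta> (x - y) \<partial>lborel) * (norm ?a)\<^sup>2"
      using i1 i3 i4 by (subst Bochner_Integration.integral_diff) (auto simp del: inner_scaleR_right simp: integral_inner_right)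
    also have "\<dots> = (norm ?a)\<^sup>2"
      by (simp add: mollifier_reflect(2)[OF moll] mollify_def[symmetric] power2_norm_eq_inner)
    finally show ?thesis by simp
  qed
  also have "\<dots> \<le> (\<integral>y. \<eta> (x - y) * (norm (f y))\<^sup>2 \<partial>lborel)"
  proof (intro integral_mono Bochner_Integration.integrable_diff i2 i3 i4)
    fix y
    have "0 \<le> (norm (?a - f y))\<^sup>2" by simp
    also have "\<dots> = (norm ?a)\<^sup>2 - 2 * (?a \<bullet> f y) + (norm (f y))\<^sup>2"
      unfolding power2_norm_eq_inner by (simp add: inner_diff_left inner_diff_right inner_commute)
    finally have "\<eta> (x - y) * (2 * (?a \<bullet> f y) - (norm ?a)\<^sup>2) \<le> \<eta> (x - y) * (norm (f y))\<^sup>2"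
      using pos by (intro mult_left_mono) auto
    then show "2 * (?a \<bullet> (\<eta> (x - y) *\<^sub>R f y)) - \<eta> (x - y) * (norm ?a)\<^sup>2 \<le> \<eta> (x - y) * (norm (f y))\<^sup>2"
      by (simp add: algebra_simps)
  qed
  finally have "ennreal ((norm ?a)\<^sup>2) \<le> ennreal (\<integral>y. \<eta> (x - y) * (norm (f y))\<^sup>2 \<partial>lborel)" by (rule ennreal_leI)
  also have "\<dots> = (\<integral>\<^sup>+y. ennreal (\<eta> (x - y) * (norm (f y))\<^sup>2) \<partial>lborel)"
    using i2 pos by (subst nn_integral_eq_integral) auto
  finally show ?thesis .
qed

lemma nn_integral_mollify_square_le:
  fixes f :: "'a::euclidean_space \<Rightarrow> 'b::euclidean_space" and v w :: "'a \<Rightarrow> real"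
  assumes moll: "mollifier e \<eta>" and f: "integrable lborel f" and f2: "integrable lborel (\<lambda>y. (norm (f y))\<^sup>2)"
    and [measurable]: "v \<in> borel_measurable borel" "w \<in> borel_measurable borel"
    and w: "\<And>x. 0 \<le> w x" and v: "\<And>y. 0 \<le> v y"
    and vw: "\<And>x y. norm (x - y) < e \<Longrightarrow> v x \<le> w y"
  shows "(\<integral>\<^sup>+x. ennreal (v x * (norm (mollify \<eta> f x))\<^sup>2) \<partial>lborel) \<le> (\<integral>\<^sup>+y. ennreal (w y * (norm (f y))\<^sup>2) \<partial>lborel)"
proof -
  have [measurable]: "\<eta> \<in> borel_measurable borel" and pos: "\<And>x. \<eta> x \<ge> 0" and zero: "\<And>x. norm x \<ge> e \<Longrightarrow> \<eta> x = 0"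
    using moll by (auto simp: mollifier_def)
  have [measurable]: "f \<in> borel_measurable borel" using f by simp
  have "(\<integral>\<^sup>+x. ennreal (v x * (norm (mollify \<eta> f x))\<^sup>2) \<partial>lborel)
     \<le> (\<integral>\<^sup>+x. \<integral>\<^sup>+y. ennreal (v x * \<eta> (x - y) * (norm (f y))\<^sup>2) \<partial>lborel \<partial>lborel)"
  proof (rule nn_integral_mono)
    fix x
    have "ennreal (v x * (norm (mollify \<eta> f x))\<^sup>2) = ennreal (v x) * ennreal ((norm (mollify \<eta> f x))\<^sup>2)"
      using v by (simp add: ennreal_mult)
    also have "\<dots> \<le> ennreal (v x) * (\<integral>\<^sup>+y. ennreal (\<eta> (x - y) * (norm (f y))\<^sup>2) \<partial>lborel)"
      by (intro mult_left_mono norm_mollify_square_le[OF moll f f2]) auto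
    also have "\<dots> = (\<integral>\<^sup>+y. ennreal (v x * \<eta> (x - y) * (norm (f y))\<^sup>2) \<partial>lborel)"
      using v pos by (subst nn_integral_cmult[symmetric]) (auto intro!: nn_integral_cong simp: ennreal_mult[symmetric] mult.assoc)
    finally show "ennreal (v x * (norm (mollify \<eta> f x))\<^sup>2) \<le> (\<integral>\<^sup>+y. ennreal (v x * \<eta> (x - y) * (norm (f y))\<^sup>2) \<partial>lborel)" .
  qed
  also have "\<dots> = (\<integral>\<^sup>+y. \<integral>\<^sup>+x. ennreal (v x * \<eta> (x - y) * (norm (f y))\<^sup>2) \<partial>lborel \<partial>lborel)"
    by (rule lborel_pair.Fubini') measurable
  also have "\<dots> \<le> (\<integral>\<^sup>+y. \<integral>\<^sup>+x. ennreal (\<eta> (x - y)) * ennreal (w y * (norm (f y))\<^sup>2) \<partial>lborel \<partial>lborel)"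
  proof (intro nn_integral_mono)
    fix x y
    have "v x * \<eta> (x - y) \<le> w y * \<eta> (x - y)"
      using vw[of x y] zero[of "x - y"] pos by (cases "norm (x - y) < e") (auto intro!: mult_right_mono)
    then have "v x * \<eta> (x - y) * (norm (f y))\<^sup>2 \<le> w y * \<eta> (x - y) * (norm (f y))\<^sup>2" by (rule mult_right_mono) simp
    also have "\<dots> = \<eta> (x - y) * (w y * (norm (f y))\<^sup>2)" by simp
    finally show "ennreal (v x * \<eta> (x - y) * (norm (f y))\<^sup>2) \<le> ennreal (\<eta> (x - y)) * ennreal (w y * (norm (f y))\<^sup>2)"
      using pos w by (simp add: ennreal_mult[symmetric] ennreal_leI)
  qed
  also have "\<dots> = (\<integral>\<^sup>+y. ennreal (w y * (norm (f y))\<^sup>2) \<partial>lborel)"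
    using mollifier_reflect(4)[OF moll] by (subst nn_integral_multc) auto
  finally show ?thesis .
qed

section \<open>Sobolev functions over compact subsets of the domain\<close>

text \<open>
  Fatou's lemma in the form in which all limits below are taken.
\<close>

lemma nn_integral_le_of_AE_limit:
  assumes [measurable]: "\<And>n. u n \<in> borel_measurable M" "u0 \<in> borel_measurable M"
    and lim: "AE x in M. (\<lambda>n. u n x) \<longlonglongrightarrow> (u0 x :: ennreal)"
    and le: "\<And>n. (\<integral>\<^sup>+x. u n x \<partial>M) \<le> R n" and R: "R \<longlonglongrightarrow> R0"
  shows "(\<integral>\<^sup>+x. u0 x \<partial>M) \<le> R0"
proof -
  have "(\<integral>\<^sup>+x. u0 x \<partial>M) = (\<integral>\<^sup>+x. liminf (\<lambda>n. u n x) \<partial>M)"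
  proof (rule nn_integral_cong_AE)
    show "AE x in M. u0 x = liminf (\<lambda>n. u n x)"
      using lim by eventually_elim (simp add: lim_imp_Liminf)
  qed
  also have "\<dots> \<le> liminf (\<lambda>n. \<integral>\<^sup>+x. u n x \<partial>M)" by (rule nn_integral_liminf) measurable
  also have "\<dots> \<le> liminf R" using le by (intro Liminf_mono always_eventually) auto
  also have "\<dots> = R0" using R by (intro lim_imp_Liminf) auto
  finally show ?thesis .
qed

lemma measure_boltzmann_pos:
  fixes E :: "'a::euclidean_space \<Rightarrow> real"
  assumes [measurable]: "K \<in> sets borel" "E \<in> borel_measurable borel"
    and fin: "finite_measure (boltzmann K E)" and r: "r > 0" and sub: "ball x r \<subseteq> K"
  shows "measure (boltzmann K E) UNIV > 0"
proof -
  interpret finite_measure "boltzmann K E" by fact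
  have "emeasure (boltzmann K E) UNIV \<noteq> 0"
  proof
    assume "emeasure (boltzmann K E) UNIV = 0"
    then have "(\<integral>\<^sup>+x. ennreal (indicator K x * exp (- E x)) \<partial>lborel) = 0"
      by (simp add: boltzmann_def emeasure_density)
    then have "AE x in lborel. ennreal (indicator K x * exp (- E x)) = 0"
      by (subst (asm) nn_integral_0_iff_AE) auto
    then have "AE y in lborel. y \<notin> ball x r"
      by eventually_elim (use sub in \<open>auto simp: indicator_def split: if_splits\<close>)
    then have "emeasure lborel (ball x r) = 0"
      by (subst (asm) AE_iff_null_sets[symmetric]) (auto simp: null_sets_def)
    then show False using content_ball_pos[OF r, of x] by (simp add: measure_def)
  qed
  then show ?thesis by (simp add: emeasure_eq_measure zero_less_measure_iff)
qed

lemma strongly_convex_on_subset: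
  "strongly_convex_on D \<rho> E \<Longrightarrow> K \<subseteq> D \<Longrightarrow> strongly_convex_on K \<rho> E"
  unfolding strongly_convex_on_def by blast

lemma strongly_convex_on_continuous:
  assumes D: "open D" "convex D" and sc: "strongly_convex_on D \<rho> E" and \<rho>: "\<rho> \<ge> 0"
  shows "continuous_on D E"
proof (rule convex_on_continuous[OF D(1)])
  show "convex_on D E"
  proof (rule convex_onI)
    fix t :: real and x y assume t: "0 < t" "t < 1" and xy: "x \<in> D" "y \<in> D"
    have "E ((1 - t) *\<^sub>R x + t *\<^sub>R y) \<le> (1 - t) * E x + t * E y - \<rho> * (1 - t) * t / 2 * (norm (x - y))\<^sup>2"
      using sc xy t unfolding strongly_convex_on_def by simp
    moreover have "0 \<le> \<rho> * (1 - t) * t / 2 * (norm (x - y))\<^sup>2" using \<rho> t by simp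
    ultimately show "E ((1 - t) *\<^sub>R x + t *\<^sub>R y) \<le> (1 - t) * E x + t * E y" by linarith
  qed (rule D(2))
qed

lemma compact_neighbourhood:
  fixes K :: "'a::euclidean_space set"
  assumes "compact K" "open D" "K \<subseteq> D"
  obtains r K' where "r > 0" "compact K'" "K' \<subseteq> D" "\<And>x. x \<in> K \<Longrightarrow> cball x r \<subseteq> K'"
proof -
  obtain r where r: "r > 0" "(\<Union>x\<in>K. cball x r) \<subseteq> D"
    using compact_subset_open_imp_cball_epsilon_subset[OF assms] by blast
  have eq: "(\<Union>x\<in>K. cball x r) = {x + y |x y. x \<in> K \<and> y \<in> cball 0 r}"
  proof (intro equalityI subsetI)
    fix z assume "z \<in> (\<Union>x\<in>K. cball x r)"
    then obtain x where "x \<in> K" "z \<in> cball x r" by blast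
    then show "z \<in> {x + y |x y. x \<in> K \<and> y \<in> cball 0 r}"
      by (intro CollectI exI[of _ x] exI[of _ "z - x"]) (auto simp: dist_norm norm_minus_commute)
  next
    fix z assume "z \<in> {x + y |x y. x \<in> K \<and> y \<in> cball 0 r}"
    then obtain x y where "x \<in> K" "y \<in> cball 0 r" "z = x + y" by blast
    then show "z \<in> (\<Union>x\<in>K. cball x r)" by (intro UN_I[of x]) (auto simp: dist_norm)
  qed
  have "compact (\<Union>x\<in>K. cball x r)"
    unfolding eq by (intro compact_sums assms compact_cball)
  then show thesis using that[of r "\<Union>x\<in>K. cball x r"] r by blast
qed

text \<open>
  The measure on the left lives on \<open>K\<close>, the one on the right on the larger set \<open>D\<close>. What
  mollification moves into \<open>K\<close> from outside is thus counted on the right, and the weights at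
  nearby points differ by a factor of at most \<open>1 + k\<close>.
\<close>

lemma boltzmann_mollify_square_le:
  fixes h :: "'a::euclidean_space \<Rightarrow> 'b::euclidean_space"
  assumes moll: "mollifier e \<eta>" and [measurable]: "K \<in> sets borel" "K' \<in> sets borel" "D \<in> sets borel"
      "E \<in> borel_measurable borel" "h \<in> borel_measurable borel"
    and sub: "K' \<subseteq> D" and k: "k \<ge> 0"
    and near: "\<And>x y. x \<in> K \<Longrightarrow> norm (x - y) < e \<Longrightarrow> y \<in> K' \<and> exp (- E x) \<le> (1 + k) * exp (- E y)"
    and h: "integrable lborel (\<lambda>x. indicator K' x *\<^sub>R h x)"
      "integrable lborel (\<lambda>x. (norm (indicator K' x *\<^sub>R h x))\<^sup>2)"
    and h2: "integrable (boltzmann D E) (\<lambda>x. (norm (h x))\<^sup>2)"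
  defines "F \<equiv> mollify \<eta> (\<lambda>x. indicator K' x *\<^sub>R h x)"
  shows "(\<integral>\<^sup>+x. ennreal ((norm (F x))\<^sup>2) \<partial>boltzmann K E) \<le> ennreal ((1 + k) * (\<integral>x. (norm (h x))\<^sup>2 \<partial>boltzmann D E))"
proof -
  have [measurable]: "\<eta> \<in> borel_measurable borel" using moll by (auto simp: mollifier_def)
  have [measurable]: "F \<in> borel_measurable borel" unfolding F_def by (rule borel_measurable_mollify) measurable
  have "(\<integral>\<^sup>+x. ennreal ((norm (F x))\<^sup>2) \<partial>boltzmann K E) = (\<integral>\<^sup>+x. ennreal (indicator K x * exp (- E x) * (norm (F x))\<^sup>2) \<partial>lborel)"
    by (subst nn_integral_boltzmann) (auto simp: ennreal_mult intro!: nn_integral_cong)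
  also have "\<dots> \<le> (\<integral>\<^sup>+y. ennreal ((1 + k) * (indicator K' y * exp (- E y)) * (norm (indicator K' y *\<^sub>R h y))\<^sup>2) \<partial>lborel)"
    unfolding F_def
  proof (rule nn_integral_mollify_square_le[OF moll h])
    show "indicator K x * exp (- E x) \<le> (1 + k) * (indicator K' y * exp (- E y))" if "norm (x - y) < e" for x y
      using near[of x y] that k by (cases "x \<in> K") auto
  qed (use k in auto)
  also have "\<dots> \<le> (\<integral>\<^sup>+y. ennreal (1 + k) * (ennreal (indicator D y * exp (- E y)) * ennreal ((norm (h y))\<^sup>2)) \<partial>lborel)"
  proof (rule nn_integral_mono)
    fix y
    have "(1 + k) * (indicator K' y * exp (- E y)) * (norm (indicator K' y *\<^sub>R h y))\<^sup>2
      \<le> (1 + k) * (indicator D y * exp (- E y) * (norm (h y))\<^sup>2)"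
      using sub k by (auto simp: indicator_def)
    then have "ennreal ((1 + k) * (indicator K' y * exp (- E y)) * (norm (indicator K' y *\<^sub>R h y))\<^sup>2)
      \<le> ennreal ((1 + k) * (indicator D y * exp (- E y) * (norm (h y))\<^sup>2))" by (rule ennreal_leI)
    also have "\<dots> = ennreal (1 + k) * (ennreal (indicator D y * exp (- E y)) * ennreal ((norm (h y))\<^sup>2))"
      using k by (simp add: ennreal_mult)
    finally show "ennreal ((1 + k) * (indicator K' y * exp (- E y)) * (norm (indicator K' y *\<^sub>R h y))\<^sup>2)
      \<le> ennreal (1 + k) * (ennreal (indicator D y * exp (- E y)) * ennreal ((norm (h y))\<^sup>2))" .
  qed
  also have "\<dots> = ennreal (1 + k) * (\<integral>\<^sup>+y. ennreal ((norm (h y))\<^sup>2) \<partial>boltzmann D E)"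
    by (subst nn_integral_cmult, measurable) (subst nn_integral_boltzmann, auto)
  also have "\<dots> = ennreal ((1 + k) * (\<integral>x. (norm (h x))\<^sup>2 \<partial>boltzmann D E))"
    using k h2 by (subst nn_integral_eq_integral) (auto simp: ennreal_mult)
  finally show ?thesis .
qed

lemma norm_mollify_le:
  fixes f :: "'a::euclidean_space \<Rightarrow> 'b::euclidean_space"
  assumes [measurable]: "\<eta> \<in> borel_measurable borel" and M: "\<And>x. \<bar>\<eta> x\<bar> \<le> M" and f: "integrable lborel f"
  shows "norm (mollify \<eta> f x) \<le> M * (\<integral>y. norm (f y) \<partial>lborel)"
proof -
  have i: "integrable lborel (\<lambda>y. \<eta> (x - y) *\<^sub>R f y)"
    by (rule integrable_bounded_reflect_mult[of \<eta> M]) (use M f in auto)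
  have "norm (mollify \<eta> f x) \<le> (\<integral>y. norm (\<eta> (x - y) *\<^sub>R f y) \<partial>lborel)"
    unfolding mollify_def by (rule integral_norm_bound)
  also have "\<dots> \<le> (\<integral>y. M * norm (f y) \<partial>lborel)"
    by (intro integral_mono integrable_norm[OF i]) (use f M in \<open>auto intro!: mult_right_mono\<close>)
  finally show ?thesis by simp
qed

text \<open>
  Integrating the Taylor bound of \<open>\<eta>\<close> against \<open>f\<close> gives one for the mollified \<open>f\<close> with
  gradient \<open>\<integral> f y *\<^sub>R d\<eta> (z - y)\<close>, so nothing has to be differentiated under the integral. By
  the definition of the weak gradient, tested on \<open>y \<mapsto> \<eta> (z - y)\<close>, that gradient is the
  mollified \<open>g\<close>. The indicator of \<open>K'\<close> makes \<open>f\<close> and \<open>g\<close> globally integrable; it is invisible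
  from a point \<open>z\<close> whose ball of radius \<open>e\<close> lies in \<open>K'\<close>.
\<close>

lemma mollify_taylor:
  fixes f :: "'a::euclidean_space \<Rightarrow> real" and g :: "'a \<Rightarrow> 'a"
  assumes [measurable]: "\<eta> \<in> borel_measurable borel" "d\<eta> \<in> borel_measurable borel"
      "f \<in> borel_measurable borel" "g \<in> borel_measurable borel" "K' \<in> sets borel"
    and M: "\<And>x. \<bar>\<eta> x\<bar> \<le> M" "\<And>x. norm (d\<eta> x) \<le> M"
    and zero: "\<And>x. norm x > e \<Longrightarrow> \<eta> x = 0" "\<And>x. norm x > e \<Longrightarrow> d\<eta> x = 0"
    and taylor: "\<And>x y. \<bar>\<eta> y - \<eta> x - d\<eta> x \<bullet> (y - x)\<bar> \<le> C * (norm (y - x))\<^sup>2"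
    and deriv: "\<And>x y v. frechet_derivative (\<lambda>y. \<eta> (x - y)) (at y) v = - (d\<eta> (x - y) \<bullet> v)"
    and f: "integrable lborel (\<lambda>x. indicator K' x *\<^sub>R f x)" and g: "integrable lborel (\<lambda>x. indicator K' x *\<^sub>R g x)"
    and z: "cball z e \<subseteq> K'"
    and weak: "\<And>b. b \<in> Basis \<Longrightarrow> (\<integral>y. f y * frechet_derivative (\<lambda>y. \<eta> (z - y)) (at y) b \<partial>lborel)
        = - (\<integral>y. (g y \<bullet> b) * \<eta> (z - y) \<partial>lborel)"
  shows "\<bar>mollify \<eta> (\<lambda>x. indicator K' x *\<^sub>R f x) x - mollify \<eta> (\<lambda>x. indicator K' x *\<^sub>R f x) z
     - mollify \<eta> (\<lambda>x. indicator K' x *\<^sub>R g x) z \<bullet> (x - z)\<bar>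
     \<le> C * (\<integral>y. \<bar>indicator K' y *\<^sub>R f y\<bar> \<partial>lborel) * (norm (x - z))\<^sup>2"
proof -
  let ?f = "\<lambda>x. indicator K' x *\<^sub>R f x" and ?g = "\<lambda>x. indicator K' x *\<^sub>R g x"
  have far: "y \<in> K' \<or> norm (z - y) > e" for y
    using z by (auto simp: dist_norm subset_iff not_less)
  have i1: "integrable lborel (\<lambda>y. \<eta> (w - y) *\<^sub>R ?f y)" for w
    by (rule integrable_bounded_reflect_mult[of \<eta> M]) (use M f in auto)
  have i1': "integrable lborel (\<lambda>y. \<eta> (w - y) *\<^sub>R ?g y)" for w
    by (rule integrable_bounded_reflect_mult[of \<eta> M]) (use M g in auto)
  have i2: "integrable lborel (\<lambda>y. ?f y *\<^sub>R d\<eta> (w - y))" for w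
  proof (rule Bochner_Integration.integrable_bound)
    show "integrable lborel (\<lambda>y. M * norm (?f y))" using f by auto
    have M0: "M \<ge> 0" using M(1)[of 0] by linarith
    show "AE y in lborel. norm (?f y *\<^sub>R d\<eta> (w - y)) \<le> norm (M * norm (?f y))"
      using M(2) M0 by (intro AE_I2) (simp add: abs_mult mult.commute[of M] mult_left_mono)
  qed measurable
  have p: "mollify \<eta> ?g z = (\<integral>y. ?f y *\<^sub>R d\<eta> (z - y) \<partial>lborel)"
  proof (rule euclidean_eqI)
    fix b :: 'a assume b: "b \<in> Basis"
    have "mollify \<eta> ?g z \<bullet> b = (\<integral>y. (\<eta> (z - y) *\<^sub>R ?g y) \<bullet> b \<partial>lborel)"
      unfolding mollify_def by (rule integral_inner_left[symmetric]) (use i1' in simp)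
    also have "\<dots> = (\<integral>y. (g y \<bullet> b) * \<eta> (z - y) \<partial>lborel)"
    proof (rule Bochner_Integration.integral_cong)
      fix y
      show "(\<eta> (z - y) *\<^sub>R ?g y) \<bullet> b = (g y \<bullet> b) * \<eta> (z - y)"
        using far[of y] zero(1)[of "z - y"] by (cases "y \<in> K'") auto
    qed simp
    also have "\<dots> = - (\<integral>y. f y * frechet_derivative (\<lambda>y. \<eta> (z - y)) (at y) b \<partial>lborel)"
      using weak[OF b] by simp
    also have "\<dots> = (\<integral>y. f y * (d\<eta> (z - y) \<bullet> b) \<partial>lborel)"
      unfolding deriv by simp
    also have "\<dots> = (\<integral>y. (?f y *\<^sub>R d\<eta> (z - y)) \<bullet> b \<partial>lborel)"
    proof (rule Bochner_Integration.integral_cong)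
      fix y
      show "f y * (d\<eta> (z - y) \<bullet> b) = (?f y *\<^sub>R d\<eta> (z - y)) \<bullet> b"
        using far[of y] zero(2)[of "z - y"] by (cases "y \<in> K'") auto
    qed simp
    also have "\<dots> = (\<integral>y. ?f y *\<^sub>R d\<eta> (z - y) \<partial>lborel) \<bullet> b"
      by (rule integral_inner_left) (use i2 in simp)
    finally show "mollify \<eta> ?g z \<bullet> b = (\<integral>y. ?f y *\<^sub>R d\<eta> (z - y) \<partial>lborel) \<bullet> b" .
  qed
  have i3: "integrable lborel (\<lambda>y. (?f y *\<^sub>R d\<eta> (z - y)) \<bullet> (x - z))"
    by (intro integrable_inner_left i2)
  have p3: "mollify \<eta> ?g z \<bullet> (x - z) = (\<integral>y. (?f y *\<^sub>R d\<eta> (z - y)) \<bullet> (x - z) \<partial>lborel)"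
    unfolding p by (rule integral_inner_left[symmetric]) (use i2 in simp)
  define R where "R y = \<eta> (x - y) *\<^sub>R ?f y - \<eta> (z - y) *\<^sub>R ?f y - (?f y *\<^sub>R d\<eta> (z - y)) \<bullet> (x - z)" for y
  have iR: "integrable lborel R"
    unfolding R_def using i1[of x] i1[of z] i3 by (intro Bochner_Integration.integrable_diff)
  have iB: "integrable lborel (\<lambda>y. (C * (norm (x - z))\<^sup>2) * \<bar>?f y\<bar>)"
    using integrable_norm[OF f] by (intro integrable_mult_right) simp
  have RB: "norm (R y) \<le> (C * (norm (x - z))\<^sup>2) * \<bar>?f y\<bar>" for y
  proof -
    have "R y = (\<eta> (x - y) - \<eta> (z - y) - d\<eta> (z - y) \<bullet> (x - z)) * ?f y"
      by (simp add: R_def algebra_simps)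
    then have "norm (R y) = \<bar>\<eta> (x - y) - \<eta> (z - y) - d\<eta> (z - y) \<bullet> (x - z)\<bar> * \<bar>?f y\<bar>"
      by (simp only: real_norm_def abs_mult)
    also have "\<dots> \<le> C * (norm (x - z))\<^sup>2 * \<bar>?f y\<bar>"
    proof (rule mult_right_mono)
      have "(x - y) - (z - y) = x - z" by simp
      then show "\<bar>\<eta> (x - y) - \<eta> (z - y) - d\<eta> (z - y) \<bullet> (x - z)\<bar> \<le> C * (norm (x - z))\<^sup>2"
        using taylor[of "x - y" "z - y"] by (simp only:)
    qed simp
    finally show ?thesis .
  qed
  have "mollify \<eta> ?f x - mollify \<eta> ?f z - mollify \<eta> ?g z \<bullet> (x - z) = (\<integral>y. R y \<partial>lborel)"
    unfolding p3 unfolding mollify_def R_def using i1[of x] i1[of z] i3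
    by (simp only: Bochner_Integration.integral_diff Bochner_Integration.integrable_diff)
  then have "\<bar>mollify \<eta> ?f x - mollify \<eta> ?f z - mollify \<eta> ?g z \<bullet> (x - z)\<bar> \<le> (\<integral>y. norm (R y) \<partial>lborel)"
    using integral_norm_bound[of lborel R] by simp
  also have "\<dots> \<le> (\<integral>y. (C * (norm (x - z))\<^sup>2) * \<bar>?f y\<bar> \<partial>lborel)"
    by (rule integral_mono[OF integrable_norm[OF iR] iB RB])
  also have "\<dots> = C * (\<integral>y. \<bar>?f y\<bar> \<partial>lborel) * (norm (x - z))\<^sup>2" by simp
  finally show ?thesis .
qed

text \<open>
  Borel measurable representatives of a Sobolev function and of its weak gradient, for a
  strongly log-concave weight on \<open>D\<close>.
\<close>

locale log_concave_sobolev =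
  fixes D :: "'a::euclidean_space set" and E :: "'a \<Rightarrow> real" and \<rho> :: real
    and f :: "'a \<Rightarrow> real" and g :: "'a \<Rightarrow> 'a"
  assumes D: "open D" "convex D" "D \<noteq> {}"
    and \<rho>: "\<rho> > 0" and sc: "strongly_convex_on D \<rho> E"
    and E_measurable[measurable]: "E \<in> borel_measurable borel"
    and f_measurable[measurable]: "f \<in> borel_measurable borel"
    and g_measurable[measurable]: "g \<in> borel_measurable borel"
    and f2: "integrable (boltzmann D E) (\<lambda>x. (f x)\<^sup>2)"
    and g2: "integrable (boltzmann D E) (\<lambda>x. (norm (g x))\<^sup>2)"
    and loc: "\<And>L. compact L \<Longrightarrow> L \<subseteq> D \<Longrightarrow> integrable lborel (\<lambda>x. indicator L x *\<^sub>R f x)"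
      "\<And>L. compact L \<Longrightarrow> L \<subseteq> D \<Longrightarrow> integrable lborel (\<lambda>x. indicator L x *\<^sub>R g x)"
    and weak: "\<And>\<phi> b. \<phi> \<in> test_functions D \<Longrightarrow> b \<in> Basis \<Longrightarrow>
      (\<integral>x. f x * frechet_derivative \<phi> (at x) b \<partial>lborel) = - (\<integral>x. (g x \<bullet> b) * \<phi> x \<partial>lborel)"
begin

lemma continuous_potential: "continuous_on D E"
  using strongly_convex_on_continuous[OF D(1,2) sc] \<rho> by simp

text \<open>
  The mollification radius is chosen so small that mollifying at a point of \<open>K\<close> does not leave
  a compact subset of \<open>D\<close>, that the weight varies by at most the factor \<open>1 + k\<close> within this
  radius, and that the \<open>L\<^sup>1\<close> error is at most \<open>k\<close>.
\<close>

lemma log_sobolev_mollified: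
  assumes K: "compact K" "convex K" "K \<subseteq> D" and d: "d > 0" and k: "k > 0"
  defines "\<nu> \<equiv> boltzmann K E"
  assumes Z: "measure \<nu> UNIV > 0"
  shows "\<exists>F. F \<in> borel_measurable borel \<and> integrable \<nu> (\<lambda>x. (F x)\<^sup>2)
    \<and> (\<integral>x. (F x)\<^sup>2 \<partial>\<nu>) \<le> (1 + k) * (\<integral>x. (f x)\<^sup>2 \<partial>boltzmann D E)
    \<and> (\<integral>\<^sup>+x. ennreal \<bar>indicator K x * (F x - f x)\<bar> \<partial>lborel) \<le> ennreal k
    \<and> (\<integral>\<^sup>+x. ennreal (entropy_gap ((\<integral>x. (F x)\<^sup>2 + d \<partial>\<nu>) / measure \<nu> UNIV) ((F x)\<^sup>2 + d)) \<partial>\<nu>)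
       \<le> ennreal (2 / \<rho> * ((1 + k) * (\<integral>x. (norm (g x))\<^sup>2 \<partial>boltzmann D E)))"
proof -
  obtain r K' where r: "r > 0" and K': "compact K'" "K' \<subseteq> D" "\<And>x. x \<in> K \<Longrightarrow> cball x r \<subseteq> K'"
    using compact_neighbourhood[OF K(1) D(1) K(3)] by metis
  have KK': "K \<subseteq> K'" using K'(3) r by force
  have [measurable]: "K' \<in> sets borel" "K \<in> sets borel" "D \<in> sets borel"
    using K' K D(1) by (auto simp: borel_compact)
  have "uniformly_continuous_on K' E"
    by (intro compact_uniformly_continuous K' continuous_on_subset[OF continuous_potential])
  moreover have "ln (1 + k) > 0" using k by simp
  ultimately obtain s where s: "s > 0" "\<And>x y. x \<in> K' \<Longrightarrow> y \<in> K' \<Longrightarrow> dist y x < s \<Longrightarrow> dist (E y) (E x) < ln (1 + k)"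
    unfolding uniformly_continuous_on_def by metis
  let ?f = "\<lambda>x. indicator K' x *\<^sub>R f x" and ?g = "\<lambda>x. indicator K' x *\<^sub>R g x"
  have if1: "integrable lborel ?f" and ig1: "integrable lborel ?g" using loc K' by auto
  obtain e0 where e0: "e0 > 0" "\<And>e \<eta>. e \<le> e0 \<Longrightarrow> mollifier e \<eta> \<Longrightarrow> (\<integral>\<^sup>+x. ennreal \<bar>mollify \<eta> ?f x - ?f x\<bar> \<partial>lborel) \<le> ennreal k"
    using mollify_L1_convergence[OF if1 k] by metis
  define e where "e = min r (min s e0)"
  have e: "e > 0" "e \<le> r" "e \<le> s" "e \<le> e0" using r s e0 by (auto simp: e_def)
  obtain \<eta> :: "'a \<Rightarrow> real" and M C d\<eta> where T: "mollifier e \<eta> \<and> (\<forall>x. \<eta> x \<le> M) \<and>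
    C \<ge> 0 \<and> d\<eta> \<in> borel_measurable borel \<and> (\<forall>x. norm (d\<eta> x) \<le> M) \<and> (\<forall>x. norm x > e \<longrightarrow> d\<eta> x = 0) \<and>
    (\<forall>x y. \<bar>\<eta> y - \<eta> x - d\<eta> x \<bullet> (y - x)\<bar> \<le> C * (norm (y - x))\<^sup>2) \<and>
    (\<forall>x y v. frechet_derivative (\<lambda>y. \<eta> (x - y)) (at y) v = - (d\<eta> (x - y) \<bullet> v)) \<and>
    (\<forall>x D. cball x e \<subseteq> D \<longrightarrow> (\<lambda>y. \<eta> (x - y)) \<in> test_functions D)"
    using smooth_mollifier_exists[OF e(1), where 'a = 'a] by (elim exE)
  have moll: "mollifier e \<eta>" and M: "\<And>x. \<eta> x \<le> M"
    and C: "C \<ge> 0" and [measurable]: "d\<eta> \<in> borel_measurable borel" and M': "\<And>x. norm (d\<eta> x) \<le> M"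
    and zero': "\<And>x. norm x > e \<Longrightarrow> d\<eta> x = 0"
    and taylor: "\<And>x y. \<bar>\<eta> y - \<eta> x - d\<eta> x \<bullet> (y - x)\<bar> \<le> C * (norm (y - x))\<^sup>2"
    and deriv: "\<And>x y v. frechet_derivative (\<lambda>y. \<eta> (x - y)) (at y) v = - (d\<eta> (x - y) \<bullet> v)"
    and test: "\<And>x D. cball x e \<subseteq> D \<Longrightarrow> (\<lambda>y. \<eta> (x - y)) \<in> test_functions D"
    using T by blast+
  have [measurable]: "\<eta> \<in> borel_measurable borel" and pos: "\<And>x. \<eta> x \<ge> 0" and zero: "\<And>x. norm x > e \<Longrightarrow> \<eta> x = 0"
    using moll by (auto simp: mollifier_def)
  have absM: "\<bar>\<eta> x\<bar> \<le> M" for x using pos M by simp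
  have M0: "M \<ge> 0" using absM[of 0] by linarith
  define F where "F = mollify \<eta> ?f"
  define p where "p = mollify \<eta> ?g"
  have [measurable]: "F \<in> borel_measurable borel" "p \<in> borel_measurable borel"
    unfolding F_def p_def by (rule borel_measurable_mollify; measurable)+
  obtain b where b: "\<And>x. x \<in> K' \<Longrightarrow> \<bar>E x\<bar> \<le> b"
    using compact_imp_bounded[OF compact_continuous_image[OF continuous_on_subset[OF continuous_potential K'(2)] K'(1)]]
    by (force simp: bounded_iff)
  have loc2: "integrable lborel (\<lambda>x. (norm (indicator K' x *\<^sub>R h x))\<^sup>2)"
    if [measurable]: "h \<in> borel_measurable borel" and h: "integrable (boltzmann D E) (\<lambda>x. (norm (h x))\<^sup>2)"
    for h :: "'a \<Rightarrow> 'b::euclidean_space"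
  proof (rule Bochner_Integration.integrable_bound)
    have "integrable lborel (\<lambda>x. indicator D x * exp (- E x) * (norm (h x))\<^sup>2)"
      using h by (simp add: integrable_boltzmann)
    then show "integrable lborel (\<lambda>x. exp b * (indicator D x * exp (- E x) * (norm (h x))\<^sup>2))"
      by (rule integrable_mult_right)
    show "AE x in lborel. norm ((norm (indicator K' x *\<^sub>R h x))\<^sup>2) \<le> norm (exp b * (indicator D x * exp (- E x) * (norm (h x))\<^sup>2))"
    proof (rule AE_I2)
      fix x
      show "norm ((norm (indicator K' x *\<^sub>R h x))\<^sup>2) \<le> norm (exp b * (indicator D x * exp (- E x) * (norm (h x))\<^sup>2))"
      proof (cases "x \<in> K'")
        case True
        have "1 \<le> exp (b + - E x)" using b[OF True] by simp
        also have "\<dots> = exp b * exp (- E x)" by (rule exp_add)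
        finally have "1 * (norm (h x))\<^sup>2 \<le> exp b * exp (- E x) * (norm (h x))\<^sup>2" by (rule mult_right_mono) simp
        moreover have "x \<in> D" using True K' by auto
        ultimately show ?thesis using True by (simp add: mult.assoc)
      qed simp
    qed
  qed measurable
  have near: "y \<in> K' \<and> exp (- E x) \<le> (1 + k) * exp (- E y)" if x: "x \<in> K" and xy: "norm (x - y) < e" for x y
  proof
    show y: "y \<in> K'" using K'(3)[OF x] xy e by (auto simp: dist_norm subset_iff)
    have "dist (E y) (E x) < ln (1 + k)"
      using xy e x KK' y by (intro s(2)) (auto simp: dist_norm norm_minus_commute)
    then have "- E x \<le> ln (1 + k) + - E y" by (simp add: dist_real_def)
    then have "exp (- E x) \<le> exp (ln (1 + k) + - E y)" by simp
    then show "exp (- E x) \<le> (1 + k) * exp (- E y)" using k by (simp only: exp_add exp_ln)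
  qed
  have f2': "integrable (boltzmann D E) (\<lambda>x. (norm (f x))\<^sup>2)" using f2 by simp
  have leF: "(\<integral>\<^sup>+x. ennreal ((norm (F x))\<^sup>2) \<partial>\<nu>) \<le> ennreal ((1 + k) * (\<integral>x. (norm (f x))\<^sup>2 \<partial>boltzmann D E))"
    unfolding F_def \<nu>_def
    by (rule boltzmann_mollify_square_le[OF moll _ _ _ _ _ K'(2) _ near if1 loc2[OF _ f2'] f2']) (use k in auto)
  have lep: "(\<integral>\<^sup>+x. ennreal ((norm (p x))\<^sup>2) \<partial>\<nu>) \<le> ennreal ((1 + k) * (\<integral>x. (norm (g x))\<^sup>2 \<partial>boltzmann D E))"
    unfolding p_def \<nu>_def
    by (rule boltzmann_mollify_square_le[OF moll _ _ _ _ _ K'(2) _ near ig1 loc2[OF _ g2] g2]) (use k in auto)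
  define B where "B = max b (max (M * (\<integral>y. norm (?f y) \<partial>lborel)) (M * (\<integral>y. norm (?g y) \<partial>lborel)))"
  have B: "b \<le> B" "M * (\<integral>y. norm (?f y) \<partial>lborel) \<le> B" "M * (\<integral>y. norm (?g y) \<partial>lborel) \<le> B"
    unfolding B_def by (rule max.cobounded1 max.coboundedI2[OF max.cobounded1] max.coboundedI2[OF max.cobounded2])+
  have Eb: "\<bar>E x\<bar> \<le> B" if "x \<in> K" for x
  proof -
    have "x \<in> K'" using that KK' by blast
    from order_trans[OF b[OF this] B(1)] show ?thesis .
  qed
  have Fb: "\<bar>F x\<bar> \<le> B" for x
    using order_trans[OF norm_mollify_le[OF _ absM if1, where x = x] B(2)] by (simp add: F_def)
  have pb: "norm (p x) \<le> B" for x
    using order_trans[OF norm_mollify_le[OF _ absM ig1, where x = x] B(3)] by (simp add: p_def)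
  have Tay: "\<bar>F x - F z - p z \<bullet> (x - z)\<bar> \<le> C * (\<integral>y. \<bar>?f y\<bar> \<partial>lborel) * (norm (x - z))\<^sup>2"
    if z: "z \<in> K" for x z
    unfolding F_def p_def
  proof (rule mollify_taylor[where d\<eta> = d\<eta> and M = M and e = e])
    have "cball z e \<subseteq> cball z r" using e by auto
    then show sub: "cball z e \<subseteq> K'" using K'(3)[OF z] by blast
    then have "cball z e \<subseteq> D" using K' by blast
    from weak[OF test[OF this]]
    show "(\<integral>y. f y * frechet_derivative (\<lambda>y. \<eta> (z - y)) (at y) b \<partial>lborel)
        = - (\<integral>y. (g y \<bullet> b) * \<eta> (z - y) \<partial>lborel)" if "b \<in> Basis" for b using that .
  qed (use absM M' zero zero' taylor deriv if1 ig1 in auto)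
  have C0: "C * (\<integral>y. \<bar>?f y\<bar> \<partial>lborel) \<ge> 0" using C by (intro mult_nonneg_nonneg integral_nonneg_AE) auto
  note LS = log_sobolev_compact[OF K(1,2) \<rho> strongly_convex_on_subset[OF sc K(3)] _ _ _ Eb Fb pb C0 Tay d, folded \<nu>_def]
  have ip: "integrable \<nu> (\<lambda>x. (norm (p x))\<^sup>2)" and iF: "integrable \<nu> (\<lambda>x. (F x)\<^sup>2)"
    and gap: "(\<integral>\<^sup>+x. ennreal (entropy_gap ((\<integral>x. (F x)\<^sup>2 + d \<partial>\<nu>) / measure \<nu> UNIV) ((F x)\<^sup>2 + d)) \<partial>\<nu>)
      \<le> ennreal (2 / \<rho> * (\<integral>x. (norm (p x))\<^sup>2 \<partial>\<nu>))"
    using LS Z by simp_all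
  have nonneg: "0 \<le> (\<integral>x. h x \<partial>boltzmann D E)" if "\<And>x. 0 \<le> h x" for h :: "'a \<Rightarrow> real"
    using that by (intro integral_nonneg_AE) auto
  have "(\<integral>x. (norm (p x))\<^sup>2 \<partial>\<nu>) \<le> (1 + k) * (\<integral>x. (norm (g x))\<^sup>2 \<partial>boltzmann D E)"
    using lep ip k nonneg by (subst (asm) nn_integral_eq_integral) auto
  then have R: "2 / \<rho> * (\<integral>x. (norm (p x))\<^sup>2 \<partial>\<nu>) \<le> 2 / \<rho> * ((1 + k) * (\<integral>x. (norm (g x))\<^sup>2 \<partial>boltzmann D E))"
    using \<rho> by (intro mult_left_mono) auto
  have FF: "(\<integral>x. (F x)\<^sup>2 \<partial>\<nu>) \<le> (1 + k) * (\<integral>x. (f x)\<^sup>2 \<partial>boltzmann D E)"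
    using leF iF k nonneg by (subst (asm) nn_integral_eq_integral) auto
  have L1: "(\<integral>\<^sup>+x. ennreal \<bar>indicator K x * (F x - f x)\<bar> \<partial>lborel) \<le> ennreal k"
  proof -
    have "(\<integral>\<^sup>+x. ennreal \<bar>indicator K x * (F x - f x)\<bar> \<partial>lborel) \<le> (\<integral>\<^sup>+x. ennreal \<bar>F x - ?f x\<bar> \<partial>lborel)"
      using KK' by (intro nn_integral_mono ennreal_leI) (auto simp: indicator_def)
    also have "\<dots> \<le> ennreal k" unfolding F_def by (rule e0(2)[OF e(4) moll])
    finally show ?thesis .
  qed
  show ?thesis
    by (intro exI[of _ F] conjI FF L1 iF order_trans[OF gap ennreal_leI[OF R]]) measurable
qed

end

section \<open>Exhaustion of the domain\<close>

text \<open>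
  The points of norm at most \<open>n\<close> whose ball of radius \<open>1 / (n + 1)\<close> lies in \<open>D\<close> form a convex
  set because \<open>D\<close> is convex, and a closed one because the ball is open.
\<close>

lemma convex_exhaustion:
  fixes D :: "'a::euclidean_space set"
  assumes D: "open D" "convex D"
  obtains K :: "nat \<Rightarrow> 'a set" where "\<And>n. compact (K n)" "\<And>n. convex (K n)" "\<And>n. K n \<subseteq> D"
    "incseq K" "\<And>x. x \<in> D \<Longrightarrow> \<exists>n. \<exists>r>0. ball x r \<subseteq> K n"
proof -
  define K where "K n = {x \<in> cball 0 (real n). ball x (1 / real (Suc n)) \<subseteq> D}" for n
  have cl: "closed {x. ball x r \<subseteq> D}" for r
  proof -
    have "open (- {x. ball x r \<subseteq> D})"
      unfolding open_contains_ball
    proof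
      fix x assume "x \<in> - {x. ball x r \<subseteq> D}"
      then obtain y where y: "y \<in> ball x r" "y \<notin> D" by blast
      show "\<exists>e>0. ball x e \<subseteq> - {x. ball x r \<subseteq> D}"
      proof (intro exI[of _ "r - dist x y"] conjI)
        show "r - dist x y > 0" using y by simp
        show "ball x (r - dist x y) \<subseteq> - {x. ball x r \<subseteq> D}"
        proof
          fix z assume "z \<in> ball x (r - dist x y)"
          then have "y \<in> ball z r" using dist_triangle[of z y x] by (simp add: dist_commute)
          then show "z \<in> - {x. ball x r \<subseteq> D}" using y by blast
        qed
      qed
    qed
    then show ?thesis by (simp add: closed_def)
  qed
  have conv: "convex {x. ball x r \<subseteq> D}" for r
  proof (rule convexI)
    fix x y and u v :: real
    assume xy: "x \<in> {x. ball x r \<subseteq> D}" "y \<in> {x. ball x r \<subseteq> D}" and uv: "0 \<le> u" "0 \<le> v" "u + v = 1"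
    have "w \<in> D" if w: "w \<in> ball (u *\<^sub>R x + v *\<^sub>R y) r" for w
    proof -
      define h where "h = w - (u *\<^sub>R x + v *\<^sub>R y)"
      have "norm h < r" using w by (simp add: h_def dist_norm norm_minus_commute)
      then have "x + h \<in> D" "y + h \<in> D" using xy by (auto simp: subset_iff dist_norm)
      then have "u *\<^sub>R (x + h) + v *\<^sub>R (y + h) \<in> D" using D(2) uv by (auto simp: convex_def)
      also have "u *\<^sub>R (x + h) + v *\<^sub>R (y + h) = u *\<^sub>R x + v *\<^sub>R y + (u + v) *\<^sub>R h"
        by (simp add: algebra_simps)
      also have "\<dots> = w" using uv by (simp add: h_def)
      finally show ?thesis .
    qed
    then show "u *\<^sub>R x + v *\<^sub>R y \<in> {x. ball x r \<subseteq> D}" by blast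
  qed
  have Keq: "K n = cball 0 (real n) \<inter> {x. ball x (1 / real (Suc n)) \<subseteq> D}" for n
    by (auto simp: K_def)
  show thesis
  proof
    show "compact (K n)" for n unfolding Keq by (intro compact_Int_closed compact_cball cl)
    show "convex (K n)" for n unfolding Keq by (intro convex_Int convex_cball conv)
    show "K n \<subseteq> D" for n unfolding K_def by (auto simp: subset_iff)
    show "incseq K"
    proof (rule incseq_SucI)
      fix n
      have "1 / real (Suc (Suc n)) \<le> 1 / real (Suc n)" by (simp add: frac_le)
      then have "ball x (1 / real (Suc (Suc n))) \<subseteq> ball x (1 / real (Suc n))" for x :: 'a by (rule subset_ball)
      then show "K n \<subseteq> K (Suc n)" unfolding K_def by fastforce
    qed
    fix x assume "x \<in> D"
    then obtain e where e: "e > 0" "ball x e \<subseteq> D" using D(1) open_contains_ball by blast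
    obtain n :: nat where n: "norm x + e + 2 / e \<le> real n" using real_arch_simple by blast
    have ne: "norm x + e \<le> real n" using n e by (smt (verit) divide_nonneg_pos)
    have "2 / e \<le> real (Suc n)" using n e by (smt (verit) norm_ge_zero of_nat_Suc)
    then have s: "1 / real (Suc n) \<le> e / 2" using e by (simp add: field_simps)
    have "ball x (e / 2) \<subseteq> K n"
    proof
      fix y assume y: "y \<in> ball x (e / 2)"
      then have "norm (y - x) < e / 2" by (simp add: dist_norm norm_minus_commute)
      then have "norm y \<le> real n" using ne e norm_triangle_ineq[of x "y - x"] by simp
      moreover have "ball y (1 / real (Suc n)) \<subseteq> ball x e"
      proof
        fix z assume "z \<in> ball y (1 / real (Suc n))"
        then show "z \<in> ball x e" using y s dist_triangle[of x z y] by simp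
      qed
      ultimately show "y \<in> K n" using e unfolding K_def by auto
    qed
    then show "\<exists>n. \<exists>r>0. ball x r \<subseteq> K n" using e by (intro exI[of _ n] exI[of _ "e / 2"]) simp
  qed
qed

lemma measure_boltzmann_mono:
  assumes [measurable]: "K \<in> sets borel" "L \<in> sets borel" "E \<in> borel_measurable borel"
    and KL: "K \<subseteq> L" and fin: "finite_measure (boltzmann L E)"
  shows "finite_measure (boltzmann K E)" "measure (boltzmann K E) UNIV \<le> measure (boltzmann L E) UNIV"
proof -
  interpret L: finite_measure "boltzmann L E" by fact
  have le: "emeasure (boltzmann K E) UNIV \<le> emeasure (boltzmann L E) UNIV"
    using KL by (auto simp: boltzmann_def emeasure_density intro!: nn_integral_mono ennreal_leI simp: indicator_def)
  have "emeasure (boltzmann L E) UNIV < \<infinity>" using L.emeasure_finite[of UNIV] by (simp add: less_top[symmetric])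
  then show fin': "finite_measure (boltzmann K E)" using le by (intro finite_measureI) auto
  interpret K: finite_measure "boltzmann K E" by (rule fin')
  show "measure (boltzmann K E) UNIV \<le> measure (boltzmann L E) UNIV"
    using le by (simp add: K.emeasure_eq_measure L.emeasure_eq_measure)
qed

context log_concave_sobolev
begin

text \<open>
  Along the exhaustion, with errors \<open>k n\<close> tending to \<open>0\<close>, the means \<open>c n\<close> of the shifted
  squares stay between \<open>d\<close> and a fixed bound. A subsequence makes them converge to some
  \<open>l > 0\<close>, a further one makes the mollified functions converge almost everywhere, and Fatou
  applies. Any positive \<open>l\<close> will do, since the mean minimises the integrated gap.
\<close>

lemma log_sobolev_shifted:
  assumes fin: "finite_measure (boltzmann D E)" and d: "d > 0"
  shows "\<exists>c>0. (\<integral>\<^sup>+x. ennreal (entropy_gap c ((f x)\<^sup>2 + d)) \<partial>boltzmann D E)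
     \<le> ennreal (2 / \<rho> * (\<integral>x. (norm (g x))\<^sup>2 \<partial>boltzmann D E))"
proof -
  have [measurable]: "D \<in> sets borel" using D(1) by simp
  obtain K0 :: "nat \<Rightarrow> 'a set" where K0: "\<And>n. compact (K0 n)" "\<And>n. convex (K0 n)" "\<And>n. K0 n \<subseteq> D"
    "incseq K0" "\<And>x. x \<in> D \<Longrightarrow> \<exists>n. \<exists>r>0. ball x r \<subseteq> K0 n"
    using convex_exhaustion[OF D(1,2)] by blast
  obtain x0 where "x0 \<in> D" using D(3) by blast
  then obtain n0 r0 where n0: "r0 > 0" "ball x0 r0 \<subseteq> K0 n0" using K0(5) by blast
  \<comment> \<open>the shift of the index makes every \<open>K n\<close> contain a ball, so the masses are bounded below\<close>
  define K where "K n = K0 (n + n0)" for n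
  have K: "compact (K n)" "convex (K n)" "K n \<subseteq> D" "K 0 \<subseteq> K n" for n
    using K0 incseqD[OF K0(4), of n0 "n + n0"] by (auto simp: K_def)
  have [measurable]: "K n \<in> sets borel" for n using K(1) by (rule borel_compact)
  let ?\<nu> = "\<lambda>n. boltzmann (K n) E"
  have finK: "finite_measure (?\<nu> n)" for n
    by (rule measure_boltzmann_mono(1)[OF _ _ _ K(3) fin]) measurable
  define z where "z = measure (?\<nu> 0) UNIV"
  have z: "z > 0" unfolding z_def
    by (rule measure_boltzmann_pos[OF _ _ finK n0(1)]) (use n0 K0(1)[of n0] in \<open>auto simp: K_def borel_compact\<close>)
  have zn: "z \<le> measure (?\<nu> n) UNIV" for n
    unfolding z_def by (rule measure_boltzmann_mono(2)[OF _ _ _ K(4) finK]) measurable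
  then have Zn: "measure (?\<nu> n) UNIV > 0" for n using z by (meson less_le_trans)
  define I where "I = (\<integral>x. (f x)\<^sup>2 \<partial>boltzmann D E)"
  define J where "J = (\<integral>x. (norm (g x))\<^sup>2 \<partial>boltzmann D E)"
  have I0: "I \<ge> 0" unfolding I_def by (auto intro!: integral_nonneg_AE)
  define k where "k n = 1 / real (Suc n)" for n
  have k: "k n > 0" "k n \<le> 1" for n by (auto simp: k_def)
  have klim: "k \<longlonglongrightarrow> 0" unfolding k_def using LIMSEQ_inverse_real_of_nat by (simp add: inverse_eq_divide)
  define c' where "c' F n = (\<integral>x. (F x)\<^sup>2 + d \<partial>?\<nu> n) / measure (?\<nu> n) UNIV" for F :: "'a \<Rightarrow> real" and n
  define P where "P n F \<longleftrightarrow> F \<in> borel_measurable borel \<and> integrable (?\<nu> n) (\<lambda>x. (F x)\<^sup>2)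
    \<and> (\<integral>x. (F x)\<^sup>2 \<partial>?\<nu> n) \<le> (1 + k n) * I
    \<and> (\<integral>\<^sup>+x. ennreal \<bar>indicator (K n) x * (F x - f x)\<bar> \<partial>lborel) \<le> ennreal (k n)
    \<and> (\<integral>\<^sup>+x. ennreal (entropy_gap (c' F n) ((F x)\<^sup>2 + d)) \<partial>?\<nu> n) \<le> ennreal (2 / \<rho> * ((1 + k n) * J))" for n F
  have "\<exists>F. P n F" for n
    unfolding P_def I_def J_def c'_def
    by (rule log_sobolev_mollified[OF K(1,2,3) d k(1) Zn])
  then obtain F where F: "\<And>n. P n (F n)" by metis
  have Fm[measurable]: "F n \<in> borel_measurable borel" and F2: "integrable (?\<nu> n) (\<lambda>x. (F n x)\<^sup>2)"
    and FI: "(\<integral>x. (F n x)\<^sup>2 \<partial>?\<nu> n) \<le> (1 + k n) * I"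
    and FL: "(\<integral>\<^sup>+x. ennreal \<bar>indicator (K n) x * (F n x - f x)\<bar> \<partial>lborel) \<le> ennreal (k n)"
    and FE: "(\<integral>\<^sup>+x. ennreal (entropy_gap (c' (F n) n) ((F n x)\<^sup>2 + d)) \<partial>?\<nu> n) \<le> ennreal (2 / \<rho> * ((1 + k n) * J))" for n
    using F[of n] unfolding P_def by blast+
  define c where "c n = c' (F n) n" for n
  have c_eq: "c n = (\<integral>x. (F n x)\<^sup>2 \<partial>?\<nu> n) / measure (?\<nu> n) UNIV + d" for n
  proof -
    interpret finite_measure "?\<nu> n" by (rule finK)
    have "(\<integral>x. (F n x)\<^sup>2 + d \<partial>?\<nu> n) = (\<integral>x. (F n x)\<^sup>2 \<partial>?\<nu> n) + d * measure (?\<nu> n) UNIV"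
      using F2[of n] by simp
    then show ?thesis using Zn[of n] by (simp add: c_def c'_def add_divide_distrib)
  qed
  have c_low: "d \<le> c n" for n
    unfolding c_eq by (simp add: integral_nonneg_AE)
  have c_up: "c n \<le> 2 * I / z + d" for n
  proof -
    have "(1 + k n) * I \<le> 2 * I" using k[of n] I0 by (intro mult_right_mono) auto
    then have "(\<integral>x. (F n x)\<^sup>2 \<partial>?\<nu> n) \<le> 2 * I" using FI[of n] by linarith
    then have "(\<integral>x. (F n x)\<^sup>2 \<partial>?\<nu> n) / measure (?\<nu> n) UNIV \<le> 2 * I / z"
      using zn z I0 by (intro frac_le) auto
    then show ?thesis unfolding c_eq by simp
  qed
  have "compact {d..2 * I / z + d}" by simp
  moreover have "\<forall>n. c n \<in> {d..2 * I / z + d}" using c_low c_up by auto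
  ultimately obtain l r where l: "l \<in> {d..2 * I / z + d}" and r: "strict_mono r" and cr: "(c \<circ> r) \<longlonglongrightarrow> l"
    unfolding compact_def by metis
  \<comment> \<open>tends to \<open>0\<close> in \<open>L\<^sup>1\<close>, hence almost everywhere along a subsequence\<close>
  define u where "u n x = indicator (K (r n)) x * (F (r n) x - f x)" for n x
  have [measurable]: "u n \<in> borel_measurable borel" for n unfolding u_def by measurable
  have krlim: "(\<lambda>n. k (r n)) \<longlonglongrightarrow> 0" using LIMSEQ_subseq_LIMSEQ[OF klim r] by (simp add: comp_def)
  have iu: "integrable lborel (u n)" for n
    using FL[of "r n"] by (intro integrableI_bounded) (auto simp: u_def intro: le_less_trans)
  have "(\<lambda>n. \<integral>x. norm (u n x) \<partial>lborel) \<longlonglongrightarrow> 0"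
  proof (rule tendsto_sandwich[OF _ _ tendsto_const krlim])
    show "eventually (\<lambda>n. (\<integral>x. norm (u n x) \<partial>lborel) \<le> k (r n)) sequentially"
    proof (intro always_eventually allI)
      fix n
      have "ennreal (\<integral>x. norm (u n x) \<partial>lborel) = (\<integral>\<^sup>+x. ennreal (norm (u n x)) \<partial>lborel)"
        by (rule nn_integral_eq_integral[symmetric, OF integrable_norm[OF iu]]) simp
      also have "\<dots> \<le> ennreal (k (r n))" using FL[of "r n"] by (simp add: u_def)
      finally have "ennreal (\<integral>x. norm (u n x) \<partial>lborel) \<le> ennreal (k (r n))" .
      then show "(\<integral>x. norm (u n x) \<partial>lborel) \<le> k (r n)" using k(1)[of "r n"] by (simp add: ennreal_le_iff)
    qed
  qed (auto intro!: always_eventually integral_nonneg_AE)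
  then obtain s where s: "strict_mono s" and AEu: "AE x in lborel. (\<lambda>n. u (s n) x) \<longlonglongrightarrow> 0"
    using tendsto_L1_AE_subseq[of lborel u] iu by blast
  define t where "t n = r (s n)" for n
  have t: "strict_mono t" using r s by (simp add: t_def strict_mono_def)
  have ct: "(\<lambda>n. c (t n)) \<longlonglongrightarrow> l"
    using LIMSEQ_subseq_LIMSEQ[OF cr s] by (simp add: t_def comp_def)
  have l0: "l > 0" using l d by simp
  define U where "U n x = ennreal (indicator (K (t n)) x * exp (- E x)) * ennreal (entropy_gap (c (t n)) ((F (t n) x)\<^sup>2 + d))" for n x
  define U0 where "U0 x = ennreal (indicator D x * exp (- E x)) * ennreal (entropy_gap l ((f x)\<^sup>2 + d))" for x
  have "(\<integral>\<^sup>+x. U0 x \<partial>lborel) \<le> ennreal (2 / \<rho> * ((1 + 0) * J))"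
  proof (rule nn_integral_le_of_AE_limit)
    show "U n \<in> borel_measurable lborel" for n unfolding U_def by measurable
    show "U0 \<in> borel_measurable lborel" unfolding U0_def by measurable
    show "(\<integral>\<^sup>+x. U n x \<partial>lborel) \<le> ennreal (2 / \<rho> * ((1 + k (t n)) * J))" for n
    proof -
      have "(\<integral>\<^sup>+x. U n x \<partial>lborel) = (\<integral>\<^sup>+x. ennreal (entropy_gap (c' (F (t n)) (t n)) ((F (t n) x)\<^sup>2 + d)) \<partial>?\<nu> (t n))"
        unfolding U_def c_def by (subst nn_integral_boltzmann) auto
      then show ?thesis using FE by simp
    qed
    have "(\<lambda>n. k (t n)) \<longlonglongrightarrow> 0" using LIMSEQ_subseq_LIMSEQ[OF klim t] by (simp add: comp_def)
    then show "(\<lambda>n. ennreal (2 / \<rho> * ((1 + k (t n)) * J))) \<longlonglongrightarrow> ennreal (2 / \<rho> * ((1 + 0) * J))"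
      by (intro tendsto_ennrealI tendsto_intros)
    show "AE x in lborel. (\<lambda>n. U n x) \<longlonglongrightarrow> U0 x"
      using AEu
    proof eventually_elim
      case (elim x)
      show ?case
      proof (cases "x \<in> D")
        case False
        then have "x \<notin> K n" for n using K(3) by blast
        then show ?thesis using False by (simp add: U_def U0_def)
      next
        case True
        obtain m q where m: "q > 0" "ball x q \<subseteq> K0 m" using K0(5)[OF True] by blast
        have inK: "eventually (\<lambda>n. x \<in> K (t n)) sequentially"
          using eventually_ge_at_top[of m]
        proof eventually_elim
          case (elim n)
          have "m \<le> t n + n0" using elim seq_suble[OF t, of n] by linarith
          then have "K0 m \<subseteq> K (t n)" unfolding K_def by (rule incseqD[OF K0(4)])
          then show ?case using m by force
        qed
        have "eventually (\<lambda>n. f x + u (s n) x = F (t n) x) sequentially"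
          using inK by eventually_elim (simp add: u_def t_def)
        moreover have "(\<lambda>n. f x + u (s n) x) \<longlonglongrightarrow> f x + 0" by (intro tendsto_intros elim)
        ultimately have Flim: "(\<lambda>n. F (t n) x) \<longlonglongrightarrow> f x" by (simp add: tendsto_cong)
        have "(\<lambda>n. entropy_gap (c (t n)) ((F (t n) x)\<^sup>2 + d)) \<longlonglongrightarrow> entropy_gap l ((f x)\<^sup>2 + d)"
          using d by (intro tendsto_entropy_gap[OF ct l0] tendsto_intros Flim) auto
        then have "(\<lambda>n. ennreal (exp (- E x)) * ennreal (entropy_gap (c (t n)) ((F (t n) x)\<^sup>2 + d)))
            \<longlonglongrightarrow> ennreal (exp (- E x)) * ennreal (entropy_gap l ((f x)\<^sup>2 + d))"
          by (intro ennreal_tendsto_cmult tendsto_ennrealI) auto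
        moreover have "eventually (\<lambda>n. ennreal (exp (- E x)) * ennreal (entropy_gap (c (t n)) ((F (t n) x)\<^sup>2 + d)) = U n x) sequentially"
          using inK by eventually_elim (simp add: U_def)
        ultimately show ?thesis using True by (simp add: U0_def tendsto_cong)
      qed
    qed
  qed
  moreover have "(\<integral>\<^sup>+x. U0 x \<partial>lborel) = (\<integral>\<^sup>+x. ennreal (entropy_gap l ((f x)\<^sup>2 + d)) \<partial>boltzmann D E)"
    unfolding U0_def by (subst nn_integral_boltzmann) auto
  ultimately show ?thesis using l0 by (intro exI[of _ l]) (simp add: J_def)
qed

text \<open>
  The constant is first replaced by the optimal one, the mean; then \<open>d\<close> tends to \<open>0\<close>, again by
  Fatou.
\<close>

lemma log_sobolev_gap:
  assumes prob: "measure (boltzmann D E) UNIV = 1" "finite_measure (boltzmann D E)"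
    and m: "(\<integral>x. (f x)\<^sup>2 \<partial>boltzmann D E) > 0"
  shows "(\<integral>\<^sup>+x. ennreal (entropy_gap (\<integral>x. (f x)\<^sup>2 \<partial>boltzmann D E) ((f x)\<^sup>2)) \<partial>boltzmann D E)
     \<le> ennreal (2 / \<rho> * (\<integral>x. (norm (g x))\<^sup>2 \<partial>boltzmann D E))"
proof -
  let ?\<mu> = "boltzmann D E"
  interpret finite_measure ?\<mu> by fact
  define m where "m = (\<integral>x. (f x)\<^sup>2 \<partial>?\<mu>)"
  define R where "R = 2 / \<rho> * (\<integral>x. (norm (g x))\<^sup>2 \<partial>?\<mu>)"
  have m0: "m > 0" using m by (simp add: m_def)
  have shifted: "(\<integral>\<^sup>+x. ennreal (entropy_gap (m + d) ((f x)\<^sup>2 + d)) \<partial>?\<mu>) \<le> ennreal R" if d: "d > 0" for d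
  proof -
    obtain c where c: "c > 0" and le: "(\<integral>\<^sup>+x. ennreal (entropy_gap c ((f x)\<^sup>2 + d)) \<partial>?\<mu>) \<le> ennreal R"
      using log_sobolev_shifted[OF prob(2) d] unfolding R_def by auto
    have nn: "0 \<le> (f x)\<^sup>2 + d" for x using d by simp
    have gap0: "0 \<le> entropy_gap c ((f x)\<^sup>2 + d)" for x by (rule entropy_gap_nonneg[OF c nn])
    have gap1: "0 \<le> entropy_gap (m + d) ((f x)\<^sup>2 + d)" for x by (rule entropy_gap_nonneg[OF _ nn]) (use m0 d in simp)
    have i1: "integrable ?\<mu> (\<lambda>x. entropy_gap c ((f x)\<^sup>2 + d))"
      using le gap0 by (intro integrableI_bounded) (auto intro: le_less_trans)
    have i2: "integrable ?\<mu> (\<lambda>x. (f x)\<^sup>2 + d)" using f2 by simp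
    have "integrable ?\<mu> (\<lambda>x. entropy_gap c ((f x)\<^sup>2 + d) + ((f x)\<^sup>2 + d) * (ln c + 1) - c)"
      using i1 i2 f2 by (intro Bochner_Integration.integrable_add Bochner_Integration.integrable_diff integrable_mult_left) auto
    then have i3: "integrable ?\<mu> (\<lambda>x. ((f x)\<^sup>2 + d) * ln ((f x)\<^sup>2 + d))"
      by (simp add: entropy_gap_def algebra_simps)
    have md: "(\<integral>x. (f x)\<^sup>2 + d \<partial>?\<mu>) = (m + d) * measure ?\<mu> (space ?\<mu>)"
      using f2 prob by (simp add: m_def)
    have i4: "integrable ?\<mu> (\<lambda>x. entropy_gap (m + d) ((f x)\<^sup>2 + d))"
      unfolding entropy_gap_def using i2 i3 f2 by (intro Bochner_Integration.integrable_add Bochner_Integration.integrable_diff integrable_mult_left) auto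
    have "(\<integral>x. entropy_gap (m + d) ((f x)\<^sup>2 + d) \<partial>?\<mu>) \<le> (\<integral>x. entropy_gap c ((f x)\<^sup>2 + d) \<partial>?\<mu>)"
      by (rule integral_entropy_gap_mean_le(2)[OF i2 nn i3 c _ md]) (use m0 d in simp)
    then have "ennreal (\<integral>x. entropy_gap (m + d) ((f x)\<^sup>2 + d) \<partial>?\<mu>) \<le> ennreal (\<integral>x. entropy_gap c ((f x)\<^sup>2 + d) \<partial>?\<mu>)"
      by (rule ennreal_leI)
    also have "\<dots> \<le> ennreal R" using le i1 gap0 by (simp add: nn_integral_eq_integral)
    finally show ?thesis using i4 gap1 by (simp add: nn_integral_eq_integral)
  qed
  define d where "d n = 1 / real (Suc n)" for n
  have d: "d n > 0" for n by (simp add: d_def)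
  have dlim: "d \<longlonglongrightarrow> 0" unfolding d_def using LIMSEQ_inverse_real_of_nat by (simp add: inverse_eq_divide)
  have "(\<integral>\<^sup>+x. ennreal (entropy_gap m ((f x)\<^sup>2)) \<partial>?\<mu>) \<le> ennreal R"
  proof (rule nn_integral_le_of_AE_limit[where u = "\<lambda>n x. ennreal (entropy_gap (m + d n) ((f x)\<^sup>2 + d n))" and R = "\<lambda>_. ennreal R"])
    show "AE x in ?\<mu>. (\<lambda>n. ennreal (entropy_gap (m + d n) ((f x)\<^sup>2 + d n))) \<longlonglongrightarrow> ennreal (entropy_gap m ((f x)\<^sup>2))"
    proof (intro AE_I2 tendsto_ennrealI)
      fix x
      have "(\<lambda>n. m + d n) \<longlonglongrightarrow> m + 0" "(\<lambda>n. (f x)\<^sup>2 + d n) \<longlonglongrightarrow> (f x)\<^sup>2 + 0"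
        by (intro tendsto_intros dlim)+
      then show "(\<lambda>n. entropy_gap (m + d n) ((f x)\<^sup>2 + d n)) \<longlonglongrightarrow> entropy_gap m ((f x)\<^sup>2)"
        using m0 less_imp_le[OF d] by (intro tendsto_entropy_gap) auto
    qed
  qed (use shifted d in auto)
  then show ?thesis by (simp add: m_def R_def)
qed

end

section \<open>Gibbs measures on the chamber\<close>

lemma ereal_integral_integrable:
  assumes "integrable M h"
  shows "ereal_integral M h = ereal (\<integral>x. h x \<partial>M)"
proof -
  have fin: "(\<integral>\<^sup>+x. ennreal (h x) \<partial>M) < top" "(\<integral>\<^sup>+x. ennreal (- h x) \<partial>M) < top"
    using assms by (auto simp: real_integrable_def less_top)
  have "enn2ereal a = ereal (enn2real a)" if "a < top" for a
    using that by (cases a) (auto simp: enn2ereal_ennreal)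
  then show ?thesis
    unfolding ereal_integral_def real_lebesgue_integral_def[OF assms] using fin by simp
qed

lemma lebesgue_borel_version:
  fixes g :: "'a::euclidean_space \<Rightarrow> 'b::euclidean_space"
  assumes "g \<in> borel_measurable lebesgue"
  obtains g' where "g' \<in> borel_measurable borel" "AE x in lborel. g x = g' x"
proof -
  have "\<exists>h\<in>borel_measurable lborel. AE x in lborel. g x \<bullet> b = h x" for b
    using assms by (intro completion_ex_borel_measurable_real borel_measurable_inner) auto
  then have ex: "\<forall>b. \<exists>h. h \<in> borel_measurable borel \<and> (AE x in lborel. g x \<bullet> b = h x)"
    by auto
  obtain h where "\<forall>b. h b \<in> borel_measurable borel \<and> (AE x in lborel. g x \<bullet> b = h b x)"
    using choice[OF ex] by blast
  then have h: "\<And>b. h b \<in> borel_measurable borel" "\<And>b. AE x in lborel. g x \<bullet> b = h b x"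
    by blast+
  show thesis
  proof
    show "(\<lambda>x. \<Sum>b\<in>Basis. h b x *\<^sub>R b) \<in> borel_measurable borel"
      using h(1) by measurable
    have "AE x in lborel. \<forall>b\<in>Basis. g x \<bullet> b = h b x"
      using h(2) by (intro AE_finite_allI) auto
    then show "AE x in lborel. g x = (\<Sum>b\<in>Basis. h b x *\<^sub>R b)"
    proof eventually_elim
      case (elim x)
      then have "(\<Sum>b\<in>Basis. h b x *\<^sub>R b) = (\<Sum>b\<in>Basis. (g x \<bullet> b) *\<^sub>R b)" by simp
      then show ?case by (simp add: euclidean_representation)
    qed
  qed
qed

lemma
  fixes h h' :: "'a::euclidean_space \<Rightarrow> 'b::euclidean_space"
  assumes h: "h \<in> borel_measurable lebesgue" and h': "h' \<in> borel_measurable borel" and ae: "AE x in lborel. h x = h' x"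
  shows integrable_lebesgue_version: "integrable lebesgue h \<longleftrightarrow> integrable lborel h'"
    and integral_lebesgue_version: "(\<integral>x. h x \<partial>lebesgue) = (\<integral>x. h' x \<partial>lborel)"
proof -
  have m: "h' \<in> borel_measurable lebesgue" using h' by (intro measurable_completion) simp
  have ae': "AE x in lebesgue. h x = h' x" using ae by (rule AE_completion)
  show "integrable lebesgue h \<longleftrightarrow> integrable lborel h'"
    using integrable_cong_AE[OF h m ae'] integrable_completion[of h' lborel] h' by simp
  show "(\<integral>x. h x \<partial>lebesgue) = (\<integral>x. h' x \<partial>lborel)"
    using integral_cong_AE[OF h m ae'] integral_completion[of h' lborel] h' by simp
qed

lemma
  fixes h h' :: "'a::euclidean_space \<Rightarrow> real"
  assumes [measurable]: "D \<in> sets borel" "E \<in> borel_measurable borel"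
    and h: "h \<in> borel_measurable lebesgue" and h': "h' \<in> borel_measurable borel" and ae: "AE x in lborel. h x = h' x"
  defines "\<mu> \<equiv> density lebesgue (\<lambda>x. ennreal (indicator D x * exp (- E x)))"
  shows integrable_density_lebesgue: "integrable \<mu> h \<longleftrightarrow> integrable (boltzmann D E) h'"
    and integral_density_lebesgue: "(\<integral>x. h x \<partial>\<mu>) = (\<integral>x. h' x \<partial>boltzmann D E)"
proof -
  let ?w = "\<lambda>x. indicator D x * exp (- E x)"
  have wb: "?w \<in> borel_measurable borel" by measurable
  have w: "?w \<in> borel_measurable lebesgue" by (intro measurable_completion) (use wb in simp)
  have wh: "(\<lambda>x. ?w x * h x) \<in> borel_measurable lebesgue" by (intro borel_measurable_times w h)
  have wh': "(\<lambda>x. ?w x * h' x) \<in> borel_measurable borel" by (intro borel_measurable_times wb h')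
  have ae': "AE x in lborel. ?w x * h x = ?w x * h' x" using ae by eventually_elim simp
  have nn: "AE x in lebesgue. 0 \<le> ?w x" by simp
  show "integrable \<mu> h \<longleftrightarrow> integrable (boltzmann D E) h'"
    unfolding \<mu>_def integrable_density[OF h w nn] integrable_boltzmann[OF assms(1,2) h']
    using integrable_lebesgue_version[OF wh wh' ae'] by simp
  show "(\<integral>x. h x \<partial>\<mu>) = (\<integral>x. h' x \<partial>boltzmann D E)"
    unfolding \<mu>_def integral_density[OF h w nn] integral_boltzmann[OF assms(1,2) h']
    using integral_lebesgue_version[OF wh wh' ae'] by simp
qed

lemma test_functions_continuous:
  assumes "\<phi> \<in> test_functions D"
  shows "continuous_on UNIV \<phi>" "continuous_on UNIV (\<lambda>x. frechet_derivative \<phi> (at x) v)"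
proof -
  have "C_k 0 \<phi>" "C_k (Suc 0) \<phi>" using assms unfolding test_functions_def by blast+
  then show "continuous_on UNIV \<phi>" "continuous_on UNIV (\<lambda>x. frechet_derivative \<phi> (at x) v)" by simp_all
qed

text \<open>
  For mean \<open>0\<close> the function vanishes almost everywhere and so does the entropy. Otherwise the
  gap at the mean is integrable, which makes \<open>f\<^sup>2 ln f\<^sup>2\<close> integrable as well.
\<close>

lemma ent_le_of_entropy_gap:
  assumes prob: "finite_measure M" "measure M (space M) = 1"
    and f2: "integrable M (\<lambda>x. (f x)\<^sup>2)" and [measurable]: "f \<in> borel_measurable M" and R: "R \<ge> 0"
    and gap: "(\<integral>x. (f x)\<^sup>2 \<partial>M) > 0 \<Longrightarrow> (\<integral>\<^sup>+x. ennreal (entropy_gap (\<integral>x. (f x)\<^sup>2 \<partial>M) ((f x)\<^sup>2)) \<partial>M) \<le> ennreal R"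
  shows "integrable M (\<lambda>x. (f x)\<^sup>2 * ln ((f x)\<^sup>2))"
    "(\<integral>x. (f x)\<^sup>2 * ln ((f x)\<^sup>2) \<partial>M) - (\<integral>x. (f x)\<^sup>2 \<partial>M) * ln (\<integral>x. (f x)\<^sup>2 \<partial>M) \<le> R"
proof -
  interpret finite_measure M by fact
  define m where "m = (\<integral>x. (f x)\<^sup>2 \<partial>M)"
  have "integrable M (\<lambda>x. (f x)\<^sup>2 * ln ((f x)\<^sup>2)) \<and> (\<integral>x. (f x)\<^sup>2 * ln ((f x)\<^sup>2) \<partial>M) - m * ln m \<le> R"
  proof (cases "m > 0")
    case False
    moreover have "m \<ge> 0" unfolding m_def by (intro integral_nonneg_AE) simp
    ultimately have "m = 0" by simp
    then have "AE x in M. (f x)\<^sup>2 = 0"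
      using integral_nonneg_eq_0_iff_AE[OF f2] by (simp add: m_def)
    then have ae: "AE x in M. (f x)\<^sup>2 * ln ((f x)\<^sup>2) = 0" by eventually_elim simp
    have "integrable M (\<lambda>x. (f x)\<^sup>2 * ln ((f x)\<^sup>2)) \<longleftrightarrow> integrable M (\<lambda>x. 0 :: real)"
      using ae by (intro integrable_cong_AE) auto
    moreover have "(\<integral>x. (f x)\<^sup>2 * ln ((f x)\<^sup>2) \<partial>M) = (\<integral>x. 0 \<partial>M)"
      using ae by (intro integral_cong_AE) auto
    ultimately show ?thesis using R \<open>m = 0\<close> by simp
  next
    case True
    have g: "(\<integral>\<^sup>+x. ennreal (entropy_gap m ((f x)\<^sup>2)) \<partial>M) \<le> ennreal R" using gap True by (simp add: m_def)
    have g0: "0 \<le> entropy_gap m ((f x)\<^sup>2)" for x by (rule entropy_gap_nonneg[OF True]) simp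
    have i1: "integrable M (\<lambda>x. entropy_gap m ((f x)\<^sup>2))"
      using g g0 by (intro integrableI_bounded) (auto intro: le_less_trans)
    have "integrable M (\<lambda>x. entropy_gap m ((f x)\<^sup>2) + (f x)\<^sup>2 * (ln m + 1) - m)"
      using i1 f2 by (intro Bochner_Integration.integrable_add Bochner_Integration.integrable_diff integrable_mult_left) auto
    then have i2: "integrable M (\<lambda>x. (f x)\<^sup>2 * ln ((f x)\<^sup>2))"
      by (simp add: entropy_gap_def algebra_simps)
    have "(\<integral>x. entropy_gap m ((f x)\<^sup>2) \<partial>M) = (\<integral>x. (f x)\<^sup>2 * ln ((f x)\<^sup>2) \<partial>M) - m * ln m"
      using integral_entropy_gap_mean_le(1)[OF f2 _ i2 True True] prob by (simp add: m_def)
    moreover have "(\<integral>x. entropy_gap m ((f x)\<^sup>2) \<partial>M) \<le> R"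
      using g i1 g0 R by (simp add: nn_integral_eq_integral ennreal_le_iff)
    ultimately show ?thesis using i2 by simp
  qed
  then show "integrable M (\<lambda>x. (f x)\<^sup>2 * ln ((f x)\<^sup>2))"
    "(\<integral>x. (f x)\<^sup>2 * ln ((f x)\<^sup>2) \<partial>M) - (\<integral>x. (f x)\<^sup>2 \<partial>M) * ln (\<integral>x. (f x)\<^sup>2 \<partial>M) \<le> R"
    by (simp_all add: m_def)
qed

text \<open>
  The measure is a density over the completed Lebesgue measure, so \<open>f\<close> and \<open>g\<close> are replaced by
  Borel measurable functions that agree with them almost everywhere.
\<close>

theorem log_sobolev_strongly_log_concave:
  fixes E f :: "real ^ 'n \<Rightarrow> real" and g :: "real ^ 'n \<Rightarrow> real ^ 'n"
  assumes D: "open D" "convex D" "D \<noteq> {}"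
    and \<rho>: "\<rho> > 0" and sc: "strongly_convex_on D \<rho> E"
    and Em[measurable]: "E \<in> borel_measurable borel"
  defines "\<mu> \<equiv> density lebesgue (\<lambda>x. ennreal (indicator D x * exp (- E x)))"
  assumes prob: "emeasure (boltzmann D E) UNIV = 1"
    and f: "f \<in> L2 \<mu>" and g: "g \<in> L2 \<mu>" and weak: "weak_gradient_on D f g"
  shows "ent \<mu> (\<lambda>x. (f x)\<^sup>2) \<le> ereal (2 / \<rho> * (\<integral>x. (norm (g x))\<^sup>2 \<partial>\<mu>))"
proof -
  have Db[measurable]: "D \<in> sets borel" using D by simp
  have sets: "sets \<mu> = sets lebesgue" by (simp add: \<mu>_def)
  have fm: "f \<in> borel_measurable lebesgue" and gm: "g \<in> borel_measurable lebesgue"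
    and if2: "integrable \<mu> (\<lambda>x. (f x)\<^sup>2)" and ig2: "integrable \<mu> (\<lambda>x. (norm (g x))\<^sup>2)"
    using f g unfolding L2_def by (auto simp: measurable_cong_sets[OF sets refl])
  obtain F where F[measurable]: "F \<in> borel_measurable borel" and fF: "AE x in lborel. f x = F x"
    using lebesgue_borel_version[OF fm] by blast
  obtain G where G[measurable]: "G \<in> borel_measurable borel" and gG: "AE x in lborel. g x = G x"
    using lebesgue_borel_version[OF gm] by blast
  have fin: "finite_measure (boltzmann D E)" using prob by (intro finite_measureI) simp
  have meas1: "measure (boltzmann D E) UNIV = 1" using prob by (simp add: measure_def)
  have f2m: "(\<lambda>x. (f x)\<^sup>2) \<in> borel_measurable lebesgue" using fm by simp
  have g2m: "(\<lambda>x. (norm (g x))\<^sup>2) \<in> borel_measurable lebesgue" using gm by simp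
  have F2m: "(\<lambda>x. (F x)\<^sup>2) \<in> borel_measurable borel" "(\<lambda>x. (norm (G x))\<^sup>2) \<in> borel_measurable borel" by measurable
  have ae2: "AE x in lborel. (f x)\<^sup>2 = (F x)\<^sup>2" "AE x in lborel. (norm (g x))\<^sup>2 = (norm (G x))\<^sup>2"
    using fF gG by (auto elim: eventually_mono)
  note tf = integrable_density_lebesgue[OF Db Em f2m F2m(1) ae2(1), folded \<mu>_def]
    integral_density_lebesgue[OF Db Em f2m F2m(1) ae2(1), folded \<mu>_def]
  note tg = integrable_density_lebesgue[OF Db Em g2m F2m(2) ae2(2), folded \<mu>_def]
    integral_density_lebesgue[OF Db Em g2m F2m(2) ae2(2), folded \<mu>_def]
  have iF2: "integrable (boltzmann D E) (\<lambda>x. (F x)\<^sup>2)" using tf if2 by simp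
  have iG2: "integrable (boltzmann D E) (\<lambda>x. (norm (G x))\<^sup>2)" using tg ig2 by simp
  define R where "R = 2 / \<rho> * (\<integral>x. (norm (G x))\<^sup>2 \<partial>boltzmann D E)"
  have R0: "R \<ge> 0" unfolding R_def using \<rho> by (intro mult_nonneg_nonneg integral_nonneg_AE) auto
  have loc: "integrable lborel (\<lambda>x. indicator L x *\<^sub>R F x)" "integrable lborel (\<lambda>x. indicator L x *\<^sub>R G x)"
    if L: "compact L" "L \<subseteq> D" for L
  proof -
    have Lb[measurable]: "L \<in> sets borel" using L by (simp add: borel_compact)
    have i: "integrable lebesgue (\<lambda>x. indicator L x *\<^sub>R f x)" "integrable lebesgue (\<lambda>x. indicator L x *\<^sub>R g x)"
      using weak L unfolding weak_gradient_on_def set_integrable_def by blast+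
    have ae: "AE x in lborel. indicator L x *\<^sub>R f x = indicator L x *\<^sub>R F x"
      "AE x in lborel. indicator L x *\<^sub>R g x = indicator L x *\<^sub>R G x"
      using fF gG by (auto elim: eventually_mono)
    show "integrable lborel (\<lambda>x. indicator L x *\<^sub>R F x)"
      using i(1) by (subst integrable_lebesgue_version[OF _ _ ae(1), symmetric]) auto
    show "integrable lborel (\<lambda>x. indicator L x *\<^sub>R G x)"
      using i(2) by (subst integrable_lebesgue_version[OF _ _ ae(2), symmetric]) auto
  qed
  have weak': "(\<integral>x. F x * frechet_derivative \<phi> (at x) b \<partial>lborel) = - (\<integral>x. (G x \<bullet> b) * \<phi> x \<partial>lborel)"
    if \<phi>: "\<phi> \<in> test_functions D" and b: "b \<in> Basis" for \<phi> b
  proof -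
    obtain i where i: "b = axis i 1" using b by (auto simp: Basis_vec_def)
    have c[measurable]: "\<phi> \<in> borel_measurable borel" "(\<lambda>x. frechet_derivative \<phi> (at x) b) \<in> borel_measurable borel"
      using test_functions_continuous[OF \<phi>] by (auto intro: borel_measurable_continuous_onI)
    have cl: "\<phi> \<in> borel_measurable lebesgue" "(\<lambda>x. frechet_derivative \<phi> (at x) b) \<in> borel_measurable lebesgue"
      by (intro measurable_completion; simp add: c)+
    have 1: "(\<integral>x. f x * frechet_derivative \<phi> (at x) b \<partial>lebesgue) = (\<integral>x. F x * frechet_derivative \<phi> (at x) b \<partial>lborel)"
      by (rule integral_lebesgue_version) (use fF in \<open>auto elim: eventually_mono intro!: borel_measurable_times fm cl F c\<close>)
    have 2: "(\<integral>x. (g x \<bullet> b) * \<phi> x \<partial>lebesgue) = (\<integral>x. (G x \<bullet> b) * \<phi> x \<partial>lborel)"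
      by (rule integral_lebesgue_version) (use gG in \<open>auto elim: eventually_mono intro!: borel_measurable_times borel_measurable_inner gm cl G c\<close>)
    have "(\<integral>x. f x * frechet_derivative \<phi> (at x) b \<partial>lebesgue) = - (\<integral>x. (g x \<bullet> b) * \<phi> x \<partial>lebesgue)"
      using weak \<phi> unfolding weak_gradient_on_def i by (simp add: inner_axis)
    then show ?thesis using 1 2 by simp
  qed
  have gap: "(\<integral>\<^sup>+x. ennreal (entropy_gap (\<integral>x. (F x)\<^sup>2 \<partial>boltzmann D E) ((F x)\<^sup>2)) \<partial>boltzmann D E) \<le> ennreal R"
    if "(\<integral>x. (F x)\<^sup>2 \<partial>boltzmann D E) > 0"
    unfolding R_def
    by (rule log_concave_sobolev.log_sobolev_gap[OF log_concave_sobolev.intro[OF D \<rho> sc Em F G iF2 iG2 loc weak'] meas1 fin that])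
  have Fm': "F \<in> borel_measurable (boltzmann D E)" by measurable
  have meas1': "measure (boltzmann D E) (space (boltzmann D E)) = 1" using meas1 by simp
  note fin_ent = ent_le_of_entropy_gap[OF fin meas1' iF2 Fm' R0 gap]
  have fl: "(\<lambda>x. (f x)\<^sup>2 * ln ((f x)\<^sup>2)) \<in> borel_measurable lebesgue"
    using fm by measurable
  have Fl: "(\<lambda>x. (F x)\<^sup>2 * ln ((F x)\<^sup>2)) \<in> borel_measurable borel" by measurable
  have ael: "AE x in lborel. (f x)\<^sup>2 * ln ((f x)\<^sup>2) = (F x)\<^sup>2 * ln ((F x)\<^sup>2)"
    using fF by (auto elim: eventually_mono)
  have "integrable \<mu> (\<lambda>x. (f x)\<^sup>2 * ln ((f x)\<^sup>2))"
    using fin_ent(1) integrable_density_lebesgue[OF Db Em fl Fl ael, folded \<mu>_def] by simp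
  then have "ent \<mu> (\<lambda>x. (f x)\<^sup>2) = ereal ((\<integral>x. (f x)\<^sup>2 * ln ((f x)\<^sup>2) \<partial>\<mu>) - (\<integral>x. (f x)\<^sup>2 \<partial>\<mu>) * ln (\<integral>x. (f x)\<^sup>2 \<partial>\<mu>))"
    unfolding ent_def by (simp add: ereal_integral_integrable)
  also have "(\<integral>x. (f x)\<^sup>2 * ln ((f x)\<^sup>2) \<partial>\<mu>) = (\<integral>x. (F x)\<^sup>2 * ln ((F x)\<^sup>2) \<partial>boltzmann D E)"
    using integral_density_lebesgue[OF Db Em fl Fl ael, folded \<mu>_def] .
  finally show ?thesis using fin_ent(2) unfolding tf(2) tg(2) R_def by simp
qed

lemma strongly_convex_on_potential:
  assumes V: "rho_convex \<rho> (\<lambda>x. ereal (V x))"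
  shows "strongly_convex_on D \<rho> V"
  unfolding strongly_convex_on_def
proof (intro ballI allI impI)
  fix x y :: 'a and t s :: real assume ts: "t > 0" "s > 0" "t + s = 1"
  let ?q = "\<lambda>x. V x - \<rho> * (norm x)\<^sup>2 / 2"
  have "ereal (?q (t *\<^sub>R x + s *\<^sub>R y)) \<le> ereal t * ereal (?q x) + ereal s * ereal (?q y)"
    using V ts unfolding rho_convex_def convex_ereal_def by (simp del: times_ereal.simps plus_ereal.simps)
  then have le: "?q (t *\<^sub>R x + s *\<^sub>R y) \<le> t * ?q x + s * ?q y" by simp
  have s: "s = 1 - t" using ts by simp
  have N: "(norm (t *\<^sub>R x + s *\<^sub>R y))\<^sup>2 = t * (norm x)\<^sup>2 + s * (norm y)\<^sup>2 - t * s * (norm (x - y))\<^sup>2"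
    unfolding power2_norm_eq_inner s
    by (simp add: inner_add_left inner_add_right inner_diff_left inner_diff_right inner_commute[of y x] algebra_simps)
  have eq: "\<rho> * (norm (t *\<^sub>R x + s *\<^sub>R y))\<^sup>2 / 2 = t * (\<rho> * (norm x)\<^sup>2 / 2) + s * (\<rho> * (norm y)\<^sup>2 / 2) - \<rho> * t * s / 2 * (norm (x - y))\<^sup>2"
    unfolding N by (simp add: field_simps)
  show "V (t *\<^sub>R x + s *\<^sub>R y) \<le> t * V x + s * V y - \<rho> * t * s / 2 * (norm (x - y))\<^sup>2"
    using le[unfolded right_diff_distrib] eq by linarith
qed

lemma open_chamber: "open (chamber :: (real ^ 'n::{finite,linorder}) set)"
proof -
  have "chamber = (\<Inter>i. \<Inter>j. {x :: real ^ 'n::{finite,linorder}. i < j \<longrightarrow> x $ j < x $ i})" by (auto simp: chamber_def)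
  also have "open \<dots>"
  proof (intro open_INT finite ballI)
    fix i j :: 'n
    show "open {x :: real ^ 'n::{finite,linorder}. i < j \<longrightarrow> x $ j < x $ i}"
      by (cases "i < j") (auto intro!: open_Collect_less continuous_intros)
  qed
  finally show ?thesis .
qed

lemma convex_chamber: "convex (chamber :: (real ^ 'n::{finite,linorder}) set)"
proof (rule convexI)
  fix x y :: "real ^ 'n::{finite,linorder}" and u v :: real
  assume x: "x \<in> chamber" and y: "y \<in> chamber" and uv: "0 \<le> u" "0 \<le> v" "u + v = 1"
  show "u *\<^sub>R x + v *\<^sub>R y \<in> chamber"
    unfolding chamber_def
  proof (intro CollectI allI impI)
    fix i j :: 'n assume ij: "i < j"
    have xy: "x $ j < x $ i" "y $ j < y $ i" using x y ij by (auto simp: chamber_def)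
    have "u * x $ j + v * y $ j < u * x $ i + v * y $ i"
    proof (cases "u = 0")
      case True
      then show ?thesis using xy uv by simp
    next
      case False
      then have "u * x $ j < u * x $ i" "v * y $ j \<le> v * y $ i" using xy uv by (auto intro: mult_left_mono)
      then show ?thesis by linarith
    qed
    then show "(u *\<^sub>R x + v *\<^sub>R y) $ j < (u *\<^sub>R x + v *\<^sub>R y) $ i" by simp
  qed
qed

lemma chamber_nonempty: "(chamber :: (real ^ 'n::{finite,linorder}) set) \<noteq> {}"
proof -
  have "(\<chi> i. - real (card {k. k < i})) \<in> (chamber :: (real ^ 'n::{finite,linorder}) set)"
    unfolding chamber_def
  proof (intro CollectI allI impI)
    fix i j :: 'n assume "i < j"
    then have "{k. k < i} \<subset> {k. k < j}" by auto
    then have "card {k. k < i} < card {k. k < j}" by (intro psubset_card_mono) auto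
    then show "(\<chi> i. - real (card {k. k < i})) $ j < (\<chi> i. - real (card {k. k < i})) $ i" by simp
  qed
  then show ?thesis by blast
qed

definition real_energy :: "(real ^ 'n::{finite,linorder} \<Rightarrow> real) \<Rightarrow> (real \<Rightarrow> ereal) \<Rightarrow> real ^ 'n::{finite,linorder} \<Rightarrow> real" where
  "real_energy V W x = V x + (\<Sum>(i, j)\<in>{(i, j). i < j}. real_of_ereal (W (x $ i - x $ j)))"

lemma energy_on_chamber:
  fixes x :: "real ^ 'n::{finite,linorder}"
  assumes W: "convex_ereal W" "\<forall>u>0. W u \<noteq> \<infinity>" and x: "x \<in> chamber"
  shows "energy V W x = ereal (real_energy V W x)"
proof -
  have "(\<Sum>(i, j)\<in>{(i, j). i < j}. W (x $ i - x $ j)) = (\<Sum>(i, j)\<in>{(i, j). i < j}. ereal (real_of_ereal (W (x $ i - x $ j))))"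
  proof (intro sum.cong refl, clarify)
    fix i j :: 'n assume "i < j"
    then have "x $ i - x $ j > 0" using x by (simp add: chamber_def)
    then have "W (x $ i - x $ j) \<noteq> \<infinity>" "W (x $ i - x $ j) \<noteq> -\<infinity>" using W by (auto simp: convex_ereal_def)
    then show "W (x $ i - x $ j) = ereal (real_of_ereal (W (x $ i - x $ j)))"
      by (cases "W (x $ i - x $ j)") auto
  qed
  then show ?thesis unfolding energy_def real_energy_def by (simp add: case_prod_unfold)
qed

lemma energy_off_chamber:
  fixes x :: "real ^ 'n::{finite,linorder}"
  assumes W: "\<forall>u\<le>0. W u = \<infinity>" and x: "x \<notin> chamber"
  shows "energy V W x = \<infinity>"
proof -
  obtain i j where ij: "i < j" "x $ i \<le> x $ j" using x by (auto simp: chamber_def not_less)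
  then have "W (x $ i - x $ j) = \<infinity>" using W by simp
  then have "(\<Sum>(i, j)\<in>{(i, j). i < j}. W (x $ i - x $ j)) = \<infinity>"
    using ij(1) by (subst sum_Pinfty) (auto intro!: bexI[of _ "(i, j)"])
  then show ?thesis by (simp add: energy_def)
qed

text \<open>
  Each difference of coordinates is linear, so the interaction is convex and the modulus of
  \<open>V\<close> survives.
\<close>

lemma strongly_convex_on_real_energy:
  fixes V :: "real ^ 'n::{finite,linorder} \<Rightarrow> real"
  assumes V: "rho_convex \<rho> (\<lambda>x. ereal (V x))" and W: "convex_ereal W" "\<forall>u>0. W u \<noteq> \<infinity>"
  shows "strongly_convex_on chamber \<rho> (real_energy V W)"
  unfolding strongly_convex_on_def
proof (intro ballI allI impI)
  fix x y :: "real ^ 'n::{finite,linorder}" and t s :: real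
  assume x: "x \<in> chamber" and y: "y \<in> chamber" and ts: "t > 0" "s > 0" "t + s = 1"
  let ?w = "\<lambda>u. real_of_ereal (W u)"
  have fin: "W u = ereal (?w u)" if "u > 0" for u
  proof -
    have "W u \<noteq> \<infinity>" "W u \<noteq> -\<infinity>" using W that by (auto simp: convex_ereal_def)
    then show ?thesis by (cases "W u") auto
  qed
  have wconv: "?w (t * a + s * b) \<le> t * ?w a + s * ?w b" if "a > 0" "b > 0" for a b
  proof -
    have "t * a + s * b > 0" using that ts by (simp add: add_pos_pos)
    moreover have "W (t * a + s * b) \<le> ereal t * W a + ereal s * W b"
      using W(1) ts unfolding convex_ereal_def by simp
    ultimately have "ereal (?w (t * a + s * b)) \<le> ereal t * ereal (?w a) + ereal s * ereal (?w b)"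
      using fin that by metis
    then show ?thesis by simp
  qed
  have "(\<Sum>(i, j)\<in>{(i, j). i < j}. ?w ((t *\<^sub>R x + s *\<^sub>R y) $ i - (t *\<^sub>R x + s *\<^sub>R y) $ j))
    \<le> (\<Sum>(i, j)\<in>{(i, j). i < j}. t * ?w (x $ i - x $ j) + s * ?w (y $ i - y $ j))"
  proof (intro sum_mono, clarify)
    fix i j :: 'n assume "i < j"
    then have "x $ i - x $ j > 0" "y $ i - y $ j > 0" using x y by (auto simp: chamber_def)
    from wconv[OF this]
    show "?w ((t *\<^sub>R x + s *\<^sub>R y) $ i - (t *\<^sub>R x + s *\<^sub>R y) $ j) \<le> t * ?w (x $ i - x $ j) + s * ?w (y $ i - y $ j)"
      by (simp add: algebra_simps)
  qed
  also have "\<dots> = t * (\<Sum>(i, j)\<in>{(i, j). i < j}. ?w (x $ i - x $ j)) + s * (\<Sum>(i, j)\<in>{(i, j). i < j}. ?w (y $ i - y $ j))"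
    by (simp add: case_prod_unfold sum.distrib sum_distrib_left)
  finally have sum: "(\<Sum>(i, j)\<in>{(i, j). i < j}. ?w ((t *\<^sub>R x + s *\<^sub>R y) $ i - (t *\<^sub>R x + s *\<^sub>R y) $ j))
    \<le> t * (\<Sum>(i, j)\<in>{(i, j). i < j}. ?w (x $ i - x $ j)) + s * (\<Sum>(i, j)\<in>{(i, j). i < j}. ?w (y $ i - y $ j))" .
  have "V (t *\<^sub>R x + s *\<^sub>R y) \<le> t * V x + s * V y - \<rho> * t * s / 2 * (norm (x - y))\<^sup>2"
    using strongly_convex_on_potential[OF V, of UNIV] ts unfolding strongly_convex_on_def by simp
  then show "real_energy V W (t *\<^sub>R x + s *\<^sub>R y) \<le> t * real_energy V W x + s * real_energy V W y - \<rho> * t * s / 2 * (norm (x - y))\<^sup>2"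
    unfolding real_energy_def using sum by (simp only: ring_distribs)
qed

text \<open>
  The normalising constant is absorbed into the potential as the additive constant \<open>ln Z\<close>.
\<close>

theorem log_sobolev_gibbs:
  fixes V :: "real ^ 'n::{finite,linorder} \<Rightarrow> real"
  assumes setting: "gibbs_setting \<rho> V W"
  defines "\<mu> \<equiv> gibbs_measure (energy V W)"
  assumes f: "f \<in> L2 \<mu>" and g: "g \<in> L2 \<mu>" and weak: "weak_gradient_on chamber f g"
  shows "ent \<mu> (\<lambda>x. (f x)\<^sup>2) \<le> ereal (2 / \<rho> * (\<integral>x. (norm (g x))\<^sup>2 \<partial>\<mu>))"
proof -
  let ?D = "chamber :: (real ^ 'n::{finite,linorder}) set" and ?u = "real_energy V W"
  have \<rho>: "\<rho> > 0" and V: "rho_convex \<rho> (\<lambda>x. ereal (V x))" and W: "convex_ereal W" "\<forall>u>0. W u \<noteq> \<infinity>" "\<forall>u\<le>0. W u = \<infinity>"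
    and Zfin: "partition_const (energy V W) < \<infinity>"
    using setting unfolding gibbs_setting_def by auto
  have sc: "strongly_convex_on ?D \<rho> ?u" by (rule strongly_convex_on_real_energy[OF V W(1,2)])
  have cont: "continuous_on ?D ?u"
    using strongly_convex_on_continuous[OF open_chamber convex_chamber sc] \<rho> by simp
  have [measurable]: "?D \<in> sets borel" by (rule borel_open[OF open_chamber])
  define E0 where "E0 x = indicator ?D x *\<^sub>R ?u x" for x
  have E0m[measurable]: "E0 \<in> borel_measurable borel"
    unfolding E0_def by (rule borel_measurable_continuous_on_indicator[OF _ cont]) (rule borel_open[OF open_chamber])
  have dens: "exp_neg (energy V W x) = indicator ?D x * exp (- E0 x)" for x
    using energy_on_chamber[OF W(1,2), of x V] energy_off_chamber[OF W(3), of x V]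
    by (cases "x \<in> ?D") (auto simp: exp_neg_def E0_def)
  define Z where "Z = enn2real (partition_const (energy V W))"
  have Zb: "partition_const (energy V W) = emeasure (boltzmann ?D E0) UNIV"
    unfolding partition_const_def dens nn_integral_completion by (simp add: boltzmann_def emeasure_density)
  have fin: "finite_measure (boltzmann ?D E0)" using Zfin Zb by (intro finite_measureI) auto
  obtain x0 r where "r > 0" "ball x0 r \<subseteq> ?D"
    using open_chamber chamber_nonempty open_contains_ball by blast
  then have "measure (boltzmann ?D E0) UNIV > 0" by (intro measure_boltzmann_pos[OF _ _ fin]) auto
  then have Z: "Z > 0" unfolding Z_def Zb by (simp add: measure_def)
  have Zeq: "partition_const (energy V W) = ennreal Z" unfolding Z_def using Zfin by simp
  define E where "E x = E0 x + ln Z" for x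
  have Em: "E \<in> borel_measurable borel" unfolding E_def by measurable
  have expE: "indicator ?D x * exp (- E x) = indicator ?D x * exp (- E0 x) / Z" for x
    using Z by (simp add: E_def exp_add[symmetric] exp_diff exp_minus field_simps)
  have \<mu>: "\<mu> = density lebesgue (\<lambda>x. ennreal (indicator ?D x * exp (- E x)))"
    unfolding \<mu>_def gibbs_measure_def dens Zeq expE using Z by (simp add: divide_ennreal)
  have scE: "strongly_convex_on ?D \<rho> E"
    unfolding strongly_convex_on_def
  proof (intro ballI allI impI)
    fix x y and t s :: real assume xy: "x \<in> ?D" "y \<in> ?D" and ts: "0 < t" "0 < s" "t + s = 1"
    have z: "t *\<^sub>R x + s *\<^sub>R y \<in> ?D" by (rule convexD[OF convex_chamber xy]) (use ts in auto)
    have "?u (t *\<^sub>R x + s *\<^sub>R y) \<le> t * ?u x + s * ?u y - \<rho> * t * s / 2 * (norm (x - y))\<^sup>2"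
      using sc xy ts unfolding strongly_convex_on_def by simp
    moreover have "t * ln Z + s * ln Z = ln Z" using ts by (simp add: distrib_right[symmetric])
    ultimately show "E (t *\<^sub>R x + s *\<^sub>R y) \<le> t * E x + s * E y - \<rho> * t * s / 2 * (norm (x - y))\<^sup>2"
      using xy z by (simp add: E_def E0_def distrib_left)
  qed
  have "emeasure (boltzmann ?D E) UNIV = (\<integral>\<^sup>+x. ennreal (indicator ?D x * exp (- E0 x)) / ennreal Z \<partial>lborel)"
    using Em Z by (simp add: boltzmann_def emeasure_density expE divide_ennreal)
  also have "\<dots> = (\<integral>\<^sup>+x. ennreal (indicator ?D x * exp (- E0 x)) \<partial>lborel) / ennreal Z"
    by (rule nn_integral_divide) measurable
  also have "(\<integral>\<^sup>+x. ennreal (indicator ?D x * exp (- E0 x)) \<partial>lborel) = ennreal Z"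
    using Zeq Zb by (simp add: boltzmann_def emeasure_density)
  finally have prob: "emeasure (boltzmann ?D E) UNIV = 1" using Z by (simp add: divide_ennreal)
  show ?thesis
    unfolding \<mu>
    by (rule log_sobolev_strongly_log_concave[OF open_chamber convex_chamber chamber_nonempty \<rho> scE Em prob])
       (use f g weak in \<open>simp_all add: \<mu>\<close>)
qed

section \<open>The beta Hermite ensemble\<close>

lemma nn_integral_gaussian_finite:
  assumes a: "a > 0"
  shows "(\<integral>\<^sup>+x. ennreal (exp (- (a * (x::real)\<^sup>2))) \<partial>lborel) < \<infinity>"
proof -
  define \<sigma> where "\<sigma> = sqrt (1 / (2 * a))"
  have \<sigma>: "\<sigma> > 0" "2 * \<sigma>\<^sup>2 = 1 / a" using a by (auto simp: \<sigma>_def)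
  have eq: "exp (- (a * x\<^sup>2)) = sqrt (2 * pi * \<sigma>\<^sup>2) * normal_density 0 \<sigma> x" for x
    using \<sigma> a by (simp add: normal_density_def)
  have "integrable lborel (\<lambda>x. exp (- (a * x\<^sup>2)))"
    unfolding eq using \<sigma>(1) by (intro integrable_mult_right integrable_normal_density)
  then show ?thesis by (simp add: nn_integral_eq_integral)
qed

lemma nn_integral_gaussian_euclidean_finite:
  assumes a: "a > 0"
  shows "(\<integral>\<^sup>+x. ennreal (exp (- (a * (norm (x::'a::euclidean_space))\<^sup>2))) \<partial>lborel) < \<infinity>"
proof -
  have "ennreal (exp (- (a * (norm x)\<^sup>2))) = (\<Prod>b\<in>Basis. ennreal (exp (- (a * (x \<bullet> b)\<^sup>2))))" for x :: 'a
  proof -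
    have "(norm x)\<^sup>2 = (\<Sum>b\<in>Basis. (x \<bullet> b)\<^sup>2)"
      unfolding power2_norm_eq_inner by (subst euclidean_inner) (simp add: power2_eq_square)
    then show ?thesis by (simp add: sum_distrib_left sum_negf[symmetric] exp_sum prod_ennreal)
  qed
  then have "(\<integral>\<^sup>+x. ennreal (exp (- (a * (norm (x::'a))\<^sup>2))) \<partial>lborel)
      = (\<Prod>b\<in>(Basis :: 'a set). \<integral>\<^sup>+x. ennreal (exp (- (a * x\<^sup>2))) \<partial>lborel)"
    by (simp only:) (subst nn_integral_lborel_prod, auto)
  also have "\<dots> < \<infinity>" using nn_integral_gaussian_finite[OF a] by (simp add: power_less_top_ennreal)
  finally show ?thesis .
qed

lemma convex_ereal_hermite_W:
  assumes \<beta>: "\<beta> > 0"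
  shows "convex_ereal (hermite_W \<beta>)"
  unfolding convex_ereal_def
proof (intro conjI allI impI)
  show "hermite_W \<beta> x \<noteq> -\<infinity>" for x by (simp add: hermite_W_def)
  fix x y u v :: real assume uv: "0 \<le> u" "0 \<le> v" "u + v = 1"
  show "hermite_W \<beta> (u *\<^sub>R x + v *\<^sub>R y) \<le> ereal u * hermite_W \<beta> x + ereal v * hermite_W \<beta> y"
  proof (cases "u = 0 \<or> v = 0")
    case True
    then show ?thesis using uv by (auto simp: zero_ereal_def[symmetric] one_ereal_def[symmetric])
  next
    case False
    then have pos: "u > 0" "v > 0" using uv by auto
    show ?thesis
    proof (cases "x > 0 \<and> y > 0")
      case True
      have "u * ln x + v * ln y \<le> ln (u *\<^sub>R x + v *\<^sub>R y)"
        using ln_concave True uv by (simp add: concave_on_iff)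
      then have "\<beta> * (u * ln x + v * ln y) \<le> \<beta> * ln (u *\<^sub>R x + v *\<^sub>R y)"
        using \<beta> by (intro mult_left_mono) auto
      moreover have "u *\<^sub>R x + v *\<^sub>R y > 0" using True pos by (simp add: add_pos_pos)
      ultimately show ?thesis using True by (simp add: hermite_W_def algebra_simps)
    next
      case False
      then have "ereal u * hermite_W \<beta> x = \<infinity> \<or> ereal v * hermite_W \<beta> y = \<infinity>"
        using pos by (auto simp: hermite_W_def)
      moreover have "ereal u * hermite_W \<beta> x \<noteq> -\<infinity>" "ereal v * hermite_W \<beta> y \<noteq> -\<infinity>"
        using pos by (auto simp: hermite_W_def)
      ultimately have eq: "ereal u * hermite_W \<beta> x + ereal v * hermite_W \<beta> y = \<infinity>" by auto
      show ?thesis unfolding eq by simp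
    qed
  qed
qed

text \<open>
  By \<open>ln u \<le> u\<close> the interaction is at most a multiple \<open>A |x|\<close> of the norm, and \<open>A |x|\<close> is at
  most \<open>n |x|\<^sup>2 / 4 + A\<^sup>2 / n\<close>. Half of the Gaussian exponent is left.
\<close>

lemma hermite_energy_lower_bound:
  assumes \<beta>: "\<beta> > 0"
  obtains K where "\<And>x :: real ^ 'n::{finite,linorder}. exp_neg (energy hermite_V (hermite_W \<beta>) x)
    \<le> exp K * exp (- (real CARD('n::{finite,linorder}) / 4 * (norm x)\<^sup>2))"
proof -
  let ?n = "real CARD('n::{finite,linorder})"
  let ?P = "{(i, j). i < j} :: ('n::{finite,linorder} \<times> 'n) set"
  \<comment> \<open>each of the pairs contributes at most \<open>\<beta> * 2 * norm x\<close>\<close>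
  define A where "A = real (card ?P) * (\<beta> * 2)"
  have n: "?n > 0" by simp
  have W: "convex_ereal (hermite_W \<beta>)" "\<forall>u>0. hermite_W \<beta> u \<noteq> \<infinity>" "\<forall>u\<le>0. hermite_W \<beta> u = \<infinity>"
    using convex_ereal_hermite_W[OF \<beta>] by (auto simp: hermite_W_def)
  have "exp_neg (energy hermite_V (hermite_W \<beta>) x) \<le> exp (A\<^sup>2 / ?n) * exp (- (?n / 4 * (norm x)\<^sup>2))"
    for x :: "real ^ 'n::{finite,linorder}"
  proof (cases "x \<in> chamber")
    case False
    then show ?thesis using energy_off_chamber[OF W(3) False, of hermite_V] by (simp add: exp_neg_def)
  next
    case True
    have "- A * norm x = (\<Sum>(i, j)\<in>?P. - (\<beta> * (2 * norm x)))"
      by (simp add: A_def case_prod_unfold)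
    also have "\<dots> \<le> (\<Sum>(i, j)\<in>?P. real_of_ereal (hermite_W \<beta> (x $ i - x $ j)))"
    proof (intro sum_mono, clarify)
      fix i j :: 'n assume "i < j"
      then have pos: "x $ i - x $ j > 0" using True by (simp add: chamber_def)
      have "ln (x $ i - x $ j) \<le> x $ i - x $ j - 1" by (rule ln_le_minus_one[OF pos])
      also have "\<dots> \<le> 2 * norm x" using component_le_norm_cart[of x i] component_le_norm_cart[of x j] by linarith
      finally have "\<beta> * ln (x $ i - x $ j) \<le> \<beta> * (2 * norm x)" using \<beta> by (intro mult_left_mono) auto
      then show "- (\<beta> * (2 * norm x)) \<le> real_of_ereal (hermite_W \<beta> (x $ i - x $ j))"
        using pos by (simp add: hermite_W_def)
    qed
    finally have "?n / 2 * (norm x)\<^sup>2 - A * norm x \<le> real_energy hermite_V (hermite_W \<beta>) x"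
      by (simp add: real_energy_def hermite_V_def)
    moreover have "?n / 4 * (norm x)\<^sup>2 - A\<^sup>2 / ?n \<le> ?n / 2 * (norm x)\<^sup>2 - A * norm x"
    proof -
      have "0 \<le> (?n * norm x / 2 - A)\<^sup>2 / ?n" by simp
      also have "\<dots> = ?n / 4 * (norm x)\<^sup>2 - A * norm x + A\<^sup>2 / ?n"
        using n by (simp add: power2_eq_square field_simps)
      finally show ?thesis by (simp add: field_simps)
    qed
    ultimately have "- real_energy hermite_V (hermite_W \<beta>) x \<le> A\<^sup>2 / ?n + - (?n / 4 * (norm x)\<^sup>2)" by linarith
    then have "exp (- real_energy hermite_V (hermite_W \<beta>) x) \<le> exp (A\<^sup>2 / ?n + - (?n / 4 * (norm x)\<^sup>2))"
      by (simp only: exp_le_cancel_iff)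
    also have "\<dots> = exp (A\<^sup>2 / ?n) * exp (- (?n / 4 * (norm x)\<^sup>2))" by (rule exp_add)
    finally show ?thesis
      using energy_on_chamber[OF W(1,2) True, of hermite_V] by (simp add: exp_neg_def)
  qed
  then show thesis by (rule that)
qed

lemma gibbs_setting_hermite:
  assumes \<beta>: "\<beta> > 0"
  shows "gibbs_setting (real CARD('n::{finite,linorder})) (hermite_V :: real ^ 'n::{finite,linorder} \<Rightarrow> real) (hermite_W \<beta>)"
  unfolding gibbs_setting_def
proof (intro conjI)
  show "rho_convex (real CARD('n)) (\<lambda>x :: real ^ 'n::{finite,linorder}. ereal (hermite_V x))"
    unfolding rho_convex_def convex_ereal_def hermite_V_def by (simp add: zero_ereal_def[symmetric])
  obtain K where K: "\<And>x :: real ^ 'n::{finite,linorder}. exp_neg (energy hermite_V (hermite_W \<beta>) x)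
    \<le> exp K * exp (- (real CARD('n) / 4 * (norm x)\<^sup>2))"
    using hermite_energy_lower_bound[OF \<beta>] by blast
  have "partition_const (energy (hermite_V :: real ^ 'n::{finite,linorder} \<Rightarrow> real) (hermite_W \<beta>))
    \<le> (\<integral>\<^sup>+x. ennreal (exp K) * ennreal (exp (- (real CARD('n) / 4 * (norm (x :: real ^ 'n::{finite,linorder}))\<^sup>2))) \<partial>lborel)"
    unfolding partition_const_def nn_integral_completion
    using K by (intro nn_integral_mono) (simp add: ennreal_mult[symmetric] ennreal_leI)
  also have "\<dots> = ennreal (exp K) * (\<integral>\<^sup>+x. ennreal (exp (- (real CARD('n) / 4 * (norm (x :: real ^ 'n::{finite,linorder}))\<^sup>2))) \<partial>lborel)"
    by (rule nn_integral_cmult) measurable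
  also have "\<dots> < \<infinity>"
    using nn_integral_gaussian_euclidean_finite[where 'a = "real ^ 'n::{finite,linorder}" and a = "real CARD('n) / 4"]
    by (simp add: ennreal_mult_less_top)
  finally show "partition_const (energy (hermite_V :: real ^ 'n::{finite,linorder} \<Rightarrow> real) (hermite_W \<beta>)) < \<infinity>" .
qed (use convex_ereal_hermite_W[OF \<beta>] in \<open>auto simp: hermite_W_def\<close>)

theorem theorem1p2:
  shows "(\<forall>\<rho> (V :: real ^ 'n::{finite,linorder} \<Rightarrow> real) W \<mu>.
            gibbs_setting \<rho> V W \<and> \<mu> = gibbs_measure (energy V W) \<longrightarrow>
            (\<forall>f \<in> H1 \<mu> chamber. \<forall>g \<in> L2 \<mu>. weak_gradient_on chamber f g \<longrightarrow>
               ent \<mu> (\<lambda>x. (f x)\<^sup>2) \<le> ereal (2 / \<rho> * (\<integral>x. (norm (g x))\<^sup>2 \<partial>\<mu>)))) \<and>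
         (\<forall>\<beta>>0. \<forall>\<mu>.
            gibbs_setting (real CARD('n::{finite,linorder})) (hermite_V :: real ^ 'n::{finite,linorder} \<Rightarrow> real) (hermite_W \<beta>) \<and>
            (\<mu> = gibbs_measure (energy (hermite_V :: real ^ 'n::{finite,linorder} \<Rightarrow> real) (hermite_W \<beta>)) \<longrightarrow>
             (\<forall>f \<in> H1 \<mu> chamber. \<forall>g \<in> L2 \<mu>. weak_gradient_on chamber f g \<longrightarrow>
                ent \<mu> (\<lambda>x. (f x)\<^sup>2) \<le> ereal (2 / real CARD('n::{finite,linorder}) * (\<integral>x. (norm (g x))\<^sup>2 \<partial>\<mu>)))))"
proof (intro conjI allI impI ballI)
  fix \<rho> and V :: "real ^ 'n::{finite,linorder} \<Rightarrow> real" and W \<mu> f g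
  assume "gibbs_setting \<rho> V W \<and> \<mu> = gibbs_measure (energy V W)" "f \<in> H1 \<mu> chamber" "g \<in> L2 \<mu>"
    "weak_gradient_on chamber f g"
  then show "ent \<mu> (\<lambda>x. (f x)\<^sup>2) \<le> ereal (2 / \<rho> * (\<integral>x. (norm (g x))\<^sup>2 \<partial>\<mu>))"
    using log_sobolev_gibbs[of \<rho> V W f g] by (simp add: H1_def)
next
  fix \<beta> :: real assume \<beta>: "\<beta> > 0"
  show "gibbs_setting (real CARD('n::{finite,linorder})) (hermite_V :: real ^ 'n::{finite,linorder} \<Rightarrow> real) (hermite_W \<beta>)"
    by (rule gibbs_setting_hermite[OF \<beta>])
  fix \<mu> and f :: "real ^ 'n::{finite,linorder} \<Rightarrow> real" and g
  assume "\<mu> = gibbs_measure (energy (hermite_V :: real ^ 'n::{finite,linorder} \<Rightarrow> real) (hermite_W \<beta>))"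
    "f \<in> H1 \<mu> chamber" "g \<in> L2 \<mu>" "weak_gradient_on chamber f g"
  then show "ent \<mu> (\<lambda>x. (f x)\<^sup>2) \<le> ereal (2 / real CARD('n::{finite,linorder}) * (\<integral>x. (norm (g x))\<^sup>2 \<partial>\<mu>))"
    using log_sobolev_gibbs[OF gibbs_setting_hermite[OF \<beta>, where 'n = 'n], of f g] by (simp add: H1_def)
qed

end
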